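(* For any Bousfield-Segal space $X$, the categories $\mathrm{Ho}(X)$ and $\mathrm{Ho}_B(X)$ coincide. In particular, $\mathrm{Ho}(X)$ is a groupoid.
   Context: For a bisimplicial set $X\colon\Delta^{op}\times\Delta^{op}\to\mathrm{Set}$, $X_{nm}=X([n],[m])$, write $X_n=X_{n\bullet}$ for the $n$-th column, a simplicial set; $d_i,s_i$ denote the horizontal structure maps between columns. $X$ is $v$-fibrant if it is fibrant in the Reedy (equivalently injective) model structure on simplicial objects $n\mapsto X_n$ in simplicial sets with the Kan-Quillen model structure. For a simplicial set $A$, $A\setminus X$ is the simplicial set with $(A\setminus X)_m=\mathrm{Hom}(A\mathbin{\Box}\Delta^m,X)$, where $(A\mathbin{\Box}B)_{nm}=A_n\times B_m$; thus $\Delta^n\setminus X\cong X_n$. Let $c_n\colon C_n\hookrightarrow\Delta^n$ be the inclusion of the union of the edges $\{0,i\}$, $0<i\le n$, and $\mathrm{sp}_n\colon\mathrm{Sp}_n\hookrightarrow\Delta^n$ the inclusion of the spine (union of the edges $\{i,i+1\}$). A $v$-fibrant $X$ is a Bousfield-Segal space if the Bousfield maps $\beta_n=c_n\setminus X\colon X_n\to C_n\setminus X=X_1\times^B_{X_0}\dots\times^B_{X_0}X_1$ (fibre product along $d_1$) are weak homotopy equivalences for all $n\ge 2$, and a Segal space if the Segal maps $\xi_n=\mathrm{sp}_n\setminus X\colon X_n\to\mathrm{Sp}_n\setminus X= X_1\times^S_{X_0}\dots\times^S_{X_0}X_1$ are weak homotopy equivalences for all $n\geq 2$. Every Bousfield-Segal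 space is a Segal space. For vertices $x,y\in X_{00}$, $X_1(x,y)$ is the fibre of $(d_1,d_0)\colon X_1\to X_0\times X_0$ over $(x,y)$, and $1_x:=s_0x$. $\mathrm{Ho}_B(X)$ has object set $X_{00}$, hom-sets $\pi_0X_1(x,y)$, and identities $[1_x]$. Its composition is as follows: choose a section $\mu_2$ of the acyclic fibration $\beta_2\colon X_2\to X_1\times^B_{X_0}X_1$, $\sigma\mapsto(d_1\sigma,d_2\sigma)$; put $f/g:=d_0\mu_2(f,g)$, which for $f\in X_1(x,y)$, $g\in X_1(x,z)$ lies in $X_1(z,y)$; then $[g]\circ[f]:=[g/(1_x/f)]$ for $f\in X_1(x,y)$, $g\in X_1(y,z)$. $\mathrm{Ho}(X)$ is Rezk's homotopy category of the Segal space $X$: it has object set $X_{00}$, hom-sets $\pi_0X_1(x,y)$, identities $[1_x]$, and composition $[g]\circ[f]:=[d_1\eta_2(f,g)]$, where $\eta_2$ is a section of the acyclic fibration $\xi_2\colon X_2\to X_1\times^S_{X_0}X_1$, $\sigma\mapsto(d_2\sigma,d_0\sigma)$. *)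

theory Defs
  imports Main "HOL-Library.FuncSet"
begin

section \<open>The simplex category\<close>

text \<open>A weakly monotone map \<open>[m] \<rightarrow> [n]\<close> is encoded as the list of its \<open>m + 1\<close> values.\<close>

definition ord_hom :: "nat \<Rightarrow> nat \<Rightarrow> nat list set" where
  "ord_hom m n = {\<alpha>. length \<alpha> = Suc m \<and> sorted \<alpha> \<and> set \<alpha> \<subseteq> {..n}}"

definition ord_id :: "nat \<Rightarrow> nat list" where
  "ord_id n = [0..<Suc n]"

definition ord_comp :: "nat list \<Rightarrow> nat list \<Rightarrow> nat list" where
  "ord_comp \<alpha> \<beta> = map (\<lambda>i. \<alpha> ! i) \<beta>"

text \<open>The injection \<open>[n - 1] \<rightarrow> [n]\<close> omitting \<open>i\<close>, and the surjection \<open>[n + 1] \<rightarrow> [n]\<close> repeating \<open>i\<close>.\<close>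

definition coface :: "nat \<Rightarrow> nat \<Rightarrow> nat list" where
  "coface n i = [0..<i] @ [Suc i..<Suc n]"

definition codegen :: "nat \<Rightarrow> nat \<Rightarrow> nat list" where
  "codegen n i = [0..<Suc i] @ [i..<Suc n]"


section \<open>Simplicial sets\<close>

text \<open>\<open>act A n \<alpha> : A\<^sub>n \<rightarrow> A\<^sub>m\<close> is the structure map of \<open>\<alpha> : [m] \<rightarrow> [n]\<close>; the source \<open>n\<close> is an
  argument because the sets of simplices of different dimensions need not be disjoint.\<close>

record 'a sset =
  simp :: "nat \<Rightarrow> 'a set"
  act :: "nat \<Rightarrow> nat list \<Rightarrow> 'a \<Rightarrow> 'a"

definition is_sset :: "'a sset \<Rightarrow> bool" where
  "is_sset A \<longleftrightarrow>
     (\<forall>m n. \<forall>\<alpha>\<in>ord_hom m n. act A n \<alpha> \<in> simp A n \<rightarrow> simp A m) \<and>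
     (\<forall>n. \<forall>x\<in>simp A n. act A n (ord_id n) x = x) \<and>
     (\<forall>k m n. \<forall>\<alpha>\<in>ord_hom m n. \<forall>\<beta>\<in>ord_hom k m. \<forall>x\<in>simp A n.
        act A n (ord_comp \<alpha> \<beta>) x = act A m \<beta> (act A n \<alpha> x))"

definition sface :: "'a sset \<Rightarrow> nat \<Rightarrow> nat \<Rightarrow> 'a \<Rightarrow> 'a" where
  "sface A n i = act A n (coface n i)"

text \<open>Simplicial maps are extensional families, so that maps that agree on all simplices are equal.\<close>

definition smaps :: "'a sset \<Rightarrow> 'b sset \<Rightarrow> (nat \<Rightarrow> 'a \<Rightarrow> 'b) set" where
  "smaps A B = {f. (\<forall>n. f n \<in> simp A n \<rightarrow>\<^sub>E simp B n) \<and>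
     (\<forall>m n. \<forall>\<alpha>\<in>ord_hom m n. \<forall>x\<in>simp A n. f m (act A n \<alpha> x) = act B n \<alpha> (f n x))}"

definition sprod :: "'a sset \<Rightarrow> 'b sset \<Rightarrow> ('a \<times> 'b) sset" where
  "sprod A B = \<lparr>simp = \<lambda>n. simp A n \<times> simp B n,
                act = \<lambda>n \<alpha>. map_prod (act A n \<alpha>) (act B n \<alpha>)\<rparr>"

definition simplex :: "nat \<Rightarrow> nat list sset" where
  "simplex n = \<lparr>simp = \<lambda>m. ord_hom m n, act = \<lambda>m \<beta> \<alpha>. ord_comp \<alpha> \<beta>\<rparr>"

definition subsimplex :: "nat \<Rightarrow> (nat set \<Rightarrow> bool) \<Rightarrow> nat list sset" where
  "subsimplex n P = \<lparr>simp = \<lambda>m. {\<alpha>\<in>ord_hom m n. P (set \<alpha>)}, act = act (simplex n)\<rparr>"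

definition boundary :: "nat \<Rightarrow> nat list sset" where
  "boundary n = subsimplex n (\<lambda>V. V \<noteq> {..n})"

definition horn :: "nat \<Rightarrow> nat \<Rightarrow> nat list sset" where
  "horn n k = subsimplex n (\<lambda>V. \<not> {..n} - {k} \<subseteq> V)"

definition star :: "nat \<Rightarrow> nat list sset" where
  "star n = subsimplex n (\<lambda>V. \<exists>i. 0 < i \<and> i \<le> n \<and> V \<subseteq> {0, i})"


section \<open>Kan fibrations and weak homotopy equivalences\<close>

definition kan_complex :: "'a sset \<Rightarrow> bool" where
  "kan_complex A \<longleftrightarrow> is_sset A \<and>
     (\<forall>n k. \<forall>u\<in>smaps (horn n k) A. 1 \<le> n \<and> k \<le> n \<longrightarrow>
        (\<exists>w\<in>smaps (simplex n) A. \<forall>m. \<forall>\<alpha>\<in>simp (horn n k) m. w m \<alpha> = u m \<alpha>))"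

definition kan_fibration :: "'a sset \<Rightarrow> 'b sset \<Rightarrow> (nat \<Rightarrow> 'a \<Rightarrow> 'b) \<Rightarrow> bool" where
  "kan_fibration E B p \<longleftrightarrow> p \<in> smaps E B \<and>
     (\<forall>n k. \<forall>u\<in>smaps (horn n k) E. \<forall>v\<in>smaps (simplex n) B.
        1 \<le> n \<and> k \<le> n \<and> (\<forall>m. \<forall>\<alpha>\<in>simp (horn n k) m. p m (u m \<alpha>) = v m \<alpha>) \<longrightarrow>
        (\<exists>w\<in>smaps (simplex n) E.
           (\<forall>m. \<forall>\<alpha>\<in>simp (horn n k) m. w m \<alpha> = u m \<alpha>) \<and>
           (\<forall>m. \<forall>\<alpha>\<in>simp (simplex n) m. p m (w m \<alpha>) = v m \<alpha>)))"

definition pi0_rel :: "'a sset \<Rightarrow> ('a \<times> 'a) set" where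
  "pi0_rel A = (let E = {(sface A 1 1 e, sface A 1 0 e) | e. e \<in> simp A 1}
                in Restr ((E \<union> E\<inverse>)\<^sup>*) (simp A 0))"

definition pi0_class :: "'a sset \<Rightarrow> 'a \<Rightarrow> 'a set" where
  "pi0_class A x = pi0_rel A `` {x}"

definition pi0 :: "'a sset \<Rightarrow> 'a set set" where
  "pi0 A = simp A 0 // pi0_rel A"

definition pi0_map :: "'a sset \<Rightarrow> 'b sset \<Rightarrow> (nat \<Rightarrow> 'a \<Rightarrow> 'b) \<Rightarrow> 'a set \<Rightarrow> 'b set" where
  "pi0_map A B f c = (\<Union>x\<in>c. pi0_class B (f 0 x))"

text \<open>The internal hom \<open>Z\<^sup>A\<close>, whose \<open>n\<close>-simplices are the maps \<open>A \<times> \<Delta>\<^sup>n \<rightarrow> Z\<close>, and the map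
  \<open>Z\<^sup>f : Z\<^sup>B \<rightarrow> Z\<^sup>A\<close> given by precomposition with \<open>f : A \<rightarrow> B\<close>.\<close>

definition shom :: "'a sset \<Rightarrow> 'c sset \<Rightarrow> (nat \<Rightarrow> 'a \<times> nat list \<Rightarrow> 'c) sset" where
  "shom A Z = \<lparr>simp = \<lambda>n. smaps (sprod A (simplex n)) Z,
     act = \<lambda>n \<beta> h k. \<lambda>(x, \<tau>)\<in>simp A k \<times> ord_hom k (length \<beta> - 1). h k (x, ord_comp \<beta> \<tau>)\<rparr>"

definition shom_pre :: "'a sset \<Rightarrow> (nat \<Rightarrow> 'a \<Rightarrow> 'b) \<Rightarrow> nat \<Rightarrow>
    (nat \<Rightarrow> 'b \<times> nat list \<Rightarrow> 'c) \<Rightarrow> nat \<Rightarrow> 'a \<times> nat list \<Rightarrow> 'c" where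
  "shom_pre A f n h = (\<lambda>k. \<lambda>(x, \<tau>)\<in>simp A k \<times> ord_hom k n. h k (f k x, \<tau>))"

text \<open>\<open>f : A \<rightarrow> B\<close> is a weak homotopy equivalence if \<open>\<pi>\<^sub>0(Z\<^sup>B) \<rightarrow> \<pi>\<^sub>0(Z\<^sup>A)\<close> is bijective for every
  Kan complex \<open>Z\<close>. Letting \<open>Z\<close> range over Kan complexes with simplices in \<open>('a + 'b) list\<close> is no
  restriction: testing against fibrant replacements of \<open>A\<close> and \<open>B\<close> suffices, and these can be
  chosen with at most \<open>max(\<aleph>\<^sub>0, |A|, |B|)\<close> simplices, so they have copies in that infinite type.\<close>

definition weak_equivalence :: "'a sset \<Rightarrow> 'b sset \<Rightarrow> (nat \<Rightarrow> 'a \<Rightarrow> 'b) \<Rightarrow> bool" where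
  "weak_equivalence A B f \<longleftrightarrow> f \<in> smaps A B \<and>
     (\<forall>Z :: ('a + 'b) list sset. kan_complex Z \<longrightarrow>
        bij_betw (pi0_map (shom B Z) (shom A Z) (shom_pre A f)) (pi0 (shom B Z)) (pi0 (shom A Z)))"


section \<open>Bisimplicial sets\<close>

text \<open>\<open>bact X n m \<alpha> \<beta> : X\<^sub>n\<^sub>m \<rightarrow> X\<^sub>k\<^sub>l\<close> is the structure map of \<open>\<alpha> : [k] \<rightarrow> [n]\<close> (horizontal) and
  \<open>\<beta> : [l] \<rightarrow> [m]\<close> (vertical).\<close>

record 'a bisset =
  bisimp :: "nat \<Rightarrow> nat \<Rightarrow> 'a set"
  bact :: "nat \<Rightarrow> nat \<Rightarrow> nat list \<Rightarrow> nat list \<Rightarrow> 'a \<Rightarrow> 'a"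

definition is_bisset :: "'a bisset \<Rightarrow> bool" where
  "is_bisset X \<longleftrightarrow>
     (\<forall>k l m n. \<forall>\<alpha>\<in>ord_hom k n. \<forall>\<beta>\<in>ord_hom l m.
        bact X n m \<alpha> \<beta> \<in> bisimp X n m \<rightarrow> bisimp X k l) \<and>
     (\<forall>m n. \<forall>x\<in>bisimp X n m. bact X n m (ord_id n) (ord_id m) x = x) \<and>
     (\<forall>k l m n k' l'. \<forall>\<alpha>\<in>ord_hom k n. \<forall>\<beta>\<in>ord_hom l m. \<forall>\<alpha>'\<in>ord_hom k' k. \<forall>\<beta>'\<in>ord_hom l' l.
        \<forall>x\<in>bisimp X n m.
        bact X n m (ord_comp \<alpha> \<alpha>') (ord_comp \<beta> \<beta>') x = bact X k l \<alpha>' \<beta>' (bact X n m \<alpha> \<beta> x))"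

definition bimaps :: "'a bisset \<Rightarrow> 'b bisset \<Rightarrow> (nat \<Rightarrow> nat \<Rightarrow> 'a \<Rightarrow> 'b) set" where
  "bimaps W X = {\<phi>. (\<forall>n m. \<phi> n m \<in> bisimp W n m \<rightarrow>\<^sub>E bisimp X n m) \<and>
     (\<forall>k l m n. \<forall>\<alpha>\<in>ord_hom k n. \<forall>\<beta>\<in>ord_hom l m. \<forall>x\<in>bisimp W n m.
        \<phi> k l (bact W n m \<alpha> \<beta> x) = bact X n m \<alpha> \<beta> (\<phi> n m x))}"

definition column :: "'a bisset \<Rightarrow> nat \<Rightarrow> 'a sset" where
  "column X n = \<lparr>simp = bisimp X n, act = \<lambda>m. bact X n m (ord_id n)\<rparr>"

text \<open>The horizontal \<open>d\<^sub>i : X\<^sub>n\<^sub>m \<rightarrow> X\<^sub>n\<^sub>-\<^sub>1\<^sub>,\<^sub>m\<close> and \<open>s\<^sub>i : X\<^sub>n\<^sub>m \<rightarrow> X\<^sub>n\<^sub>+\<^sub>1\<^sub>,\<^sub>m\<close>.\<close>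

definition hface :: "'a bisset \<Rightarrow> nat \<Rightarrow> nat \<Rightarrow> nat \<Rightarrow> 'a \<Rightarrow> 'a" where
  "hface X n m i = bact X n m (coface n i) (ord_id m)"

definition hdegen :: "'a bisset \<Rightarrow> nat \<Rightarrow> nat \<Rightarrow> nat \<Rightarrow> 'a \<Rightarrow> 'a" where
  "hdegen X n m i = bact X n m (codegen n i) (ord_id m)"

definition box :: "'a sset \<Rightarrow> 'b sset \<Rightarrow> ('a \<times> 'b) bisset" where
  "box A B = \<lparr>bisimp = \<lambda>n m. simp A n \<times> simp B m,
              bact = \<lambda>n m \<alpha> \<beta>. map_prod (act A n \<alpha>) (act B m \<beta>)\<rparr>"

text \<open>The simplicial set \<open>A \ X\<close>.\<close>

definition ldiv :: "'b sset \<Rightarrow> 'a bisset \<Rightarrow> (nat \<Rightarrow> nat \<Rightarrow> 'b \<times> nat list \<Rightarrow> 'a) sset" where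
  "ldiv A X = \<lparr>simp = \<lambda>m. bimaps (box A (simplex m)) X,
     act = \<lambda>m \<beta> \<phi> k l. \<lambda>(x, \<tau>)\<in>simp A k \<times> ord_hom l (length \<beta> - 1). \<phi> k l (x, ord_comp \<beta> \<tau>)\<rparr>"

text \<open>For \<open>A \<subseteq> \<Delta>\<^sup>n\<close>, the map \<open>X\<^sub>n \<cong> \<Delta>\<^sup>n \ X \<rightarrow> A \ X\<close> induced by the inclusion; the isomorphism is
  the Yoneda isomorphism, which sends \<open>\<sigma> \<in> X\<^sub>n\<^sub>m\<close> to the map \<open>(\<alpha>, \<beta>) \<mapsto> (\<alpha>, \<beta>)\<^sup>* \<sigma>\<close>.\<close>

definition ldiv_restrict :: "'a bisset \<Rightarrow> nat \<Rightarrow> nat list sset \<Rightarrow> nat \<Rightarrow>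
    'a \<Rightarrow> nat \<Rightarrow> nat \<Rightarrow> nat list \<times> nat list \<Rightarrow> 'a" where
  "ldiv_restrict X n A m =
     (\<lambda>\<sigma>\<in>bisimp X n m. \<lambda>k l. \<lambda>(\<alpha>, \<beta>)\<in>simp A k \<times> ord_hom l m. bact X n m \<alpha> \<beta> \<sigma>)"

text \<open>Reedy fibrancy: \<open>\<partial>\<Delta>\<^sup>n \ X\<close> is the \<open>n\<close>-th matching object of \<open>n \<mapsto> X\<^sub>n\<close>.\<close>

definition v_fibrant :: "'a bisset \<Rightarrow> bool" where
  "v_fibrant X \<longleftrightarrow> is_bisset X \<and>
     (\<forall>n. kan_fibration (column X n) (ldiv (boundary n) X) (ldiv_restrict X n (boundary n)))"

definition bousfield_segal_space :: "'a bisset \<Rightarrow> bool" where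
  "bousfield_segal_space X \<longleftrightarrow> v_fibrant X \<and>
     (\<forall>n\<ge>2. weak_equivalence (column X n) (ldiv (star n) X) (ldiv_restrict X n (star n)))"


section \<open>Homotopy categories\<close>

definition bousfield_pairs :: "'a bisset \<Rightarrow> ('a \<times> 'a) sset" where
  "bousfield_pairs X =
     \<lparr>simp = \<lambda>m. {(f, g). f \<in> bisimp X 1 m \<and> g \<in> bisimp X 1 m \<and> hface X 1 m 1 f = hface X 1 m 1 g},
      act = act (sprod (column X 1) (column X 1))\<rparr>"

definition segal_pairs :: "'a bisset \<Rightarrow> ('a \<times> 'a) sset" where
  "segal_pairs X =
     \<lparr>simp = \<lambda>m. {(f, g). f \<in> bisimp X 1 m \<and> g \<in> bisimp X 1 m \<and> hface X 1 m 0 f = hface X 1 m 1 g},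
      act = act (sprod (column X 1) (column X 1))\<rparr>"

definition bousfield_section :: "'a bisset \<Rightarrow> (nat \<Rightarrow> 'a \<times> 'a \<Rightarrow> 'a) \<Rightarrow> bool" where
  "bousfield_section X \<mu> \<longleftrightarrow> \<mu> \<in> smaps (bousfield_pairs X) (column X 2) \<and>
     (\<forall>m. \<forall>p\<in>simp (bousfield_pairs X) m. (hface X 2 m 1 (\<mu> m p), hface X 2 m 2 (\<mu> m p)) = p)"

definition segal_section :: "'a bisset \<Rightarrow> (nat \<Rightarrow> 'a \<times> 'a \<Rightarrow> 'a) \<Rightarrow> bool" where
  "segal_section X \<eta> \<longleftrightarrow> \<eta> \<in> smaps (segal_pairs X) (column X 2) \<and>
     (\<forall>m. \<forall>p\<in>simp (segal_pairs X) m. (hface X 2 m 2 (\<eta> m p), hface X 2 m 0 (\<eta> m p)) = p)"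

text \<open>The fibre \<open>X\<^sub>1(x, y)\<close> of \<open>(d\<^sub>1, d\<^sub>0) : X\<^sub>1 \<rightarrow> X\<^sub>0 \<times> X\<^sub>0\<close>; in dimension \<open>m\<close>, the vertices \<open>x\<close> and
  \<open>y\<close> are represented by their degeneracies in \<open>X\<^sub>0\<^sub>m\<close>.\<close>

definition const_simplex :: "'a bisset \<Rightarrow> nat \<Rightarrow> 'a \<Rightarrow> 'a" where
  "const_simplex X m = act (column X 0) 0 (replicate (Suc m) 0)"

definition map_space :: "'a bisset \<Rightarrow> 'a \<Rightarrow> 'a \<Rightarrow> 'a sset" where
  "map_space X x y =
     \<lparr>simp = \<lambda>m. {f \<in> bisimp X 1 m. x \<in> bisimp X 0 0 \<and> y \<in> bisimp X 0 0 \<and>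
                    hface X 1 m 1 f = const_simplex X m x \<and> hface X 1 m 0 f = const_simplex X m y},
      act = act (column X 1)\<rparr>"

definition id_edge :: "'a bisset \<Rightarrow> 'a \<Rightarrow> 'a" where
  "id_edge X x = hdegen X 0 0 0 x"

text \<open>\<open>Comp C x y z g f\<close> is the composite of \<open>f : x \<rightarrow> y\<close> and \<open>g : y \<rightarrow> z\<close>.\<close>

record ('o, 'm) cat =
  Obj :: "'o set"
  Hom :: "'o \<Rightarrow> 'o \<Rightarrow> 'm set"
  Ident :: "'o \<Rightarrow> 'm"
  Comp :: "'o \<Rightarrow> 'o \<Rightarrow> 'o \<Rightarrow> 'm \<Rightarrow> 'm \<Rightarrow> 'm"

definition is_category :: "('o, 'm) cat \<Rightarrow> bool" where
  "is_category C \<longleftrightarrow>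
     (\<forall>x\<in>Obj C. Ident C x \<in> Hom C x x) \<and>
     (\<forall>x\<in>Obj C. \<forall>y\<in>Obj C. \<forall>z\<in>Obj C. \<forall>f\<in>Hom C x y. \<forall>g\<in>Hom C y z.
        Comp C x y z g f \<in> Hom C x z) \<and>
     (\<forall>x\<in>Obj C. \<forall>y\<in>Obj C. \<forall>f\<in>Hom C x y.
        Comp C x x y f (Ident C x) = f \<and> Comp C x y y (Ident C y) f = f) \<and>
     (\<forall>w\<in>Obj C. \<forall>x\<in>Obj C. \<forall>y\<in>Obj C. \<forall>z\<in>Obj C. \<forall>f\<in>Hom C w x. \<forall>g\<in>Hom C x y. \<forall>h\<in>Hom C y z.
        Comp C w x z (Comp C x y z h g) f = Comp C w y z h (Comp C w x y g f))"

definition is_groupoid :: "('o, 'm) cat \<Rightarrow> bool" where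
  "is_groupoid C \<longleftrightarrow> is_category C \<and>
     (\<forall>x\<in>Obj C. \<forall>y\<in>Obj C. \<forall>f\<in>Hom C x y. \<exists>g\<in>Hom C y x.
        Comp C x y x g f = Ident C x \<and> Comp C y x y f g = Ident C y)"

text \<open>The operation that a section \<open>\<mu>\<close> of the Bousfield map induces on vertices: \<open>f/g = d\<^sub>0 \<mu>(f, g)\<close>.\<close>

definition bousfield_div :: "'a bisset \<Rightarrow> (nat \<Rightarrow> 'a \<times> 'a \<Rightarrow> 'a) \<Rightarrow> 'a \<Rightarrow> 'a \<Rightarrow> 'a" where
  "bousfield_div X \<mu> f g = hface X 2 0 0 (\<mu> 0 (f, g))"

text \<open>Composition in the following two structures takes the union of the classes obtained from all
  choices of representatives. That union is again a class exactly if the class is independent of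
  the representatives, so \<open>is_category\<close> includes well-definedness of the composition.\<close>

definition Ho_B :: "'a bisset \<Rightarrow> (nat \<Rightarrow> 'a \<times> 'a \<Rightarrow> 'a) \<Rightarrow> ('a, 'a set) cat" where
  "Ho_B X \<mu> = \<lparr>Obj = bisimp X 0 0,
     Hom = \<lambda>x y. pi0 (map_space X x y),
     Ident = \<lambda>x. pi0_class (map_space X x x) (id_edge X x),
     Comp = \<lambda>x y z G F.
       \<Union>f \<in> F \<inter> simp (map_space X x y) 0. \<Union>g \<in> G \<inter> simp (map_space X y z) 0.
         pi0_class (map_space X x z) (bousfield_div X \<mu> g (bousfield_div X \<mu> (id_edge X x) f))\<rparr>"

definition Ho :: "'a bisset \<Rightarrow> (nat \<Rightarrow> 'a \<times> 'a \<Rightarrow> 'a) \<Rightarrow> ('a, 'a set) cat" where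
  "Ho X \<eta> = \<lparr>Obj = bisimp X 0 0,
     Hom = \<lambda>x y. pi0 (map_space X x y),
     Ident = \<lambda>x. pi0_class (map_space X x x) (id_edge X x),
     Comp = \<lambda>x y z G F.
       \<Union>f \<in> F \<inter> simp (map_space X x y) 0. \<Union>g \<in> G \<inter> simp (map_space X y z) 0.
         pi0_class (map_space X x z) (hface X 2 0 1 (\<eta> 0 (f, g)))\<rparr>"

end

theory Submission
  imports Defs
begin

text \<open>
  Why the statement holds. A section \<open>\<mu>\<close> of the Bousfield map \<open>\<beta>\<^sub>2\<close> defines the division
  \<open>f/g = d\<^sub>0 \<mu>(f, g)\<close> of two edges with a common source. Up to homotopy fixing the end points, division
  satisfies
    \<^item> \<open>f/f \<sim> 1\<close> and \<open>f/1 \<sim> f\<close>, witnessed by degenerate triangles, and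
    \<^item> \<open>(h/f)/(g/f) \<sim> h/g\<close>, witnessed by the four faces of a 3-simplex whose edges at the initial vertex
      are \<open>f\<close>, \<open>g\<close> and \<open>h\<close>.
  Such a 3-simplex exists because \<open>\<beta>\<^sub>3\<close> has a section. Each witness is read through one principle
  (\<open>quot_triangle\<close>): the third edge of any triangle is homotopic to the quotient of the two
  edges at its initial vertex, because the fibres of \<open>\<beta>\<^sub>2\<close> are connected. These three laws are Ward's
  axioms for a groupoid in terms of division, with \<open>g \<circ> f = g/(1/f)\<close>; the groupoid laws follow by pure
  algebra (locale \<open>ward_groupoid\<close>). A Segal section fills \<open>f\<close>, \<open>g\<close> by a triangle with long edge \<open>k\<close>, so
  \<open>g \<sim> k/f\<close> and hence \<open>g \<circ> f \<sim> (k/f) \<circ> f \<sim> k\<close>: the two compositions agree, and \<open>Ho\<close> is a groupoid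
  because \<open>Ho\<^sub>B\<close> is.

  All of this is done for families of edges parametrised by an arbitrary simplicial set \<open>K\<close>. With
  \<open>K = \<Delta>\<^sup>0\<close> it gives the statement about homotopy categories. With \<open>K\<close> the simplicial set of composable
  pairs, the law \<open>(g \<circ> f)/f \<sim> g\<close> says that \<open>(f, g) \<mapsto> \<mu>(g \<circ> f, f)\<close> is a section of the Segal map up to
  homotopy, and the homotopy lifting property turns it into a strict section.

  The sections of \<open>\<beta>\<^sub>n\<close> and the connectedness of its fibres come from standard homotopy theory, in the
  generality needed here. A Kan fibration has the homotopy lifting property for every simplicial set,
  relative to a subcomplex (\<open>homotopy_lifting\<close>): a prism is filled horn by horn, and the
  general case follows by induction over skeleta (\<open>skeletal_extension\<close>). A weak equivalence
  between Kan complexes has a homotopy inverse, by the Yoneda argument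
  (\<open>weak_equivalence_homotopy_inverse\<close>). If it is also a Kan fibration, the inverse can be
  made a strict section (\<open>section_of_homotopy_section\<close>) and the deformation fibrewise
  (\<open>fibrewise_deformation\<close>). Finally, Reedy fibrancy makes the restriction along every
  inclusion of subcomplexes of \<open>\<Delta>\<^sup>n\<close> a Kan fibration (\<open>restriction_kanfib\<close>), in particular \<open>\<beta>\<^sub>n\<close> and \<open>\<xi>\<^sub>2\<close>.
\<close>

declare upt_Suc [simp del] replicate_Suc [simp del]

section \<open>Monotone maps as lists\<close>

lemma ord_homI: "length \<alpha> = Suc m \<Longrightarrow> sorted \<alpha> \<Longrightarrow> set \<alpha> \<subseteq> {..n} \<Longrightarrow> \<alpha> \<in> ord_hom m n"
  by (simp add: ord_hom_def)

lemma ord_hom_length: "\<alpha> \<in> ord_hom m n \<Longrightarrow> length \<alpha> = Suc m"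
  by (simp add: ord_hom_def)

lemma ord_hom_set: "\<alpha> \<in> ord_hom m n \<Longrightarrow> set \<alpha> \<subseteq> {..n}"
  by (simp add: ord_hom_def)

lemma ord_hom_sorted: "\<alpha> \<in> ord_hom m n \<Longrightarrow> sorted \<alpha>"
  by (simp add: ord_hom_def)

lemma ord_hom_nonempty: "\<alpha> \<in> ord_hom m n \<Longrightarrow> set \<alpha> \<noteq> {}"
  by (auto simp add: ord_hom_def)

lemma ord_hom_nth_le: "\<alpha> \<in> ord_hom m n \<Longrightarrow> i \<le> m \<Longrightarrow> \<alpha> ! i \<le> n"
  by (metis atMost_iff le_imp_less_Suc nth_mem ord_hom_length ord_hom_set subsetD)

lemma ord_hom_mono: "\<alpha> \<in> ord_hom m n \<Longrightarrow> i \<le> j \<Longrightarrow> j \<le> m \<Longrightarrow> \<alpha> ! i \<le> \<alpha> ! j"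
  by (simp add: ord_hom_def sorted_nth_mono)

lemma ord_hom_mapI:
  assumes "\<And>i j. i \<le> j \<Longrightarrow> j \<le> m \<Longrightarrow> d i \<le> d j" "\<And>i. i \<le> m \<Longrightarrow> d i \<le> n"
  shows "map d [0..<Suc m] \<in> ord_hom m n"
proof (rule ord_homI)
  show "sorted (map d [0..<Suc m])"
    using assms(1) by (auto simp: sorted_iff_nth_mono)
qed (use assms(2) in auto)

lemma ord_id_in: "ord_id n \<in> ord_hom n n"
  by (auto simp: ord_hom_def ord_id_def less_Suc_eq_le)

lemma ord_comp_in: "\<alpha> \<in> ord_hom m n \<Longrightarrow> \<beta> \<in> ord_hom k m \<Longrightarrow> ord_comp \<alpha> \<beta> \<in> ord_hom k n"
proof -
  assume a: "\<alpha> \<in> ord_hom m n" and b: "\<beta> \<in> ord_hom k m"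
  have "\<beta> = map (\<lambda>i. \<beta> ! i) [0..<Suc k]" using ord_hom_length[OF b] by (metis map_nth)
  then have "ord_comp \<alpha> \<beta> = map (\<lambda>i. \<alpha> ! (\<beta> ! i)) [0..<Suc k]"
    unfolding ord_comp_def by (metis (mono_tags, lifting) map_eq_conv map_map comp_apply)
  moreover have "map (\<lambda>i. \<alpha> ! (\<beta> ! i)) [0..<Suc k] \<in> ord_hom k n"
    by (intro ord_hom_mapI ord_hom_mono[OF a] ord_hom_mono[OF b] ord_hom_nth_le[OF a] ord_hom_nth_le[OF b])
  ultimately show ?thesis by simp
qed

lemma ord_comp_nth: "i < length \<beta> \<Longrightarrow> ord_comp \<alpha> \<beta> ! i = \<alpha> ! (\<beta> ! i)"
  by (simp add: ord_comp_def)

lemma ord_comp_set: "set (ord_comp \<alpha> \<beta>) = (!) \<alpha> ` set \<beta>"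
  by (auto simp: ord_comp_def)

lemma ord_comp_length: "length (ord_comp \<alpha> \<beta>) = length \<beta>"
  by (simp add: ord_comp_def)

lemma ord_comp_assoc:
  "\<beta> \<in> ord_hom l m \<Longrightarrow> \<gamma> \<in> ord_hom k l \<Longrightarrow>
    ord_comp (ord_comp \<alpha> \<beta>) \<gamma> = ord_comp \<alpha> (ord_comp \<beta> \<gamma>)"
  using ord_hom_nth_le[of \<gamma> k l]
  by (intro nth_equalityI) (auto simp: ord_comp_nth ord_comp_length ord_hom_length less_Suc_eq_le)

lemma ord_comp_id_right: "\<alpha> \<in> ord_hom m n \<Longrightarrow> ord_comp \<alpha> (ord_id m) = \<alpha>"
  by (metis ord_comp_def ord_hom_length ord_id_def map_nth)

lemma ord_comp_id_left: "\<beta> \<in> ord_hom k n \<Longrightarrow> ord_comp (ord_id n) \<beta> = \<beta>"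
  using ord_hom_nth_le[of \<beta> k n]
  by (intro nth_equalityI)
    (auto simp: ord_comp_nth ord_comp_length ord_hom_length ord_id_def less_Suc_eq_le)

lemma ord_comp_set_subset: 
  "\<alpha> \<in> ord_hom m n \<Longrightarrow> \<beta> \<in> ord_hom k m \<Longrightarrow> set (ord_comp \<alpha> \<beta>) \<subseteq> set \<alpha>"
  unfolding ord_comp_set
  by (metis atMost_iff image_subset_iff le_imp_less_Suc nth_mem ord_hom_length ord_hom_set subsetD)

abbreviation ord_const :: "nat \<Rightarrow> nat \<Rightarrow> nat list" where
  "ord_const m v \<equiv> replicate (Suc m) v"

lemma ord_const_in: "v \<le> n \<Longrightarrow> ord_const m v \<in> ord_hom m n"
  by (rule ord_homI) auto

lemma ord_comp_const_right: "ord_comp \<alpha> (ord_const k v) = ord_const k (\<alpha> ! v)"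
  by (simp add: ord_comp_def)

lemma ord_comp_const_left: "\<beta> \<in> ord_hom k m \<Longrightarrow> ord_comp (ord_const m v) \<beta> = ord_const k v"
  using ord_hom_nth_le[of \<beta> k m]
  by (intro nth_equalityI)
    (auto simp: ord_comp_nth ord_comp_length ord_hom_length less_Suc_eq_le)

lemma ord_hom_0: "\<tau> \<in> ord_hom k 0 \<longleftrightarrow> \<tau> = ord_const k 0"
proof
  assume t: "\<tau> \<in> ord_hom k 0"
  show "\<tau> = ord_const k 0"
    using ord_hom_nth_le[OF t] ord_hom_length[OF t]
    by (intro nth_equalityI) (auto simp: less_Suc_eq_le)
qed (auto simp: ord_const_in)

text \<open>The face of \<open>\<Delta>\<^sup>n\<close> on the vertex set \<open>F\<close> is the increasing enumeration of \<open>F\<close>; it is a monomorphism,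
  and a simplex lies on it as soon as its vertices do.\<close>

lemma face_in: "F \<subseteq> {..n} \<Longrightarrow> card F = Suc k \<Longrightarrow> sorted_list_of_set F \<in> ord_hom k n"
  by (rule ord_homI) (auto simp: finite_subset[of F "{..n}"])

lemma face_factor:
  assumes "F \<subseteq> {..n}" "card F = Suc k" "\<alpha> \<in> ord_hom m n" "set \<alpha> \<subseteq> F"
  obtains \<alpha>' where "\<alpha>' \<in> ord_hom m k" "\<alpha> = ord_comp (sorted_list_of_set F) \<alpha>'"
proof -
  let ?L = "sorted_list_of_set F"
  have fin: "finite F" using assms(1) finite_subset by blast
  have L: "set ?L = F" "length ?L = Suc k" "sorted ?L" "distinct ?L"
    using fin assms(2) by auto
  have "\<exists>i. i \<le> k \<and> ?L ! i = \<alpha> ! j" if "j \<le> m" for j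
  proof -
    have "\<alpha> ! j \<in> set ?L" using that assms L by (auto simp: ord_hom_length[OF assms(3)])
    then show ?thesis using L by (auto simp: in_set_conv_nth less_Suc_eq_le)
  qed
  then obtain d where d: "\<And>j. j \<le> m \<Longrightarrow> d j \<le> k \<and> ?L ! d j = \<alpha> ! j" by metis
  have strict: "d i \<le> d j" if "i \<le> j" "j \<le> m" for i j
  proof (rule ccontr)
    assume "\<not> d i \<le> d j"
    then have "?L ! d j < ?L ! d i"
      using strict_sorted_list_of_set[of F] d[of i] that L
      by (metis le_imp_less_Suc not_le order_trans sorted_wrt_nth_less)
    then show False using d[of i] d[of j] that ord_hom_mono[OF assms(3), of i j] by auto
  qed
  show thesis
  proof
    show "map d [0..<Suc m] \<in> ord_hom m k" using d strict by (intro ord_hom_mapI) auto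
    show "\<alpha> = ord_comp ?L (map d [0..<Suc m])"
      using d by (intro nth_equalityI)
        (auto simp: ord_hom_length[OF assms(3)] ord_comp_nth ord_comp_length less_Suc_eq_le)
  qed
qed

lemma face_mono:
  assumes "F \<subseteq> {..n}" "card F = Suc k" "\<alpha> \<in> ord_hom m k" "\<beta> \<in> ord_hom m k"
    "ord_comp (sorted_list_of_set F) \<alpha> = ord_comp (sorted_list_of_set F) \<beta>"
  shows "\<alpha> = \<beta>"
proof -
  let ?L = "sorted_list_of_set F"
  have fin: "finite F" using assms(1) finite_subset by blast
  have L: "set ?L = F" "length ?L = Suc k" "distinct ?L" using fin assms(2) by auto
  show ?thesis
  proof (rule nth_equalityI)
    fix i assume i: "i < length \<alpha>"
    then have "?L ! (\<alpha> ! i) = ?L ! (\<beta> ! i)"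
      using assms(3-5) by (metis ord_comp_nth ord_hom_length)
    then show "\<alpha> ! i = \<beta> ! i"
      using L ord_hom_nth_le[OF assms(3), of i] ord_hom_nth_le[OF assms(4), of i] i
      by (simp add: ord_hom_length[OF assms(3)] nth_eq_iff_index_eq less_Suc_eq_le)
  qed (use assms ord_hom_length in auto)
qed

text \<open>Any choice of preimages is monotone, since the fibres of a monotone map are ordered as their values
  are; so the preimage of one value can be prescribed.\<close>

lemma ord_hom_surj_section:
  assumes "\<alpha> \<in> ord_hom m n" "set \<alpha> = {..n}" "i \<le> m"
  obtains \<delta> where "\<delta> \<in> ord_hom n m" "ord_comp \<alpha> \<delta> = ord_id n" "\<delta> ! (\<alpha> ! i) = i"
proof -
  have "\<exists>j. j \<le> m \<and> \<alpha> ! j = v \<and> (v = \<alpha> ! i \<longrightarrow> j = i)" if "v \<le> n" for v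
  proof (cases "v = \<alpha> ! i")
    case False
    have "v \<in> set \<alpha>" using assms that by auto
    then show ?thesis using False by (auto simp: in_set_conv_nth ord_hom_length[OF assms(1)] less_Suc_eq_le)
  qed (use assms in auto)
  then obtain d where d: "\<And>v. v \<le> n \<Longrightarrow> d v \<le> m \<and> \<alpha> ! d v = v \<and> (v = \<alpha> ! i \<longrightarrow> d v = i)"
    by metis
  have mono: "d v \<le> d w" if "v \<le> w" "w \<le> n" for v w
  proof (rule ccontr)
    assume "\<not> d v \<le> d w"
    then have "\<alpha> ! d w \<le> \<alpha> ! d v" using d that by (intro ord_hom_mono[OF assms(1)]) auto
    then have "w \<le> v" using d[of v] d[of w] that by auto
    then have "v = w" using that by auto
    then show False using \<open>\<not> d v \<le> d w\<close> by auto
  qed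
  show thesis
  proof
    show "map d [0..<Suc n] \<in> ord_hom n m" using d mono by (intro ord_hom_mapI) auto
    show "ord_comp \<alpha> (map d [0..<Suc n]) = ord_id n"
      using d by (intro nth_equalityI) (auto simp: ord_comp_nth ord_comp_length ord_id_def less_Suc_eq_le)
    have "\<alpha> ! i \<le> n" using assms ord_hom_nth_le by blast
    then show "map d [0..<Suc n] ! (\<alpha> ! i) = i"
      using d[of "\<alpha> ! i"] by (simp add: less_Suc_eq_le)
  qed
qed

lemma ord_hom_surj_id:
  assumes "\<alpha> \<in> ord_hom n n" "set \<alpha> = {..n}"
  shows "\<alpha> = ord_id n"
proof -
  have "distinct \<alpha>" using assms by (intro card_distinct) (auto simp: ord_hom_length)
  then show ?thesis using assms ord_hom_sorted
    by (intro sorted_distinct_set_unique) (auto simp: ord_id_def less_Suc_eq_le)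
qed

section \<open>Simplicial sets and maps\<close>

lemma is_ssetI:
  assumes "\<And>m n \<alpha> x. \<alpha> \<in> ord_hom m n \<Longrightarrow> x \<in> simp A n \<Longrightarrow> act A n \<alpha> x \<in> simp A m"
    "\<And>n x. x \<in> simp A n \<Longrightarrow> act A n (ord_id n) x = x"
    "\<And>k m n \<alpha> \<beta> x. \<alpha> \<in> ord_hom m n \<Longrightarrow> \<beta> \<in> ord_hom k m \<Longrightarrow> x \<in> simp A n \<Longrightarrow>
       act A n (ord_comp \<alpha> \<beta>) x = act A m \<beta> (act A n \<alpha> x)"
  shows "is_sset A"
  using assms by (auto simp: is_sset_def)

lemma sset_act: "is_sset A \<Longrightarrow> \<alpha> \<in> ord_hom m n \<Longrightarrow> x \<in> simp A n \<Longrightarrow> act A n \<alpha> x \<in> simp A m"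
  by (auto simp: is_sset_def)

lemma sset_id: "is_sset A \<Longrightarrow> x \<in> simp A n \<Longrightarrow> act A n (ord_id n) x = x"
  by (auto simp: is_sset_def)

lemma sset_comp: "is_sset A \<Longrightarrow> \<alpha> \<in> ord_hom m n \<Longrightarrow> \<beta> \<in> ord_hom k m \<Longrightarrow> x \<in> simp A n \<Longrightarrow>
    act A m \<beta> (act A n \<alpha> x) = act A n (ord_comp \<alpha> \<beta>) x"
  by (auto simp: is_sset_def)

text \<open>Extensionality of \<open>smaps\<close> only matters where maps are themselves simplices. Everywhere else
  a simplicial map is a family that is unconstrained off the simplices of its source.\<close>

definition smor :: "'a sset \<Rightarrow> 'b sset \<Rightarrow> (nat \<Rightarrow> 'a \<Rightarrow> 'b) \<Rightarrow> bool" where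
  "smor A B f \<longleftrightarrow> (\<forall>n. \<forall>x\<in>simp A n. f n x \<in> simp B n) \<and>
     (\<forall>m n. \<forall>\<alpha>\<in>ord_hom m n. \<forall>x\<in>simp A n. f m (act A n \<alpha> x) = act B n \<alpha> (f n x))"

definition sres :: "'a sset \<Rightarrow> (nat \<Rightarrow> 'a \<Rightarrow> 'b) \<Rightarrow> nat \<Rightarrow> 'a \<Rightarrow> 'b" where
  "sres A f = (\<lambda>n. restrict (f n) (simp A n))"

lemma smorI:
  assumes "\<And>n x. x \<in> simp A n \<Longrightarrow> f n x \<in> simp B n"
    "\<And>m n \<alpha> x. \<alpha> \<in> ord_hom m n \<Longrightarrow> x \<in> simp A n \<Longrightarrow> f m (act A n \<alpha> x) = act B n \<alpha> (f n x)"
  shows "smor A B f"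
  using assms by (auto simp: smor_def)

lemma smor_in: "smor A B f \<Longrightarrow> x \<in> simp A n \<Longrightarrow> f n x \<in> simp B n"
  by (auto simp: smor_def)

lemma smor_nat: "smor A B f \<Longrightarrow> \<alpha> \<in> ord_hom m n \<Longrightarrow> x \<in> simp A n \<Longrightarrow>
    f m (act A n \<alpha> x) = act B n \<alpha> (f n x)"
  by (auto simp: smor_def)

lemma smaps_smor: "f \<in> smaps A B \<Longrightarrow> smor A B f"
  by (auto simp: smaps_def smor_def)

lemma smor_sres: "is_sset A \<Longrightarrow> smor A B f \<Longrightarrow> sres A f \<in> smaps A B"
  by (auto simp: smaps_def smor_def sres_def sset_act)

lemma sres_eq: "x \<in> simp A n \<Longrightarrow> sres A f n x = f n x"
  by (simp add: sres_def)

lemma smaps_eqI: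
  assumes "f \<in> smaps A B" "g \<in> smaps A B" "\<And>n x. x \<in> simp A n \<Longrightarrow> f n x = g n x"
  shows "f = g"
proof
  fix n show "f n = g n"
    using assms by (intro PiE_ext[of "f n" "simp A n" "\<lambda>_. simp B n"]) (auto simp: smaps_def)
qed

lemma smor_cong: "is_sset A \<Longrightarrow> smor A B f \<Longrightarrow> (\<And>n x. x \<in> simp A n \<Longrightarrow> f n x = g n x) \<Longrightarrow> smor A B g"
  unfolding smor_def by (metis sset_act)

lemma smor_id: "smor A A (\<lambda>n x. x)"
  by (auto simp: smor_def)

lemma smor_comp: "smor A B f \<Longrightarrow> smor B C g \<Longrightarrow> smor A C (\<lambda>n x. g n (f n x))"
  by (auto simp: smor_def)

definition subs :: "'a sset \<Rightarrow> (nat \<Rightarrow> 'a \<Rightarrow> bool) \<Rightarrow> 'a sset" where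
  "subs A S = \<lparr>simp = \<lambda>n. {x \<in> simp A n. S n x}, act = act A\<rparr>"

definition closed_in :: "'a sset \<Rightarrow> (nat \<Rightarrow> 'a \<Rightarrow> bool) \<Rightarrow> bool" where
  "closed_in A S \<longleftrightarrow> (\<forall>m n. \<forall>\<alpha>\<in>ord_hom m n. \<forall>x\<in>simp A n. S n x \<longrightarrow> S m (act A n \<alpha> x))"

lemma subs_simps [simp]: "simp (subs A S) n = {x \<in> simp A n. S n x}" "act (subs A S) = act A"
  by (simp_all add: subs_def)

lemma closed_inD: "closed_in A S \<Longrightarrow> \<alpha> \<in> ord_hom m n \<Longrightarrow> x \<in> simp A n \<Longrightarrow> S n x \<Longrightarrow> S m (act A n \<alpha> x)"
  by (auto simp: closed_in_def)

lemma is_sset_subs: "is_sset A \<Longrightarrow> closed_in A S \<Longrightarrow> is_sset (subs A S)"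
  by (rule is_ssetI) (auto simp: sset_act sset_id sset_comp dest: closed_inD)

lemma simplex_simps [simp]: "simp (simplex n) m = ord_hom m n" "act (simplex n) m \<beta> \<alpha> = ord_comp \<alpha> \<beta>"
  by (simp_all add: simplex_def)

lemma subsimplex_subs: "subsimplex n P = subs (simplex n) (\<lambda>m \<alpha>. P (set \<alpha>))"
  by (simp add: subsimplex_def subs_def simplex_def)

lemma subsimplex_simps [simp]:
  "simp (subsimplex n P) m = {\<alpha> \<in> ord_hom m n. P (set \<alpha>)}" "act (subsimplex n P) m \<beta> \<alpha> = ord_comp \<alpha> \<beta>"
  by (simp_all add: subsimplex_def)

lemma horn_simps [simp]:
  "simp (horn n k) m = {\<alpha> \<in> ord_hom m n. \<not> {..n} - {k} \<subseteq> set \<alpha>}" "act (horn n k) m \<beta> \<alpha> = ord_comp \<alpha> \<beta>"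
  by (simp_all add: horn_def)

lemma boundary_simps [simp]:
  "simp (boundary n) m = {\<alpha> \<in> ord_hom m n. set \<alpha> \<noteq> {..n}}" "act (boundary n) m \<beta> \<alpha> = ord_comp \<alpha> \<beta>"
  by (simp_all add: boundary_def)

lemma sprod_simps [simp]:
  "simp (sprod A B) n = simp A n \<times> simp B n"
  "act (sprod A B) n \<alpha> (x, y) = (act A n \<alpha> x, act B n \<alpha> y)"
  by (simp_all add: sprod_def)

lemma is_sset_simplex: "is_sset (simplex n)"
  by (rule is_ssetI) (auto simp: ord_comp_in ord_comp_id_right ord_comp_assoc)

lemma is_sset_sprod: "is_sset A \<Longrightarrow> is_sset B \<Longrightarrow> is_sset (sprod A B)"
  by (rule is_ssetI) (auto simp: sset_act sset_id sset_comp)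

lemma is_sset_subsimplex:
  assumes "\<And>V W. V \<subseteq> {..n} \<Longrightarrow> P V \<Longrightarrow> W \<subseteq> V \<Longrightarrow> P W"
  shows "is_sset (subsimplex n P)"
  unfolding subsimplex_subs
proof (rule is_sset_subs[OF is_sset_simplex], unfold closed_in_def, intro allI ballI impI)
  fix k m \<alpha> x assume "\<alpha> \<in> ord_hom k m" "x \<in> simp (simplex n) m" "P (set x)"
  then show "P (set (act (simplex n) m \<alpha> x))" 
    using assms[of "set x"] ord_comp_set_subset[of x m n \<alpha> k] ord_hom_set[of x m n] by simp
qed

lemma is_sset_horn: "is_sset (horn n k)"
  unfolding horn_def by (rule is_sset_subsimplex) auto

lemma boundary_closed: 
  assumes "\<alpha> \<in> ord_hom m n" "\<beta> \<in> ord_hom k m" "set \<alpha> \<noteq> {..n}"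
  shows "set (ord_comp \<alpha> \<beta>) \<noteq> {..n}"
  using ord_comp_set_subset[OF assms(1,2)] ord_hom_set[OF assms(1)] assms(3) by auto

lemma yoneda: "is_sset A \<Longrightarrow> a \<in> simp A n \<Longrightarrow> smor (simplex n) A (\<lambda>m \<alpha>. act A n \<alpha> a)"
  by (rule smorI) (auto simp: sset_act sset_comp)

text \<open>Kan fibrations with the simplex of the base given as an element instead of a map.\<close>

definition kanfib :: "'a sset \<Rightarrow> 'b sset \<Rightarrow> (nat \<Rightarrow> 'a \<Rightarrow> 'b) \<Rightarrow> bool" where
  "kanfib E B p \<longleftrightarrow> smor E B p \<and>
     (\<forall>n k u. \<forall>b\<in>simp B n. 1 \<le> n \<and> k \<le> n \<and> smor (horn n k) E u \<and>
        (\<forall>m. \<forall>\<alpha>\<in>simp (horn n k) m. p m (u m \<alpha>) = act B n \<alpha> b) \<longrightarrow>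
        (\<exists>e\<in>simp E n. p n e = b \<and> (\<forall>m. \<forall>\<alpha>\<in>simp (horn n k) m. act E n \<alpha> e = u m \<alpha>)))"

lemma kanfib_smor: "kanfib E B p \<Longrightarrow> smor E B p"
  by (simp add: kanfib_def)

text \<open>By the Yoneda lemma a map \<open>\<Delta>\<^sup>n \<rightarrow> E\<close> is an element \<open>e\<close> of \<open>E\<^sub>n\<close>, and it extends \<open>u\<close> if every
  \<open>\<alpha>\<close> in the horn takes \<open>e\<close> to \<open>u \<alpha>\<close>.\<close>

lemma kanfib_lift:
  assumes "kanfib E B p" "1 \<le> n" "k \<le> n" "b \<in> simp B n" "smor (horn n k) E u"
    "\<And>m \<alpha>. \<alpha> \<in> simp (horn n k) m \<Longrightarrow> p m (u m \<alpha>) = act B n \<alpha> b"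
  obtains e where "e \<in> simp E n" "p n e = b" "\<And>m \<alpha>. \<alpha> \<in> simp (horn n k) m \<Longrightarrow> act E n \<alpha> e = u m \<alpha>"
proof -
  have "\<forall>n k u. \<forall>b\<in>simp B n. 1 \<le> n \<and> k \<le> n \<and> smor (horn n k) E u \<and>
        (\<forall>m. \<forall>\<alpha>\<in>simp (horn n k) m. p m (u m \<alpha>) = act B n \<alpha> b) \<longrightarrow>
        (\<exists>e\<in>simp E n. p n e = b \<and> (\<forall>m. \<forall>\<alpha>\<in>simp (horn n k) m. act E n \<alpha> e = u m \<alpha>))"
    using assms(1) unfolding kanfib_def by (rule conjunct2)
  from this[rule_format, OF assms(4), of k u] assms(2,3,5,6)
  have "\<exists>e\<in>simp E n. p n e = b \<and> (\<forall>m. \<forall>\<alpha>\<in>simp (horn n k) m. act E n \<alpha> e = u m \<alpha>)" by simp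
  then obtain e where "e\<in>simp E n" "p n e = b" "\<forall>m. \<forall>\<alpha>\<in>simp (horn n k) m. act E n \<alpha> e = u m \<alpha>"
    by (elim bexE conjE)
  then show ?thesis using that by blast
qed

lemma kanfibI:
  assumes "smor E B p"
    "\<And>n k u b. 1 \<le> n \<Longrightarrow> k \<le> n \<Longrightarrow> b \<in> simp B n \<Longrightarrow> smor (horn n k) E u \<Longrightarrow>
      (\<And>m \<alpha>. \<alpha> \<in> simp (horn n k) m \<Longrightarrow> p m (u m \<alpha>) = act B n \<alpha> b) \<Longrightarrow>
      \<exists>e\<in>simp E n. p n e = b \<and> (\<forall>m. \<forall>\<alpha>\<in>simp (horn n k) m. act E n \<alpha> e = u m \<alpha>)"
  shows "kanfib E B p"
  unfolding kanfib_def
proof (rule conjI[OF assms(1)], intro allI ballI impI)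
  fix n k u b
  assume "b \<in> simp B n" and "1 \<le> n \<and> k \<le> n \<and> smor (horn n k) E u \<and>
    (\<forall>m. \<forall>\<alpha>\<in>simp (horn n k) m. p m (u m \<alpha>) = act B n \<alpha> b)"
  then show "\<exists>e\<in>simp E n. p n e = b \<and> (\<forall>m. \<forall>\<alpha>\<in>simp (horn n k) m. act E n \<alpha> e = u m \<alpha>)"
    by (elim conjE) (rule assms(2); blast)
qed

lemma kan_fibration_kanfib:
  assumes "kan_fibration E B p" "is_sset E" "is_sset B"
  shows "kanfib E B p"
proof (rule kanfibI)
  show "smor E B p" using assms(1) by (simp add: kan_fibration_def smaps_smor)
next
  fix n k u b
  assume b: "b \<in> simp B n" and n: "1 \<le> n" "k \<le> n" and u: "smor (horn n k) E u"
    and eq: "\<And>m \<alpha>. \<alpha> \<in> simp (horn n k) m \<Longrightarrow> p m (u m \<alpha>) = act B n \<alpha> b"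
  let ?v = "sres (simplex n) (\<lambda>m \<alpha>. act B n \<alpha> b)"
  let ?u = "sres (horn n k) u"
  have v: "?v \<in> smaps (simplex n) B" using assms(3) b by (intro smor_sres is_sset_simplex yoneda)
  have u': "?u \<in> smaps (horn n k) E" using u by (intro smor_sres is_sset_horn)
  have "\<forall>m. \<forall>\<alpha>\<in>simp (horn n k) m. p m (?u m \<alpha>) = ?v m \<alpha>"
  proof (intro allI ballI)
    fix m \<alpha> assume a: "\<alpha> \<in> simp (horn n k) m"
    then have "\<alpha> \<in> simp (simplex n) m" by simp
    then show "p m (?u m \<alpha>) = ?v m \<alpha>" using eq[OF a] a by (simp only: sres_eq)
  qed
  with n obtain w where w: "w \<in> smaps (simplex n) E" "\<forall>m. \<forall>\<alpha>\<in>simp (horn n k) m. w m \<alpha> = ?u m \<alpha>"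
     "\<forall>m. \<forall>\<alpha>\<in>simp (simplex n) m. p m (w m \<alpha>) = ?v m \<alpha>"
    using assms(1)[unfolded kan_fibration_def, THEN conjunct2, rule_format, OF u' v] by blast
  have wm: "act E n \<alpha> (w n (ord_id n)) = w m \<alpha>" if "\<alpha> \<in> ord_hom m n" for m \<alpha>
    using smor_nat[OF smaps_smor[OF w(1)] that, of "ord_id n"] that by (simp add: ord_id_in ord_comp_id_left)
  show "\<exists>e\<in>simp E n. p n e = b \<and> (\<forall>m. \<forall>\<alpha>\<in>simp (horn n k) m. act E n \<alpha> e = u m \<alpha>)"
  proof (intro bexI conjI allI ballI)
    show "w n (ord_id n) \<in> simp E n"
      using smor_in[OF smaps_smor[OF w(1)], of "ord_id n" n] by (simp add: ord_id_in)
    show "p n (w n (ord_id n)) = b"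
      using w(3) b assms(3) by (simp add: ord_id_in sres_def sset_id)
    fix m \<alpha> assume "\<alpha> \<in> simp (horn n k) m"
    then show "act E n \<alpha> (w n (ord_id n)) = u m \<alpha>"
      using wm[of \<alpha> m] w(2) sres_eq[of \<alpha> "horn n k" m u] by simp
  qed
qed

lemma kan_complexI:
  assumes "is_sset A" "\<And>n k u. 1 \<le> n \<Longrightarrow> k \<le> n \<Longrightarrow> smor (horn n k) A u \<Longrightarrow>
     \<exists>e\<in>simp A n. \<forall>m. \<forall>\<alpha>\<in>simp (horn n k) m. act A n \<alpha> e = u m \<alpha>"
  shows "kan_complex A"
  unfolding kan_complex_def
proof (rule conjI[OF assms(1)], intro allI ballI impI)
  fix n k u assume "u \<in> smaps (horn n k) A" "1 \<le> n \<and> k \<le> n"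
  then obtain e where e: "e \<in> simp A n" "\<And>m \<alpha>. \<alpha>\<in>simp (horn n k) m \<Longrightarrow> act A n \<alpha> e = u m \<alpha>"
    using assms(2)[of n k u] smaps_smor[of u] by meson
  show "\<exists>w\<in>smaps (simplex n) A. \<forall>m. \<forall>\<alpha>\<in>simp (horn n k) m. w m \<alpha> = u m \<alpha>"
  proof (intro bexI allI ballI)
    show "sres (simplex n) (\<lambda>m \<alpha>. act A n \<alpha> e) \<in> smaps (simplex n) A"
      using assms(1) e by (intro smor_sres is_sset_simplex yoneda)
    fix m \<alpha> assume a: "\<alpha> \<in> simp (horn n k) m"
    then have "\<alpha> \<in> simp (simplex n) m" by simp
    then show "sres (simplex n) (\<lambda>m \<alpha>. act A n \<alpha> e) m \<alpha> = u m \<alpha>" using e(2)[OF a] by (simp only: sres_eq)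
  qed
qed

section \<open>Extending partial maps over skeleta\<close>

text \<open>Membership in the \<open>(n - 1)\<close>-skeleton; for \<open>n = 0\<close> the skeleton is empty.\<close>

definition skel :: "'k sset \<Rightarrow> nat \<Rightarrow> nat \<Rightarrow> 'k \<Rightarrow> bool" where
  "skel K n k y \<longleftrightarrow> (\<exists>j<n. \<exists>z\<in>simp K j. \<exists>\<alpha>\<in>ord_hom k j. y = act K j \<alpha> z)"

lemma skel_closed:
  assumes "is_sset K" shows "closed_in K (skel K n)"
  unfolding closed_in_def
proof (intro allI ballI impI)
  fix l k \<theta> y assume t: "\<theta> \<in> ord_hom l k" and "skel K n k y"
  then obtain j z \<alpha> where j: "j < n" "z \<in> simp K j" "\<alpha> \<in> ord_hom k j" "y = act K j \<alpha> z"
    by (auto simp: skel_def)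
  then have "act K k \<theta> y = act K j (ord_comp \<alpha> \<theta>) z" using sset_comp[OF assms j(3) t j(2)] by simp
  then show "skel K n l (act K k \<theta> y)" unfolding skel_def using j t ord_comp_in by blast
qed

lemma skel_nonsurj:
  assumes "is_sset K" "z \<in> simp K n" "\<alpha> \<in> ord_hom k n" "set \<alpha> \<noteq> {..n}"
  shows "skel K n k (act K n \<alpha> z)"
proof -
  have fin: "finite (set \<alpha>)" "set \<alpha> \<subseteq> {..n}" "set \<alpha> \<noteq> {}"
    using assms(3) ord_hom_set ord_hom_nonempty by auto
  then obtain j where j: "card (set \<alpha>) = Suc j" by (metis card_gt_0_iff gr0_implies_Suc)
  have "card (set \<alpha>) < card {..n}" using fin assms(4) by (intro psubset_card_mono) auto
  then have "j < n" using j by simp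
  obtain \<alpha>' where a: "\<alpha>' \<in> ord_hom k j" "\<alpha> = ord_comp (sorted_list_of_set (set \<alpha>)) \<alpha>'"
    using face_factor[OF fin(2) j assms(3)] by blast
  let ?i = "sorted_list_of_set (set \<alpha>)"
  have i: "?i \<in> ord_hom j n" using face_in[OF fin(2) j] .
  have "act K n \<alpha> z = act K j \<alpha>' (act K n ?i z)"
    using sset_comp[OF assms(1) i a(1) assms(2)] a(2) by simp
  then show ?thesis unfolding skel_def using \<open>j < n\<close> a(1) sset_act[OF assms(1) i assms(2)] by blast
qed

text \<open>A simplex outside the \<open>(n-1)\<close>-skeleton is a degeneracy of at most one \<open>n\<close>-simplex, in at most
  one way (Eilenberg and Zilber): a section of one degeneracy operator, composed with the other, is
  an endomorphism of \<open>[n]\<close> that must be surjective, so both operators have the same sections; as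
  there is a section through each point, the operators agree.\<close>

lemma eilenberg_zilber:
  assumes K: "is_sset K" and z: "z \<in> simp K n" "\<not> skel K n n z" and w: "w \<in> simp K n"
    and ab: "\<alpha> \<in> ord_hom k n" "\<beta> \<in> ord_hom k n" "act K n \<alpha> z = act K n \<beta> w"
    and s: "set \<alpha> = {..n}"
  shows "z = w \<and> \<alpha> = \<beta>"
proof -
  have sec: "ord_comp \<beta> \<delta> = ord_id n \<and> z = w" if d: "\<delta> \<in> ord_hom n k" "ord_comp \<alpha> \<delta> = ord_id n" for \<delta>
  proof -
    have "z = act K k \<delta> (act K n \<alpha> z)" using sset_comp[OF K ab(1) d(1) z(1)] d(2) sset_id[OF K z(1)] by simp
    also have "\<dots> = act K n (ord_comp \<beta> \<delta>) w" using ab(3) sset_comp[OF K ab(2) d(1) w] by simp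
    finally have zw: "z = act K n (ord_comp \<beta> \<delta>) w" .
    have bd: "ord_comp \<beta> \<delta> \<in> ord_hom n n" using ab(2) d(1) ord_comp_in by blast
    have "set (ord_comp \<beta> \<delta>) = {..n}"
      using skel_nonsurj[OF K w bd] z(2) zw by auto
    then have "ord_comp \<beta> \<delta> = ord_id n" using ord_hom_surj_id bd by blast
    then show ?thesis using zw sset_id[OF K w] by simp
  qed
  have "\<alpha> ! i = \<beta> ! i" if i: "i \<le> k" for i
  proof -
    obtain \<delta> where d: "\<delta> \<in> ord_hom n k" "ord_comp \<alpha> \<delta> = ord_id n" "\<delta> ! (\<alpha> ! i) = i"
      using ord_hom_surj_section[OF ab(1) s i] by blast
    have l: "\<alpha> ! i < length \<delta>" using d(1) ord_hom_nth_le[OF ab(1) i] by (simp add: ord_hom_length)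
    have "\<beta> ! i = ord_comp \<beta> \<delta> ! (\<alpha> ! i)" using d(3) ord_comp_nth[OF l] by simp
    also have "\<dots> = \<alpha> ! i" using sec[OF d(1,2)] ord_hom_nth_le[OF ab(1) i] by (simp add: ord_id_def less_Suc_eq_le)
    finally show ?thesis by simp
  qed
  then have "\<alpha> = \<beta>" using ab by (intro nth_equalityI) (auto simp: ord_hom_length less_Suc_eq_le)
  moreover obtain \<delta> where "\<delta> \<in> ord_hom n k" "ord_comp \<alpha> \<delta> = ord_id n"
    using ord_hom_surj_section[OF ab(1) s, of 0] by blast
  ultimately show ?thesis using sec by blast
qed

text \<open>A partial map is a family that is only constrained on the subcomplex \<open>D\<close>.\<close>

definition partial_sol ::
  "'k sset \<Rightarrow> 'p sset \<Rightarrow> (nat \<Rightarrow> 'k \<Rightarrow> 'p \<Rightarrow> bool) \<Rightarrow> (nat \<Rightarrow> 'k \<Rightarrow> bool) \<Rightarrow> (nat \<Rightarrow> 'k \<Rightarrow> 'p) \<Rightarrow> bool" where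
  "partial_sol K P T D g \<longleftrightarrow> smor (subs K D) P g \<and> (\<forall>k. \<forall>y\<in>simp K k. D k y \<longrightarrow> T k y (g k y))"

text \<open>The lifting property against all boundary inclusions, for a map that is only given by its
  sets \<open>T n y\<close> of allowed values.\<close>

definition boundary_extension ::
  "'k sset \<Rightarrow> 'p sset \<Rightarrow> (nat \<Rightarrow> 'k \<Rightarrow> 'p \<Rightarrow> bool) \<Rightarrow> bool" where
  "boundary_extension K P T \<longleftrightarrow> (\<forall>n. \<forall>y\<in>simp K n. \<forall>u. smor (boundary n) P u \<and>
     (\<forall>m. \<forall>\<alpha>\<in>simp (boundary n) m. T m (act K n \<alpha> y) (u m \<alpha>)) \<longrightarrow>
     (\<exists>e\<in>simp P n. T n y e \<and> (\<forall>m. \<forall>\<alpha>\<in>simp (boundary n) m. act P n \<alpha> e = u m \<alpha>)))"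

definition closed_values :: "'k sset \<Rightarrow> 'p sset \<Rightarrow> (nat \<Rightarrow> 'k \<Rightarrow> 'p \<Rightarrow> bool) \<Rightarrow> bool" where
  "closed_values K P T \<longleftrightarrow> (\<forall>m n. \<forall>\<alpha>\<in>ord_hom m n. \<forall>y\<in>simp K n. \<forall>e\<in>simp P n.
     T n y e \<longrightarrow> T m (act K n \<alpha> y) (act P n \<alpha> e))"

lemma boundary_extensionE:
  assumes "boundary_extension K P T" "y \<in> simp K n" "smor (boundary n) P u"
    "\<And>m \<alpha>. \<alpha> \<in> ord_hom m n \<Longrightarrow> set \<alpha> \<noteq> {..n} \<Longrightarrow> T m (act K n \<alpha> y) (u m \<alpha>)"
  shows "\<exists>e. e \<in> simp P n \<and> T n y e \<and> (\<forall>m. \<forall>\<alpha>\<in>ord_hom m n. set \<alpha> \<noteq> {..n} \<longrightarrow> act P n \<alpha> e = u m \<alpha>)"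
proof -
  have "smor (boundary n) P u \<and> (\<forall>m. \<forall>\<alpha>\<in>simp (boundary n) m. T m (act K n \<alpha> y) (u m \<alpha>))"
    using assms(3,4) by simp
  then have "\<exists>e\<in>simp P n. T n y e \<and> (\<forall>m. \<forall>\<alpha>\<in>simp (boundary n) m. act P n \<alpha> e = u m \<alpha>)"
    using assms(1,2) unfolding boundary_extension_def by blast
  then show ?thesis by auto
qed

text \<open>The map is extended to all \<open>n\<close>-simplices outside its domain at once. Their boundaries lie in the
  skeleton, where the map is already defined, and the Eilenberg-Zilber lemma makes the extension
  to their degeneracies unambiguous.\<close>

lemma extend_one_dimension:
  fixes K :: "'k sset" and P :: "'p sset"
  assumes K: "is_sset K" and P: "is_sset P" and L: "closed_in K L"
    and T: "closed_values K P T" and ext: "boundary_extension K P T"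
    and sol: "partial_sol K P T (\<lambda>k y. L k y \<or> skel K n k y) g"
  shows "\<exists>g'. partial_sol K P T (\<lambda>k y. L k y \<or> skel K (Suc n) k y) g' \<and>
    (\<forall>k. \<forall>y\<in>simp K k. L k y \<or> skel K n k y \<longrightarrow> g' k y = g k y)"
proof -
  define D where "D = (\<lambda>k y. L k y \<or> skel K n k y)"
  have Dcl: "closed_in K D"
    using L skel_closed[OF K, of n] unfolding D_def closed_in_def by blast
  have g: "smor (subs K D) P g" and gT: "\<And>k y. y \<in> simp K k \<Longrightarrow> D k y \<Longrightarrow> T k y (g k y)"
    using sol unfolding partial_sol_def D_def by auto
  have g_in: "g k y \<in> simp P k" if "y \<in> simp K k" "D k y" for k y
    using smor_in[OF g] that by simp
  have g_nat: "g j (act K k \<theta> y) = act P k \<theta> (g k y)" if "\<theta> \<in> ord_hom j k" "y \<in> simp K k" "D k y" for j k \<theta> y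
    using smor_nat[OF g, of \<theta>] that by simp
  have bd: "D m (act K n \<alpha> z)" if "z \<in> simp K n" "\<alpha> \<in> ord_hom m n" "set \<alpha> \<noteq> {..n}" for m \<alpha> z
    using skel_nonsurj[OF K that] by (simp add: D_def)
  have "\<exists>e. e \<in> simp P n \<and> T n z e \<and>
      (\<forall>m. \<forall>\<alpha>\<in>ord_hom m n. set \<alpha> \<noteq> {..n} \<longrightarrow> act P n \<alpha> e = g m (act K n \<alpha> z))" if z: "z \<in> simp K n" for z
  proof (rule boundary_extensionE[OF ext z, of "\<lambda>m \<alpha>. g m (act K n \<alpha> z)"])
    show "smor (boundary n) P (\<lambda>m \<alpha>. g m (act K n \<alpha> z))"
    proof (rule smorI)
      fix m \<alpha> assume "\<alpha> \<in> simp (boundary n) m"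
      then show "g m (act K n \<alpha> z) \<in> simp P m" using bd[OF z] sset_act[OF K _ z] g_in by simp
    next
      fix k m \<beta> \<alpha> assume b: "\<beta> \<in> ord_hom k m" and a: "\<alpha> \<in> simp (boundary n) m"
      then have "act K n (ord_comp \<alpha> \<beta>) z = act K m \<beta> (act K n \<alpha> z)" using sset_comp[OF K _ b z] by simp
      then show "g k (act K n (act (boundary n) m \<beta> \<alpha>) z) = act P m \<beta> (g m (act K n \<alpha> z))"
        using g_nat[OF b] a bd[OF z] sset_act[OF K _ z] by simp
    qed
  next
    fix m \<alpha> assume "\<alpha> \<in> ord_hom m n" "set \<alpha> \<noteq> {..n}"
    then show "T m (act K n \<alpha> z) (g m (act K n \<alpha> z))" using bd[OF z] gT sset_act[OF K _ z] by simp
  qed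
  \<comment> \<open>On the old domain \<open>e z\<close> is the old value, so that one formula \<open>\<alpha>\<^sup>* (e z)\<close> describes the extension on every \<open>\<alpha>\<^sup>* z\<close>.\<close>
  then have "\<exists>e. e \<in> simp P n \<and> T n z e \<and> (D n z \<longrightarrow> e = g n z) \<and>
      (\<forall>m. \<forall>\<alpha>\<in>ord_hom m n. set \<alpha> \<noteq> {..n} \<longrightarrow> act P n \<alpha> e = g m (act K n \<alpha> z))" if z: "z \<in> simp K n" for z
  proof (cases "D n z")
    case True
    then show ?thesis using g_in[OF z True] gT[OF z True] g_nat[OF _ z True] by auto
  qed (use that in auto)
  then obtain e where e: "\<And>z. z \<in> simp K n \<Longrightarrow> e z \<in> simp P n" "\<And>z. z \<in> simp K n \<Longrightarrow> T n z (e z)"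
      "\<And>z m \<alpha>. z \<in> simp K n \<Longrightarrow> \<alpha> \<in> ord_hom m n \<Longrightarrow> set \<alpha> \<noteq> {..n} \<Longrightarrow> act P n \<alpha> (e z) = g m (act K n \<alpha> z)"
      "\<And>z. z \<in> simp K n \<Longrightarrow> D n z \<Longrightarrow> e z = g n z"
    by metis
  define R where "R k y z \<alpha> \<longleftrightarrow> z \<in> simp K n \<and> \<alpha> \<in> ord_hom k n \<and> y = act K n \<alpha> z" for k y z \<alpha>
  have R_new: "set \<alpha> = {..n} \<and> \<not> skel K n n z" if r: "R k y z \<alpha>" and nd: "\<not> D k y" for k y z \<alpha>
  proof
    show "set \<alpha> = {..n}" using bd r nd unfolding R_def by blast
    show "\<not> skel K n n z" using closed_inD[OF skel_closed[OF K]] r nd unfolding R_def D_def by blast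
  qed
  have R_uniq: "z = w \<and> \<alpha> = \<beta>" if "R k y z \<alpha>" "R k y w \<beta>" "\<not> D k y" for k y z \<alpha> w \<beta>
    using eilenberg_zilber[OF K] R_new[OF that(1,3)] that unfolding R_def by metis
  have R_ex: "\<exists>z \<alpha>. R k y z \<alpha>" if sk: "skel K (Suc n) k y" and nd: "\<not> D k y" for k y
  proof -
    obtain j z \<alpha> where j: "j < Suc n" "z \<in> simp K j" "\<alpha> \<in> ord_hom k j" "y = act K j \<alpha> z"
      using sk by (auto simp: skel_def)
    have "\<not> j < n" using j nd unfolding D_def skel_def by blast
    then have "j = n" using j(1) by simp
    then show ?thesis using j R_def by blast
  qed
  define g' where "g' k y = (if D k y then g k y else
      (let p = SOME p. R k y (fst p) (snd p) in act P n (snd p) (e (fst p))))" for k y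
  have g'_old: "g' k y = g k y" if "D k y" for k y using that by (simp add: g'_def)
  have g'_new: "g' k y = act P n \<alpha> (e z)" if r: "R k y z \<alpha>" for k y z \<alpha>
  proof (cases "D k y")
    case False
    have "R k y (fst (SOME p. R k y (fst p) (snd p))) (snd (SOME p. R k y (fst p) (snd p)))"
      by (rule someI[of _ "(z, \<alpha>)"]) (simp add: r)
    from R_uniq[OF r this False] show ?thesis using False by (simp add: g'_def Let_def)
  next
    case True
    have z: "z \<in> simp K n" "\<alpha> \<in> ord_hom k n" "y = act K n \<alpha> z" using r by (auto simp: R_def)
    show ?thesis
    proof (cases "set \<alpha> = {..n}")
      case False then show ?thesis using e(3)[OF z(1,2)] z(3) g'_old[OF True] by simp
    next
      case s: True
      obtain \<delta> where d: "\<delta> \<in> ord_hom n k" "ord_comp \<alpha> \<delta> = ord_id n"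
        using ord_hom_surj_section[OF z(2) s, of 0] by blast
      have "act K k \<delta> y = z" using sset_comp[OF K z(2) d(1) z(1)] z(1,3) d(2) sset_id[OF K z(1)] by simp
      then have "D n z" using closed_inD[OF Dcl d(1) _ True] sset_act[OF K z(2,1)] z(3) by simp
      then show ?thesis using e(4)[OF z(1)] g_nat[OF z(2,1)] z(3) g'_old[OF True] by simp
    qed
  qed
  have cases: "D k y \<or> (\<exists>z \<alpha>. R k y z \<alpha>)" if "L k y \<or> skel K (Suc n) k y" for k y
    using R_ex that unfolding D_def by blast
  have g'_T: "g' k y \<in> simp P k \<and> T k y (g' k y)" if y: "y \<in> simp K k" and "L k y \<or> skel K (Suc n) k y" for k y
    using cases[OF that(2)]
  proof (elim disjE exE)
    assume "D k y" then show ?thesis using g'_old g_in gT y by simp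
  next
    fix z \<alpha> assume r: "R k y z \<alpha>"
    then have z: "z \<in> simp K n" "\<alpha> \<in> ord_hom k n" "y = act K n \<alpha> z" by (auto simp: R_def)
    then show ?thesis
      using g'_new[OF r] sset_act[OF P z(2) e(1)[OF z(1)]] T e(1,2)[OF z(1)] unfolding closed_values_def by metis
  qed
  have g'_nat: "g' j (act K k \<theta> y) = act P k \<theta> (g' k y)"
    if t: "\<theta> \<in> ord_hom j k" and y: "y \<in> simp K k" and "L k y \<or> skel K (Suc n) k y" for j k \<theta> y
    using cases[OF that(3)]
  proof (elim disjE exE)
    assume "D k y" then show ?thesis using g'_old g_nat[OF t y] closed_inD[OF Dcl t y] by simp
  next
    fix z \<alpha> assume r: "R k y z \<alpha>"
    then have z: "z \<in> simp K n" "\<alpha> \<in> ord_hom k n" "y = act K n \<alpha> z" by (auto simp: R_def)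
    have "R j (act K k \<theta> y) z (ord_comp \<alpha> \<theta>)"
      using z t ord_comp_in sset_comp[OF K z(2) t z(1)] unfolding R_def by auto
    then show ?thesis using g'_new[OF r] g'_new sset_comp[OF P z(2) t e(1)[OF z(1)]] by simp
  qed
  show ?thesis
  proof (intro exI conjI allI ballI impI)
    show "partial_sol K P T (\<lambda>k y. L k y \<or> skel K (Suc n) k y) g'"
      unfolding partial_sol_def using g'_T g'_nat by (auto intro!: smorI)
    fix k y assume "L k y \<or> skel K n k y"
    then show "g' k y = g k y" using g'_old by (simp add: D_def)
  qed
qed

text \<open>The union of a chain of extensions, one for each dimension. A simplex of dimension \<open>k\<close> has its final
  value from stage \<open>k + 1\<close> on.\<close>

theorem skeletal_extension:
  fixes K :: "'k sset" and P :: "'p sset"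
  assumes K: "is_sset K" and P: "is_sset P" and L: "closed_in K L"
    and T: "closed_values K P T" and ext: "boundary_extension K P T"
    and f: "partial_sol K P T L f"
  obtains g where "smor K P g" "\<And>n y. y \<in> simp K n \<Longrightarrow> T n y (g n y)"
    "\<And>n y. y \<in> simp K n \<Longrightarrow> L n y \<Longrightarrow> g n y = f n y"
proof -
  let ?D = "\<lambda>n k y. L k y \<or> skel K n k y"
  let ?P = "\<lambda>n g. partial_sol K P T (?D n) g \<and> (n = 0 \<longrightarrow> g = f)"
  let ?Q = "\<lambda>n g g'. \<forall>k. \<forall>y\<in>simp K k. ?D n k y \<longrightarrow> g' k y = g k y"
  have base: "\<exists>g. ?P 0 g" using f by (intro exI[of _ f]) (simp add: skel_def)
  have step: "\<exists>g'. ?P (Suc n) g' \<and> ?Q n g g'" if "?P n g" for g n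
    using extend_one_dimension[OF K P L T ext conjunct1[OF that]] by simp
  have "\<exists>G. \<forall>n. ?P n (G n) \<and> ?Q n (G n) (G (Suc n))"
    by (rule dependent_nat_choice[of ?P ?Q]) (rule base, rule step)
  then obtain G where H: "\<forall>n. ?P n (G n) \<and> ?Q n (G n) (G (Suc n))" ..
  have PG: "?P n (G n)" and QG: "?Q n (G n) (G (Suc n))" for n
    using H[THEN spec, of n] by (rule conjunct1, rule conjunct2)
  have G1: "partial_sol K P T (?D n) (G n)" for n using PG[of n] ..
  have G2: "G 0 = f" using PG[of 0] by blast
  have G3: "G (Suc n) k y = G n k y" if "y \<in> simp K k" "?D n k y" for n k y
    using QG[of n] that by blast
  note G = G1 G2 G3
  have mono: "?D m k y" if "?D n k y" "n \<le> m" for n m k y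
    using that(1)
  proof
    assume "skel K n k y"
    then obtain j where "j < n" "\<exists>z\<in>simp K j. \<exists>\<alpha>\<in>ord_hom k j. y = act K j \<alpha> z" unfolding skel_def by auto
    then show ?thesis using less_le_trans[OF _ that(2)] unfolding skel_def by auto
  qed simp
  have agree: "G (n + d) k y = G n k y" if "y \<in> simp K k" "?D n k y" for n d k y
  proof (induction d)
    case (Suc d)
    have "?D (n + d) k y" using mono[OF that(2)] by simp
    then show ?case using G(3)[OF that(1)] Suc.IH by simp
  qed simp
  have all: "?D (Suc k) k y" if "y \<in> simp K k" for k y
  proof -
    have "y = act K k (ord_id k) y" using sset_id[OF K that] by simp
    then have "skel K (Suc k) k y" using that ord_id_in[of k] unfolding skel_def by blast
    then show ?thesis ..
  qed
  define g where "g k y = G (Suc k) k y" for k y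
  have g: "g k y = G m k y" if "y \<in> simp K k" "?D m k y" for k y m
  proof (cases "m \<le> Suc k")
    case True
    then show ?thesis using agree[OF that, of "Suc k - m"] by (simp add: g_def)
  next
    case False
    then show ?thesis using agree[OF that(1) all[OF that(1)], of "m - Suc k"] by (simp add: g_def)
  qed
  have Gm: "smor (subs K (?D n)) P (G n)" for n using G1[of n] unfolding partial_sol_def ..
  show thesis
  proof
    show "smor K P g"
    proof (rule smorI)
      fix k y assume y: "y \<in> simp K k"
      show "g k y \<in> simp P k"
        using smor_in[OF Gm[of "Suc k"], of y k] y all[OF y] by (simp add: g_def)
    next
      fix j k \<theta> y assume t: "\<theta> \<in> ord_hom j k" and y: "y \<in> simp K k"
      have "closed_in K (?D (Suc k))"
        using L skel_closed[OF K, of "Suc k"] unfolding closed_in_def by blast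
      then have "?D (Suc k) j (act K k \<theta> y)" using closed_inD[OF _ t y] all[OF y] by blast
      then have "g j (act K k \<theta> y) = G (Suc k) j (act K k \<theta> y)" using g[OF sset_act[OF K t y]] by blast
      also have "\<dots> = act P k \<theta> (g k y)"
        using smor_nat[OF Gm[of "Suc k"] t, of y] y all[OF y] by (simp add: g_def)
      finally show "g j (act K k \<theta> y) = act P k \<theta> (g k y)" .
    qed
    fix k y assume y: "y \<in> simp K k"
    have "\<forall>y\<in>simp K k. ?D (Suc k) k y \<longrightarrow> T k y (G (Suc k) k y)"
      using G1[of "Suc k"] unfolding partial_sol_def by simp
    then show "T k y (g k y)" using y all[OF y] unfolding g_def by blast
    assume "L k y" then show "g k y = f k y" using g[OF y, of 0] G(2) by simp
  qed
qed

section \<open>Internal homs\<close>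

lemma shom_simp [simp]: "simp (shom A Z) n = smaps (sprod A (simplex n)) Z"
  by (simp add: shom_def)

lemma shom_act:
  assumes "\<beta> \<in> ord_hom k n" "x \<in> simp A j" "\<tau> \<in> ord_hom j k"
  shows "act (shom A Z) n \<beta> h j (x, \<tau>) = h j (x, ord_comp \<beta> \<tau>)"
  using assms by (simp add: shom_def ord_hom_length)

lemma shom_act_in:
  assumes A: "is_sset A" and b: "\<beta> \<in> ord_hom k n" and h: "h \<in> smaps (sprod A (simplex n)) Z"
  shows "act (shom A Z) n \<beta> h \<in> smaps (sprod A (simplex k)) Z"
proof -
  have sm: "smor (sprod A (simplex n)) Z h" using h smaps_smor by blast
  have "smor (sprod A (simplex k)) Z (act (shom A Z) n \<beta> h)"
  proof (rule smorI)
    fix j z assume "z \<in> simp (sprod A (simplex k)) j"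
    then obtain x \<tau> where z: "z = (x, \<tau>)" "x \<in> simp A j" "\<tau> \<in> ord_hom j k" by auto
    show "act (shom A Z) n \<beta> h j z \<in> simp Z j"
      using smor_in[OF sm, of "(x, ord_comp \<beta> \<tau>)" j] z b by (simp add: shom_act ord_comp_in)
  next
    fix l j \<theta> z assume t: "\<theta> \<in> ord_hom l j" and "z \<in> simp (sprod A (simplex k)) j"
    then obtain x \<tau> where z: "z = (x, \<tau>)" "x \<in> simp A j" "\<tau> \<in> ord_hom j k" by auto
    show "act (shom A Z) n \<beta> h l (act (sprod A (simplex k)) j \<theta> z) = act Z j \<theta> (act (shom A Z) n \<beta> h j z)"
      using smor_nat[OF sm t, of "(x, ord_comp \<beta> \<tau>)"] z b t A ord_comp_assoc[OF z(3) t]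
      by (simp add: shom_act ord_comp_in sset_act)
  qed
  moreover have "act (shom A Z) n \<beta> h j \<in> extensional (simp (sprod A (simplex k)) j)" for j
    using ord_hom_length[OF b] by (simp add: shom_def)
  ultimately show ?thesis unfolding smaps_def smor_def by (auto simp: PiE_def)
qed

lemma is_sset_shom:
  assumes A: "is_sset A"
  shows "is_sset (shom A Z)"
proof (rule is_ssetI)
  fix m n \<alpha> h assume "\<alpha> \<in> ord_hom m n" "h \<in> simp (shom A Z) n"
  then show "act (shom A Z) n \<alpha> h \<in> simp (shom A Z) m" using shom_act_in[OF A] by simp
next
  fix n h assume h: "h \<in> simp (shom A Z) n"
  show "act (shom A Z) n (ord_id n) h = h"
  proof (rule smaps_eqI)
    show "act (shom A Z) n (ord_id n) h \<in> smaps (sprod A (simplex n)) Z" "h \<in> smaps (sprod A (simplex n)) Z"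
      using h shom_act_in[OF A ord_id_in] by auto
    fix j z assume "z \<in> simp (sprod A (simplex n)) j"
    then show "act (shom A Z) n (ord_id n) h j z = h j z"
      by (auto simp: shom_act[OF ord_id_in] ord_comp_id_left)
  qed
next
  fix k m n \<alpha> \<beta> h assume a: "\<alpha> \<in> ord_hom m n" and b: "\<beta> \<in> ord_hom k m" and h: "h \<in> simp (shom A Z) n"
  show "act (shom A Z) n (ord_comp \<alpha> \<beta>) h = act (shom A Z) m \<beta> (act (shom A Z) n \<alpha> h)"
  proof (rule smaps_eqI)
    show "act (shom A Z) n (ord_comp \<alpha> \<beta>) h \<in> smaps (sprod A (simplex k)) Z"
      "act (shom A Z) m \<beta> (act (shom A Z) n \<alpha> h) \<in> smaps (sprod A (simplex k)) Z"
      using h shom_act_in[OF A ord_comp_in[OF a b]] shom_act_in[OF A b shom_act_in[OF A a]] by auto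
    fix j z assume "z \<in> simp (sprod A (simplex k)) j"
    then show "act (shom A Z) n (ord_comp \<alpha> \<beta>) h j z = act (shom A Z) m \<beta> (act (shom A Z) n \<alpha> h) j z"
      using ord_comp_in[OF a b] by (auto simp: shom_act[OF a] shom_act[OF b] shom_act ord_comp_in[OF b] ord_comp_assoc[OF b])
  qed
qed

section \<open>The homotopy lifting property\<close>

text \<open>Attaching one simplex \<open>P\<close> along a horn. Injectivity of \<open>\<kappa> \<mapsto> \<kappa>\<^sup>* P\<close> makes the faces and degeneracies of
  \<open>P\<close> distinct, so the filler of the horn determines the extension without further choices.\<close>

lemma horn_attach:
  assumes C: "is_sset C" and S: "closed_in C S" and S': "closed_in C S'" and P: "P \<in> simp C N"
    and N: "1 \<le> N" "k \<le> N"
    and horn: "\<And>m \<kappa>. \<kappa> \<in> ord_hom m N \<Longrightarrow> S m (act C N \<kappa> P) \<longleftrightarrow> \<not> {..N} - {k} \<subseteq> set \<kappa>"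
    and inj: "\<And>m \<kappa> \<kappa>'. \<kappa> \<in> ord_hom m N \<Longrightarrow> \<kappa>' \<in> ord_hom m N \<Longrightarrow> act C N \<kappa> P = act C N \<kappa>' P \<Longrightarrow> \<kappa> = \<kappa>'"
    and SS': "\<And>m x. x \<in> simp C m \<Longrightarrow> S' m x \<Longrightarrow> S m x \<or> (\<exists>\<kappa>\<in>ord_hom m N. x = act C N \<kappa> P)"
    and f: "smor (subs C S) E f" and g: "smor C B g" and p: "kanfib E B p"
    and pf: "\<And>m x. x \<in> simp C m \<Longrightarrow> S m x \<Longrightarrow> p m (f m x) = g m x"
    and E: "is_sset E"
  shows "\<exists>f'. smor (subs C S') E f' \<and> (\<forall>m. \<forall>x\<in>simp C m. S' m x \<longrightarrow> p m (f' m x) = g m x) \<and>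
    (\<forall>m. \<forall>x\<in>simp C m. S m x \<longrightarrow> f' m x = f m x)"
proof -
  have f_in: "f m x \<in> simp E m" if "x \<in> simp C m" "S m x" for m x using smor_in[OF f] that by simp
  have f_nat: "f l (act C m \<theta> x) = act E m \<theta> (f m x)" if "\<theta> \<in> ord_hom l m" "x \<in> simp C m" "S m x" for l m \<theta> x
    using smor_nat[OF f that(1)] that by simp
  have CP: "act C N \<kappa> P \<in> simp C m" if "\<kappa> \<in> ord_hom m N" for m \<kappa> using sset_act[OF C that P] .
  have comp: "act C m \<theta> (act C N \<kappa> P) = act C N (ord_comp \<kappa> \<theta>) P"
    if "\<kappa> \<in> ord_hom m N" "\<theta> \<in> ord_hom l m" for l m \<kappa> \<theta> using sset_comp[OF C that P] .
  let ?u = "\<lambda>m \<kappa>. f m (act C N \<kappa> P)"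
  have u: "smor (horn N k) E ?u"
    proof (rule smorI)
      fix m \<kappa> assume "\<kappa> \<in> simp (horn N k) m"
      then show "?u m \<kappa> \<in> simp E m" using f_in[OF CP] horn by simp
    next
      fix l m \<theta> \<kappa> assume "\<theta> \<in> ord_hom l m" "\<kappa> \<in> simp (horn N k) m"
      then show "?u l (act (horn N k) m \<theta> \<kappa>) = act E m \<theta> (?u m \<kappa>)"
        using f_nat[OF _ CP] horn comp by simp
    qed
  have pu: "p m (?u m \<kappa>) = act B N \<kappa> (g N P)" if "\<kappa> \<in> simp (horn N k) m" for m \<kappa>
    using that pf[OF CP] horn smor_nat[OF g _ P] by simp
  obtain e where e: "e \<in> simp E N" "p N e = g N P" "\<And>m \<kappa>. \<kappa> \<in> simp (horn N k) m \<Longrightarrow> act E N \<kappa> e = ?u m \<kappa>"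
    using kanfib_lift[OF p N smor_in[OF g P] u pu] by metis
  define f' where "f' m x = (if S m x then f m x else act E N (THE \<kappa>. \<kappa> \<in> ord_hom m N \<and> x = act C N \<kappa> P) e)" for m x
  have old: "f' m x = f m x" if "S m x" for m x using that by (simp add: f'_def)
  have new: "f' m (act C N \<kappa> P) = act E N \<kappa> e" if k: "\<kappa> \<in> ord_hom m N" for m \<kappa>
  proof (cases "S m (act C N \<kappa> P)")
    case True
    then show ?thesis using old[OF True] e(3)[of \<kappa> m] horn[OF k] k by simp
  next
    case False
    have "(THE \<kappa>'. \<kappa>' \<in> ord_hom m N \<and> act C N \<kappa> P = act C N \<kappa>' P) = \<kappa>"
      using k inj by (intro the_equality) auto
    then show ?thesis using False by (simp add: f'_def)
  qed
  have pnat: "p m (act E N \<kappa> e) = g m (act C N \<kappa> P)" if "\<kappa> \<in> ord_hom m N" for m \<kappa>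
    using smor_nat[OF kanfib_smor[OF p] that e(1)] smor_nat[OF g that P] e(2) by simp
  show ?thesis
  proof (intro exI conjI allI ballI impI)
    show "smor (subs C S') E f'"
    proof (rule smorI)
      fix m x assume "x \<in> simp (subs C S') m"
      then have x: "x \<in> simp C m" "S' m x" by auto
      from SS'[OF x] show "f' m x \<in> simp E m"
        using old f_in[OF x(1)] new sset_act[OF E _ e(1)] by auto
    next
      fix l m \<theta> x assume t: "\<theta> \<in> ord_hom l m" and "x \<in> simp (subs C S') m"
      then have x: "x \<in> simp C m" "S' m x" by auto
      from SS'[OF x] show "f' l (act (subs C S') m \<theta> x) = act E m \<theta> (f' m x)"
      proof
        assume s: "S m x"
        then show ?thesis using old[OF s] old[OF closed_inD[OF S t x(1) s]] f_nat[OF t x(1) s] by simp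
      next
        assume "\<exists>\<kappa>\<in>ord_hom m N. x = act C N \<kappa> P"
        then obtain \<kappa> where k: "\<kappa> \<in> ord_hom m N" "x = act C N \<kappa> P" by auto
        then show ?thesis using new comp[OF k(1) t] ord_comp_in[OF k(1) t] sset_comp[OF E k(1) t e(1)] by simp
      qed
    qed
    fix m x assume x: "x \<in> simp C m"
    show "f' m x = f m x" if "S m x" using old that by simp
    show "p m (f' m x) = g m x" if "S' m x"
      using SS'[OF x that] old pf[OF x] new pnat by auto
  qed
qed

text \<open>The cylinder \<open>\<Delta>\<^sup>1 \<times> \<Delta>\<^sup>n\<close> is obtained from \<open>\<Delta>\<^sup>1 \<times> \<partial>\<Delta>\<^sup>n\<close> and the end \<open>{\<epsilon>} \<times> \<Delta>\<^sup>n\<close> by attaching, one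
  after the other, the \<open>n + 1\<close> shuffles of dimension \<open>n + 1\<close>, each along a horn. After \<open>i\<close> steps, a
  simplex \<open>(\<chi>, \<alpha>)\<close> with \<open>\<alpha>\<close> surjective is present if the vertices that it has at the other end lie
  among the \<open>i\<close> lowest (for \<open>\<epsilon> = 1\<close>) or highest (for \<open>\<epsilon> = 0\<close>) vertices of \<open>\<Delta>\<^sup>n\<close>.\<close>

definition prism_stage :: "nat \<Rightarrow> nat \<Rightarrow> nat \<Rightarrow> nat \<Rightarrow> nat list \<times> nat list \<Rightarrow> bool" where
  "prism_stage n \<epsilon> i m z \<longleftrightarrow> set (snd z) \<noteq> {..n} \<or>
     (\<forall>j\<le>m. fst z ! j \<noteq> \<epsilon> \<longrightarrow> (if \<epsilon> = 1 then snd z ! j else n - snd z ! j) < i)"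

text \<open>The shuffle with turning point \<open>c\<close> is the chain \<open>(0,0), \<dots>, (0,c), (1,c), \<dots>, (1,n)\<close> of vertices of
  \<open>\<Delta>\<^sup>1 \<times> \<Delta>\<^sup>n\<close>; its \<open>v\<close>-th vertex has level and position as follows.\<close>

definition shuffle_level :: "nat \<Rightarrow> nat \<Rightarrow> nat" where
  "shuffle_level c v = (if v \<le> c then 0 else 1)"

definition shuffle_vertex :: "nat \<Rightarrow> nat \<Rightarrow> nat" where
  "shuffle_vertex c v = (if v \<le> c then v else v - 1)"

definition shuffle :: "nat \<Rightarrow> nat \<Rightarrow> nat list \<times> nat list" where
  "shuffle n c = (map (shuffle_level c) [0..<Suc (Suc n)], map (shuffle_vertex c) [0..<Suc (Suc n)])"

abbreviation prism :: "nat \<Rightarrow> (nat list \<times> nat list) sset" where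
  "prism n \<equiv> sprod (simplex 1) (simplex n)"

lemma is_sset_prism: "is_sset (prism n)"
  by (intro is_sset_sprod is_sset_simplex)

lemma prism_stage_closed: "closed_in (prism n) (prism_stage n \<epsilon> i)"
  unfolding closed_in_def
proof (intro allI ballI impI)
  fix l m \<theta> z assume t: "\<theta> \<in> ord_hom l m" and z: "z \<in> simp (prism n) m" and s: "prism_stage n \<epsilon> i m z"
  obtain \<chi> \<alpha> where za: "z = (\<chi>, \<alpha>)" "\<chi> \<in> ord_hom m 1" "\<alpha> \<in> ord_hom m n" using z by auto
  have nth: "ord_comp \<beta> \<theta> ! j = \<beta> ! (\<theta> ! j)" "\<theta> ! j \<le> m" if "j \<le> l" for \<beta> j
    using that t ord_hom_nth_le[OF t] by (auto simp: ord_comp_nth ord_hom_length)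
  from s show "prism_stage n \<epsilon> i l (act (prism n) m \<theta> z)"
    using boundary_closed[OF za(3) t] nth unfolding prism_stage_def za by auto
qed

lemma shuffle_in: "c \<le> n \<Longrightarrow> shuffle n c \<in> simp (prism n) (Suc n)"
  unfolding shuffle_def sprod_simps simplex_simps
  by (intro SigmaI ord_hom_mapI) (auto simp: shuffle_level_def shuffle_vertex_def)

lemma shuffle_act:
  assumes "\<kappa> \<in> ord_hom m (Suc n)"
  shows "act (prism n) (Suc n) \<kappa> (shuffle n c) = (map (shuffle_level c) \<kappa>, map (shuffle_vertex c) \<kappa>)"
  using ord_hom_set[OF assms] unfolding shuffle_def sprod_simps simplex_simps ord_comp_def
  by (auto simp del: upt_Suc simp: less_Suc_eq_le)

lemma shuffle_inj:
  assumes "\<kappa> \<in> ord_hom m (Suc n)" "\<kappa>' \<in> ord_hom m (Suc n)"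
    "act (prism n) (Suc n) \<kappa> (shuffle n c) = act (prism n) (Suc n) \<kappa>' (shuffle n c)"
  shows "\<kappa> = \<kappa>'"
proof -
  have eq: "map (shuffle_level c) \<kappa> = map (shuffle_level c) \<kappa>'" "map (shuffle_vertex c) \<kappa> = map (shuffle_vertex c) \<kappa>'"
    using assms(3) unfolding shuffle_act[OF assms(1)] shuffle_act[OF assms(2)] by auto
  have sum: "shuffle_level c v + shuffle_vertex c v = v" for v
    by (auto simp: shuffle_level_def shuffle_vertex_def)
  show ?thesis
  proof (rule nth_equalityI)
    show l: "length \<kappa> = length \<kappa>'" using eq map_eq_imp_length_eq by blast
    fix j assume j: "j < length \<kappa>"
    have "shuffle_level c (\<kappa> ! j) = shuffle_level c (\<kappa>' ! j)" "shuffle_vertex c (\<kappa> ! j) = shuffle_vertex c (\<kappa>' ! j)"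
      using eq j l by (metis nth_map)+
    then show "\<kappa> ! j = \<kappa>' ! j" using sum by metis
  qed
qed

lemma shuffle_surj:
  assumes "V \<subseteq> {..Suc n}" "c \<le> n"
  shows "shuffle_vertex c ` V = {..n} \<longleftrightarrow> {..Suc n} - {c, Suc c} \<subseteq> V \<and> (c \<in> V \<or> Suc c \<in> V)" (is "?l = ?r")
proof
  assume l: ?l
  have ex: "\<exists>v\<in>V. shuffle_vertex c v = w" if "w \<le> n" for w
    using l that by (metis atMost_iff imageE)
  have "c \<in> V \<or> Suc c \<in> V" using ex[OF assms(2)] by (auto simp: shuffle_vertex_def split: if_splits)
  moreover have "w \<in> V" if "w \<in> {..Suc n} - {c, Suc c}" for w
  proof (cases "w < c")
    case True then show ?thesis using ex[of w] assms by (auto simp: shuffle_vertex_def split: if_splits)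
  next
    case False
    then have "Suc c < w" "w - 1 \<le> n" using that by auto
    then obtain v where v: "v \<in> V" "shuffle_vertex c v = w - 1" using ex by blast
    then have "v = w" using \<open>Suc c < w\<close> by (auto simp: shuffle_vertex_def split: if_splits)
    then show ?thesis using v by simp
  qed
  ultimately show ?r by blast
next
  assume r: ?r
  have "shuffle_vertex c ` V \<subseteq> {..n}" using assms by (auto simp: shuffle_vertex_def)
  moreover have "w \<in> shuffle_vertex c ` V" if w: "w \<le> n" for w
  proof -
    have "w \<in> V" if "w < c" using r that w by auto
    moreover have "Suc w \<in> V" if "w > c" using r that w by auto
    ultimately consider "w < c" "w \<in> V" | "w = c" | "w > c" "Suc w \<in> V" by linarith
    then show ?thesis
    proof cases
      case 1 then show ?thesis by (intro image_eqI[of _ _ w]) (auto simp: shuffle_vertex_def)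
    next
      case 2 
      from r have "c \<in> V \<or> Suc c \<in> V" ..
      then show ?thesis
      proof
        assume "c \<in> V" then show ?thesis using 2 by (intro image_eqI[of _ _ c]) (auto simp: shuffle_vertex_def)
      next
        assume "Suc c \<in> V" then show ?thesis using 2 by (intro image_eqI[of _ _ "Suc c"]) (auto simp: shuffle_vertex_def)
      qed
    next
      case 3 then show ?thesis by (intro image_eqI[of _ _ "Suc w"]) (auto simp: shuffle_vertex_def)
    qed
  qed
  ultimately show ?l by auto
qed

text \<open>The new shuffle meets the previous stage exactly in a horn: the missing face is the one that omits
  the vertex \<open>(1,c)\<close> (for \<open>\<epsilon> = 1\<close>) or \<open>(0,c)\<close> (for \<open>\<epsilon> = 0\<close>), so that it has \<open>c\<close> among its vertices at the
  other end. Every other face has its vertices at the other end in the range already covered, or projects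
  to the boundary of \<open>\<Delta>\<^sup>n\<close>.\<close>

lemma shuffle_stage:
  assumes k: "\<kappa> \<in> ord_hom m (Suc n)" and e: "\<epsilon> = 0 \<or> \<epsilon> = 1" and i: "i \<le> n"
    and c: "c = (if \<epsilon> = 1 then i else n - i)"
  shows "prism_stage n \<epsilon> i m (act (prism n) (Suc n) \<kappa> (shuffle n c)) \<longleftrightarrow>
    \<not> {..Suc n} - {if \<epsilon> = 1 then Suc c else c} \<subseteq> set \<kappa>"
proof -
  let ?x = "if \<epsilon> = 1 then c else Suc c"
  have V: "set \<kappa> \<subseteq> {..Suc n}" and cn: "c \<le> n" using ord_hom_set[OF k] i c by auto
  have len: "length \<kappa> = Suc m" using ord_hom_length[OF k] .
  have all: "(\<forall>j\<le>m. Q (\<kappa> ! j)) \<longleftrightarrow> (\<forall>v\<in>set \<kappa>. Q v)" for Q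
    using len by (auto simp: in_set_conv_nth all_set_conv_all_nth less_Suc_eq_le)
  have "(\<forall>j\<le>m. map (shuffle_level c) \<kappa> ! j \<noteq> \<epsilon> \<longrightarrow>
      (if \<epsilon> = 1 then map (shuffle_vertex c) \<kappa> ! j else n - map (shuffle_vertex c) \<kappa> ! j) < i) \<longleftrightarrow>
    (\<forall>j\<le>m. shuffle_level c (\<kappa> ! j) \<noteq> \<epsilon> \<longrightarrow>
      (if \<epsilon> = 1 then shuffle_vertex c (\<kappa> ! j) else n - shuffle_vertex c (\<kappa> ! j)) < i)"
    using len by simp
  also have "\<dots> \<longleftrightarrow> (\<forall>v\<in>set \<kappa>. shuffle_level c v \<noteq> \<epsilon> \<longrightarrow>
      (if \<epsilon> = 1 then shuffle_vertex c v else n - shuffle_vertex c v) < i)" by (rule all)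
  also have "\<dots> \<longleftrightarrow> (\<forall>v\<in>set \<kappa>. v \<noteq> ?x)"
  proof (rule ball_cong[OF refl])
    fix v assume "v \<in> set \<kappa>"
    then have "v \<le> Suc n" using V by auto
    then show "(shuffle_level c v \<noteq> \<epsilon> \<longrightarrow>
      (if \<epsilon> = 1 then shuffle_vertex c v else n - shuffle_vertex c v) < i) \<longleftrightarrow> v \<noteq> ?x"
      using e i unfolding c shuffle_level_def shuffle_vertex_def by auto
  qed
  finally have "prism_stage n \<epsilon> i m (act (prism n) (Suc n) \<kappa> (shuffle n c)) \<longleftrightarrow>
    shuffle_vertex c ` set \<kappa> \<noteq> {..n} \<or> (\<forall>v\<in>set \<kappa>. v \<noteq> ?x)"
    unfolding prism_stage_def shuffle_act[OF k] fst_conv snd_conv set_map by simp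
  then have "prism_stage n \<epsilon> i m (act (prism n) (Suc n) \<kappa> (shuffle n c)) \<longleftrightarrow>
    \<not> ({..Suc n} - {c, Suc c} \<subseteq> set \<kappa> \<and> (c \<in> set \<kappa> \<or> Suc c \<in> set \<kappa>) \<and> ?x \<in> set \<kappa>)"
    unfolding shuffle_surj[OF V cn] by blast
  also have "\<dots> \<longleftrightarrow> \<not> {..Suc n} - {if \<epsilon> = 1 then Suc c else c} \<subseteq> set \<kappa>"
  proof -
    have "{..Suc n} - {Suc c} = insert c ({..Suc n} - {c, Suc c})"
      "{..Suc n} - {c} = insert (Suc c) ({..Suc n} - {c, Suc c})" using cn by auto
    then show ?thesis by (cases "\<epsilon> = 1") (simp_all only: insert_subset if_True if_False simp_thms, auto)
  qed
  finally show ?thesis .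
qed

lemma shuffle_cover:
  assumes z: "z \<in> simp (prism n) m" and s: "prism_stage n \<epsilon> (Suc i) m z" and e: "\<epsilon> = 0 \<or> \<epsilon> = 1"
    and i: "i \<le> n" and c: "c = (if \<epsilon> = 1 then i else n - i)"
  shows "prism_stage n \<epsilon> i m z \<or> (\<exists>\<kappa>\<in>ord_hom m (Suc n). z = act (prism n) (Suc n) \<kappa> (shuffle n c))"
proof (cases "prism_stage n \<epsilon> i m z")
  case not: False
  obtain \<chi> \<alpha> where za: "z = (\<chi>, \<alpha>)" "\<chi> \<in> ord_hom m 1" "\<alpha> \<in> ord_hom m n" using z by auto
  from not obtain j where j: "j \<le> m" "\<chi> ! j \<noteq> \<epsilon>" "\<not> (if \<epsilon> = 1 then \<alpha> ! j else n - \<alpha> ! j) < i"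
    and surj: "set \<alpha> = {..n}"
    unfolding prism_stage_def za fst_conv snd_conv de_Morgan_disj not_all not_imp by (elim conjE exE) simp
  have all: "(if \<epsilon> = 1 then \<alpha> ! l else n - \<alpha> ! l) \<le> i" if "l \<le> m" "\<chi> ! l \<noteq> \<epsilon>" for l
    using s surj that unfolding prism_stage_def za by (auto simp: less_Suc_eq_le)
  have chi: "\<chi> ! l \<le> 1" "\<alpha> ! l \<le> n" if "l \<le> m" for l
    using that ord_hom_nth_le[OF za(2)] ord_hom_nth_le[OF za(3)] by auto
  have aj: "\<alpha> ! j = c" using all[OF j(1,2)] j(3) chi[OF j(1)] i c by (auto split: if_splits)
  have bound: "(\<chi> ! l = 0 \<longrightarrow> \<alpha> ! l \<le> c) \<and> (\<chi> ! l = 1 \<longrightarrow> c \<le> \<alpha> ! l)" if l: "l \<le> m" for l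
  proof (cases "\<chi> ! l = \<epsilon>")
    case False
    then show ?thesis using all[OF l False] e c chi[OF l] i by (auto split: if_splits)
  next
    case True
    have cl: "\<chi> ! j \<noteq> \<chi> ! l" using True j by simp
    show ?thesis
    proof (cases "\<epsilon> = 1")
      case e1: True
      then have "j \<le> l" using cl True j chi[OF j(1)] ord_hom_mono[OF za(2), of l j] l by (cases "j \<le> l") auto
      then show ?thesis using e1 True aj ord_hom_mono[OF za(3) _ l] by auto
    next
      case e0: False
      then have "\<epsilon> = 0" using e by simp
      then have "l \<le> j" using cl True j chi[OF j(1)] ord_hom_mono[OF za(2), of j l] l by (cases "l \<le> j") auto
      then show ?thesis using \<open>\<epsilon> = 0\<close> True aj ord_hom_mono[OF za(3) _ j(1)] by auto
    qed
  qed
  \<comment> \<open>Along a shuffle the index of a vertex is the sum of its two coordinates.\<close>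
  let ?k = "map (\<lambda>l. \<alpha> ! l + \<chi> ! l) [0..<Suc m]"
  have k: "?k \<in> ord_hom m (Suc n)"
    by (rule ord_hom_mapI) (use chi ord_hom_mono[OF za(2)] ord_hom_mono[OF za(3)] in \<open>auto intro: add_mono add_le_mono[of _ n _ 1, simplified]\<close>)
  have kl: "shuffle_level c (\<alpha> ! l + \<chi> ! l) = \<chi> ! l \<and> shuffle_vertex c (\<alpha> ! l + \<chi> ! l) = \<alpha> ! l" if "l \<le> m" for l
  proof -
    have "\<chi> ! l = 0 \<or> \<chi> ! l = 1" using chi(1)[OF that] by auto
    then show ?thesis using bound[OF that] by (auto simp: shuffle_level_def shuffle_vertex_def)
  qed
  have "z = act (prism n) (Suc n) ?k (shuffle n c)"
    unfolding shuffle_act[OF k] za(1) map_map prod.inject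
    by (intro conjI nth_equalityI) (use kl in \<open>auto simp: ord_hom_length[OF za(2)] ord_hom_length[OF za(3)] less_Suc_eq_le\<close>)
  then show ?thesis using k by blast
qed simp

lemma prism_extension:
  assumes E: "is_sset E" and p: "kanfib E B p" and g: "smor (prism n) B g" and e: "\<epsilon> = 0 \<or> \<epsilon> = 1"
    and f: "smor (subs (prism n) (prism_stage n \<epsilon> 0)) E f"
    and pf: "\<And>m z. z \<in> simp (prism n) m \<Longrightarrow> prism_stage n \<epsilon> 0 m z \<Longrightarrow> p m (f m z) = g m z"
  obtains f' where "smor (prism n) E f'" "\<And>m z. z \<in> simp (prism n) m \<Longrightarrow> p m (f' m z) = g m z"
    "\<And>m z. z \<in> simp (prism n) m \<Longrightarrow> prism_stage n \<epsilon> 0 m z \<Longrightarrow> f' m z = f m z"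
proof -
  have mono: "prism_stage n \<epsilon> 0 m z \<Longrightarrow> prism_stage n \<epsilon> i m z" for i m z
    unfolding prism_stage_def by (metis not_less_zero)
  have "\<exists>f'. smor (subs (prism n) (prism_stage n \<epsilon> i)) E f' \<and>
      (\<forall>m. \<forall>z\<in>simp (prism n) m. prism_stage n \<epsilon> i m z \<longrightarrow> p m (f' m z) = g m z) \<and>
      (\<forall>m. \<forall>z\<in>simp (prism n) m. prism_stage n \<epsilon> 0 m z \<longrightarrow> f' m z = f m z)" if "i \<le> Suc n" for i
    using that
  proof (induction i)
    case 0
    then show ?case using f pf by (intro exI[of _ f]) simp
  next
    case (Suc i)
    then obtain h where h: "smor (subs (prism n) (prism_stage n \<epsilon> i)) E h"
      "\<And>m z. z\<in>simp (prism n) m \<Longrightarrow> prism_stage n \<epsilon> i m z \<Longrightarrow> p m (h m z) = g m z"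
      "\<And>m z. z\<in>simp (prism n) m \<Longrightarrow> prism_stage n \<epsilon> 0 m z \<Longrightarrow> h m z = f m z" by auto
    have i: "i \<le> n" using Suc.prems by simp
    define c where "c = (if \<epsilon> = 1 then i else n - i)"
    have cn: "c \<le> n" using i by (simp add: c_def)
    have N: "1 \<le> Suc n" "(if \<epsilon> = 1 then Suc c else c) \<le> Suc n" using cn by auto
    have "\<exists>f'. smor (subs (prism n) (prism_stage n \<epsilon> (Suc i))) E f' \<and>
       (\<forall>m. \<forall>x\<in>simp (prism n) m. prism_stage n \<epsilon> (Suc i) m x \<longrightarrow> p m (f' m x) = g m x) \<and>
       (\<forall>m. \<forall>x\<in>simp (prism n) m. prism_stage n \<epsilon> i m x \<longrightarrow> f' m x = h m x)"
      by (rule horn_attach[OF is_sset_prism prism_stage_closed prism_stage_closed shuffle_in[OF cn] N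
          shuffle_stage[OF _ e i c_def] shuffle_inj shuffle_cover[OF _ _ e i c_def] h(1) g p h(2) E])
    then obtain f' where f': "smor (subs (prism n) (prism_stage n \<epsilon> (Suc i))) E f'"
       "\<And>m x. x \<in> simp (prism n) m \<Longrightarrow> prism_stage n \<epsilon> (Suc i) m x \<Longrightarrow> p m (f' m x) = g m x"
       "\<And>m x. x \<in> simp (prism n) m \<Longrightarrow> prism_stage n \<epsilon> i m x \<Longrightarrow> f' m x = h m x" by blast
    show ?case
    proof (intro exI conjI allI ballI impI)
      show "smor (subs (prism n) (prism_stage n \<epsilon> (Suc i))) E f'" by (rule f'(1))
      fix m z assume z: "z \<in> simp (prism n) m"
      show "p m (f' m z) = g m z" if "prism_stage n \<epsilon> (Suc i) m z" by (rule f'(2)[OF z that])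
      show "f' m z = f m z" if "prism_stage n \<epsilon> 0 m z" using f'(3)[OF z mono[OF that]] h(3)[OF z that] by simp
    qed
  qed
  from this[OF order_refl] obtain f' where f': "smor (subs (prism n) (prism_stage n \<epsilon> (Suc n))) E f'"
      "\<And>m z. z\<in>simp (prism n) m \<Longrightarrow> prism_stage n \<epsilon> (Suc n) m z \<Longrightarrow> p m (f' m z) = g m z"
      "\<And>m z. z\<in>simp (prism n) m \<Longrightarrow> prism_stage n \<epsilon> 0 m z \<Longrightarrow> f' m z = f m z" by auto
  have top: "prism_stage n \<epsilon> (Suc n) m z" if "z \<in> simp (prism n) m" for m z
    using that ord_hom_nth_le[of "snd z" m n] unfolding prism_stage_def by (auto simp: less_Suc_eq_le)
  have "smor (prism n) E f'"
    by (rule smorI) (use smor_in[OF f'(1)] smor_nat[OF f'(1)] top in auto)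
  then show thesis using that f'(2)[OF _ top] f'(3) by blast
qed

text \<open>A homotopy on \<open>K\<close> with values in \<open>E\<close> is a map from \<open>K\<close> to the path object of \<open>E\<close>. Lifting it over \<open>\<beta>\<close> with the
  end \<open>\<epsilon>\<close> prescribed restricts its values simplex by simplex, so the skeletal extension reduces the problem to
  filling one prism \<open>\<Delta>\<^sup>1 \<times> \<Delta>\<^sup>n\<close> relative to its sides and one end.\<close>

theorem homotopy_lifting:
  fixes K :: "'k sset" and E :: "'e sset" and B :: "'b sset"
  assumes K: "is_sset K" and E: "is_sset E" and p: "kanfib E B p"
    and \<beta>: "smor (sprod K (simplex 1)) B \<beta>" and a: "smor K E a" and \<epsilon>: "\<epsilon> = 0 \<or> \<epsilon> = 1"
    and pa: "\<And>n x. x \<in> simp K n \<Longrightarrow> p n (a n x) = \<beta> n (x, ord_const n \<epsilon>)"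
    and L: "closed_in K L" and H0: "smor (subs (sprod K (simplex 1)) (\<lambda>n z. L n (fst z))) E H0"
    and pH0: "\<And>n x \<tau>. x \<in> simp K n \<Longrightarrow> L n x \<Longrightarrow> \<tau> \<in> ord_hom n 1 \<Longrightarrow> p n (H0 n (x, \<tau>)) = \<beta> n (x, \<tau>)"
    and aH0: "\<And>n x. x \<in> simp K n \<Longrightarrow> L n x \<Longrightarrow> H0 n (x, ord_const n \<epsilon>) = a n x"
  shows "\<exists>H. smor (sprod K (simplex 1)) E H \<and> (\<forall>n. \<forall>x\<in>simp K n. H n (x, ord_const n \<epsilon>) = a n x \<and>
    (\<forall>\<tau>\<in>ord_hom n 1. p n (H n (x, \<tau>)) = \<beta> n (x, \<tau>) \<and> (L n x \<longrightarrow> H n (x, \<tau>) = H0 n (x, \<tau>))))"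
proof -
  let ?P = "shom (simplex 1) E"
  have P: "is_sset ?P" by (intro is_sset_shom is_sset_simplex)
  have e1: "\<epsilon> \<le> 1" using \<epsilon> by auto
  have ce: "ord_const m \<epsilon> \<in> ord_hom m 1" for m using ord_const_in[OF e1] .
  \<comment> \<open>The paths over the given homotopy at \<open>y\<close> that have the prescribed end.\<close>
  define T where "T n y h \<longleftrightarrow> (\<forall>m. \<forall>\<chi>\<in>ord_hom m 1. \<forall>\<alpha>\<in>ord_hom m n. p m (h m (\<chi>, \<alpha>)) = \<beta> m (act K n \<alpha> y, \<chi>)) \<and>
    (\<forall>m. \<forall>\<alpha>\<in>ord_hom m n. h m (ord_const m \<epsilon>, \<alpha>) = a m (act K n \<alpha> y))" for n y h
  have TI: "T n y h" if "\<And>m \<chi> \<alpha>. \<chi> \<in> ord_hom m 1 \<Longrightarrow> \<alpha> \<in> ord_hom m n \<Longrightarrow> p m (h m (\<chi>, \<alpha>)) = \<beta> m (act K n \<alpha> y, \<chi>)"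
      "\<And>m \<alpha>. \<alpha> \<in> ord_hom m n \<Longrightarrow> h m (ord_const m \<epsilon>, \<alpha>) = a m (act K n \<alpha> y)" for n y h
    using that unfolding T_def by simp
  have T1: "p m (h m (\<chi>, \<alpha>)) = \<beta> m (act K n \<alpha> y, \<chi>)" if "T n y h" "\<chi> \<in> ord_hom m 1" "\<alpha> \<in> ord_hom m n" for n y h m \<chi> \<alpha>
    using that unfolding T_def by simp
  have T2: "h m (ord_const m \<epsilon>, \<alpha>) = a m (act K n \<alpha> y)" if "T n y h" "\<alpha> \<in> ord_hom m n" for n y h m \<alpha>
    using that unfolding T_def by simp
  have act: "act ?P n \<theta> h m (\<chi>, \<alpha>) = h m (\<chi>, ord_comp \<theta> \<alpha>)"
    if "\<theta> \<in> ord_hom k n" "\<chi> \<in> ord_hom m 1" "\<alpha> \<in> ord_hom m k" for n k \<theta> h m \<chi> \<alpha>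
    by (rule shom_act[OF that(1) _ that(3)]) (use that(2) in simp)
  have T: "closed_values K ?P T"
    unfolding closed_values_def
  proof (intro allI ballI impI)
    fix k n \<theta> y h assume t: "\<theta> \<in> ord_hom k n" and y: "y \<in> simp K n" and h: "h \<in> simp ?P n" "T n y h"
    show "T k (act K n \<theta> y) (act ?P n \<theta> h)"
    proof (rule TI)
      fix m \<chi> \<alpha> assume c: "\<chi> \<in> ord_hom m 1" and a: "\<alpha> \<in> ord_hom m k"
      show "p m (act ?P n \<theta> h m (\<chi>, \<alpha>)) = \<beta> m (act K k \<alpha> (act K n \<theta> y), \<chi>)"
        using T1[OF h(2) c ord_comp_in[OF t a]] by (simp only: act[OF t c a] sset_comp[OF K t a y])
    next
      fix m \<alpha> assume a: "\<alpha> \<in> ord_hom m k"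
      show "act ?P n \<theta> h m (ord_const m \<epsilon>, \<alpha>) = a m (act K k \<alpha> (act K n \<theta> y))"
        using T2[OF h(2) ord_comp_in[OF t a]] by (simp only: act[OF t ce a] sset_comp[OF K t a y])
    qed
  qed
  have ext: "boundary_extension K ?P T"
    unfolding boundary_extension_def
  proof (intro allI ballI impI)
    fix n y u assume y: "y \<in> simp K n"
      and "smor (boundary n) ?P u \<and> (\<forall>m. \<forall>\<alpha>\<in>simp (boundary n) m. T m (act K n \<alpha> y) (u m \<alpha>))"
    then have u: "smor (boundary n) ?P u" and uT: "\<And>m \<alpha>. \<alpha> \<in> simp (boundary n) m \<Longrightarrow> T m (act K n \<alpha> y) (u m \<alpha>)"
      by auto
    define f where "f m z = (if set (snd z) \<noteq> {..n} then u m (snd z) m (fst z, ord_id m) else a m (act K n (snd z) y))" for m z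
    define g where "g m z = \<beta> m (act K n (snd z) y, fst z)" for m and z :: "nat list \<times> nat list"
    have um: "smor (prism m) E (u m \<alpha>)" if "\<alpha> \<in> ord_hom m n" "set \<alpha> \<noteq> {..n}" for m \<alpha>
      using smor_in[OF u, of \<alpha> m] that smaps_smor[of "u m \<alpha>"] by simp
    have f_new: "f m (ord_const m \<epsilon>, \<alpha>) = a m (act K n \<alpha> y)" if al: "\<alpha> \<in> ord_hom m n" for m \<alpha>
    proof (cases "set \<alpha> \<noteq> {..n}")
      case True
      have "u m \<alpha> m (ord_const m \<epsilon>, ord_id m) = a m (act K m (ord_id m) (act K n \<alpha> y))"
        using uT[of \<alpha> m] True al by (intro T2[OF _ ord_id_in]) simp
      then show ?thesis using True sset_id[OF K sset_act[OF K al y]] by (simp add: f_def)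
    qed (simp add: f_def)
    have stage: "set \<alpha> \<noteq> {..n} \<or> \<chi> = ord_const m \<epsilon>"
      if "prism_stage n \<epsilon> 0 m (\<chi>, \<alpha>)" "\<chi> \<in> ord_hom m 1" for m \<chi> \<alpha>
    proof -
      have "\<chi> = ord_const m \<epsilon>" if "set \<alpha> = {..n}"
        using that \<open>prism_stage n \<epsilon> 0 m (\<chi>, \<alpha>)\<close> ord_hom_length[OF \<open>\<chi> \<in> ord_hom m 1\<close>]
        by (intro nth_equalityI) (auto simp: prism_stage_def less_Suc_eq_le)
      then show ?thesis by blast
    qed
    have g: "smor (prism n) B g"
    proof (rule smorI)
      fix m z assume "z \<in> simp (prism n) m"
      then show "g m z \<in> simp B m" using smor_in[OF \<beta>] sset_act[OF K _ y] by (auto simp: g_def)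
    next
      fix l m \<theta> z assume t: "\<theta> \<in> ord_hom l m" and "z \<in> simp (prism n) m"
      then obtain \<chi> \<alpha> where z: "z = (\<chi>, \<alpha>)" "\<chi> \<in> ord_hom m 1" "\<alpha> \<in> ord_hom m n" by auto
      show "g l (act (prism n) m \<theta> z) = act B m \<theta> (g m z)"
        using smor_nat[OF \<beta> t, of "(act K n \<alpha> y, \<chi>)"] z sset_act[OF K z(3) y] sset_comp[OF K z(3) t y]
        by (simp add: g_def)
    qed
    have f: "smor (subs (prism n) (prism_stage n \<epsilon> 0)) E f"
    proof (rule smorI)
      fix m z assume "z \<in> simp (subs (prism n) (prism_stage n \<epsilon> 0)) m"
      then obtain \<chi> \<alpha> where z: "z = (\<chi>, \<alpha>)" "\<chi> \<in> ord_hom m 1" "\<alpha> \<in> ord_hom m n" by auto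
      show "f m z \<in> simp E m"
      proof (cases "set \<alpha> \<noteq> {..n}")
        case True
        then show ?thesis using smor_in[OF um[OF z(3)], of "(\<chi>, ord_id m)" m] z(1,2) ord_id_in by (simp add: f_def)
      next
        case False
        then show ?thesis using smor_in[OF a sset_act[OF K z(3) y]] z(1) by (simp add: f_def)
      qed
    next
      fix l m \<theta> z assume t: "\<theta> \<in> ord_hom l m" and z': "z \<in> simp (subs (prism n) (prism_stage n \<epsilon> 0)) m"
      then obtain \<chi> \<alpha> where z: "z = (\<chi>, \<alpha>)" "\<chi> \<in> ord_hom m 1" "\<alpha> \<in> ord_hom m n" by auto
      have ac: "act (subs (prism n) (prism_stage n \<epsilon> 0)) m \<theta> z = (ord_comp \<chi> \<theta>, ord_comp \<alpha> \<theta>)" using z(1) by simp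
      show "f l (act (subs (prism n) (prism_stage n \<epsilon> 0)) m \<theta> z) = act E m \<theta> (f m z)"
      proof (cases "set \<alpha> \<noteq> {..n}")
        case True
        have "u l (ord_comp \<alpha> \<theta>) = act ?P m \<theta> (u m \<alpha>)"
          using smor_nat[OF u t, of \<alpha>] z(3) True by simp
        then have "f l (ord_comp \<chi> \<theta>, ord_comp \<alpha> \<theta>) = act ?P m \<theta> (u m \<alpha>) l (ord_comp \<chi> \<theta>, ord_id l)"
          using boundary_closed[OF z(3) t True] by (simp add: f_def)
        also have "\<dots> = u m \<alpha> l (ord_comp \<chi> \<theta>, ord_comp (ord_id m) \<theta>)"
          using act[OF t ord_comp_in[OF z(2) t] ord_id_in] ord_comp_id_right[OF t] ord_comp_id_left[OF t] by simp
        also have "\<dots> = act E m \<theta> (u m \<alpha> m (\<chi>, ord_id m))"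
          using smor_nat[OF um[OF z(3) True] t, of "(\<chi>, ord_id m)"] z(2) ord_id_in by simp
        finally show ?thesis using True by (simp only: ac z(1)) (simp add: f_def)
      next
        case False
        then have chi: "\<chi> = ord_const m \<epsilon>" using stage[of m \<chi> \<alpha>] z z' by auto
        have "f l (ord_comp \<chi> \<theta>, ord_comp \<alpha> \<theta>) = a l (act K n (ord_comp \<alpha> \<theta>) y)"
          unfolding chi ord_comp_const_left[OF t] by (rule f_new[OF ord_comp_in[OF z(3) t]])
        also have "\<dots> = act E m \<theta> (a m (act K n \<alpha> y))"
          using smor_nat[OF a t sset_act[OF K z(3) y]] sset_comp[OF K z(3) t y] by simp
        finally show ?thesis unfolding ac using f_new[OF z(3)] z(1) chi by simp
      qed
    qed
    have pf: "p m (f m z) = g m z" if z': "z \<in> simp (prism n) m" "prism_stage n \<epsilon> 0 m z" for m z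
    proof -
      obtain \<chi> \<alpha> where z: "z = (\<chi>, \<alpha>)" "\<chi> \<in> ord_hom m 1" "\<alpha> \<in> ord_hom m n" using z' by auto
      show ?thesis
      proof (cases "set \<alpha> \<noteq> {..n}")
        case True
        have "p m (u m \<alpha> m (\<chi>, ord_id m)) = \<beta> m (act K m (ord_id m) (act K n \<alpha> y), \<chi>)"
          using uT[of \<alpha> m] True z(3) by (intro T1[OF _ z(2) ord_id_in]) simp
        then show ?thesis using True z sset_id[OF K sset_act[OF K z(3) y]] by (simp add: f_def g_def)
      next
        case False
        then have chi: "\<chi> = ord_const m \<epsilon>" using stage[of m \<chi> \<alpha>] z z' by auto
        show ?thesis using f_new[OF z(3)] pa[OF sset_act[OF K z(3) y]] z(1) chi by (simp add: g_def)
      qed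
    qed
    obtain f' where f': "smor (prism n) E f'" "\<And>m z. z \<in> simp (prism n) m \<Longrightarrow> p m (f' m z) = g m z"
      "\<And>m z. z \<in> simp (prism n) m \<Longrightarrow> prism_stage n \<epsilon> 0 m z \<Longrightarrow> f' m z = f m z"
      using prism_extension[OF E p g \<epsilon> f pf] by metis
    let ?h = "sres (prism n) f'"
    have h: "?h \<in> smaps (prism n) E" by (rule smor_sres[OF is_sset_prism f'(1)])
    have hf: "?h m (\<chi>, \<alpha>) = f' m (\<chi>, \<alpha>)" if "\<chi> \<in> ord_hom m 1" "\<alpha> \<in> ord_hom m n" for m \<chi> \<alpha>
      by (rule sres_eq) (use that in simp)
    show "\<exists>e\<in>simp ?P n. T n y e \<and> (\<forall>m. \<forall>\<alpha>\<in>simp (boundary n) m. act ?P n \<alpha> e = u m \<alpha>)"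
    proof (intro bexI conjI allI ballI)
      show "T n y ?h"
      proof (rule TI)
        fix m \<chi> \<alpha> assume c: "\<chi> \<in> ord_hom m 1" "\<alpha> \<in> ord_hom m n"
        then show "p m (?h m (\<chi>, \<alpha>)) = \<beta> m (act K n \<alpha> y, \<chi>)"
          unfolding hf[OF c] using f'(2)[of "(\<chi>, \<alpha>)" m] by (simp add: g_def)
      next
        fix m \<alpha> assume al: "\<alpha> \<in> ord_hom m n"
        have "prism_stage n \<epsilon> 0 m (ord_const m \<epsilon>, \<alpha>)" by (auto simp: prism_stage_def)
        then show "?h m (ord_const m \<epsilon>, \<alpha>) = a m (act K n \<alpha> y)"
          unfolding hf[OF ce al] using f'(3)[of "(ord_const m \<epsilon>, \<alpha>)" m] f_new[OF al] ce al by simp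
      qed
      show "?h \<in> simp ?P n" using h by simp
      fix m \<alpha> assume "\<alpha> \<in> simp (boundary n) m"
      then have al: "\<alpha> \<in> ord_hom m n" "set \<alpha> \<noteq> {..n}" by auto
      show "act ?P n \<alpha> ?h = u m \<alpha>"
      proof (rule smaps_eqI)
        show "act ?P n \<alpha> ?h \<in> smaps (prism m) E" by (rule shom_act_in[OF is_sset_simplex al(1) h])
        show "u m \<alpha> \<in> smaps (prism m) E" using smor_in[OF u, of \<alpha> m] al by simp
        fix k z assume "z \<in> simp (prism m) k"
        then obtain \<chi> \<kappa> where z: "z = (\<chi>, \<kappa>)" "\<chi> \<in> ord_hom k 1" "\<kappa> \<in> ord_hom k m" by auto
        have ak: "ord_comp \<alpha> \<kappa> \<in> ord_hom k n" by (rule ord_comp_in[OF al(1) z(3)])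
        have b: "set (ord_comp \<alpha> \<kappa>) \<noteq> {..n}" by (rule boundary_closed[OF al(1) z(3) al(2)])
        have "act ?P n \<alpha> ?h k z = ?h k (\<chi>, ord_comp \<alpha> \<kappa>)" unfolding z(1) by (rule act[OF al(1) z(2,3)])
        also have "\<dots> = f k (\<chi>, ord_comp \<alpha> \<kappa>)"
          unfolding hf[OF z(2) ak] using f'(3)[of "(\<chi>, ord_comp \<alpha> \<kappa>)" k] z(2) ak b by (simp add: prism_stage_def)
        also have "\<dots> = u k (ord_comp \<alpha> \<kappa>) k (\<chi>, ord_id k)" using b by (simp add: f_def)
        also have "\<dots> = act ?P m \<kappa> (u m \<alpha>) k (\<chi>, ord_id k)"
          using smor_nat[OF u z(3), of \<alpha>] al by simp
        also have "\<dots> = u m \<alpha> k z"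
          using act[OF z(3,2) ord_id_in, of "u m \<alpha>"] ord_comp_id_right[OF z(3)] z(1) by simp
        finally show "act ?P n \<alpha> ?h k z = u m \<alpha> k z" .
      qed
    qed
  qed
  define f where "f n y = sres (prism n) (\<lambda>m z. H0 m (act K n (snd z) y, fst z))" for n y
  have fH: "f n y m (\<chi>, \<alpha>) = H0 m (act K n \<alpha> y, \<chi>)" if "\<chi> \<in> ord_hom m 1" "\<alpha> \<in> ord_hom m n" for n y m \<chi> \<alpha>
    unfolding f_def by (subst sres_eq) (use that in auto)
  have LK: "L m (act K n \<alpha> y)" "act K n \<alpha> y \<in> simp K m" if "\<alpha> \<in> ord_hom m n" "y \<in> simp K n" "L n y" for n m \<alpha> y
    using closed_inD[OF L that] sset_act[OF K that(1,2)] by auto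
  have f_in: "f n y \<in> smaps (prism n) E" if y: "y \<in> simp K n" "L n y" for n y
    unfolding f_def
  proof (rule smor_sres[OF is_sset_prism], rule smorI)
    fix m z assume "z \<in> simp (prism n) m"
    then show "H0 m (act K n (snd z) y, fst z) \<in> simp E m"
      using smor_in[OF H0, of "(act K n (snd z) y, fst z)" m] LK[OF _ y] by auto
  next
    fix l m \<theta> z assume t: "\<theta> \<in> ord_hom l m" and "z \<in> simp (prism n) m"
    then obtain \<chi> \<alpha> where z: "z = (\<chi>, \<alpha>)" "\<chi> \<in> ord_hom m 1" "\<alpha> \<in> ord_hom m n" by auto
    show "H0 l (act K n (snd (act (prism n) m \<theta> z)) y, fst (act (prism n) m \<theta> z)) =
      act E m \<theta> (H0 m (act K n (snd z) y, fst z))"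
      using smor_nat[OF H0 t, of "(act K n \<alpha> y, \<chi>)"] LK[OF z(3) y] z sset_comp[OF K z(3) t y(1)] by simp
  qed
  have f: "partial_sol K ?P T L f"
    unfolding partial_sol_def
  proof (intro conjI allI ballI impI)
    show "smor (subs K L) ?P f"
    proof (rule smorI)
      fix n y assume "y \<in> simp (subs K L) n" then show "f n y \<in> simp ?P n" using f_in by simp
    next
      fix m n \<alpha> y assume al: "\<alpha> \<in> ord_hom m n" and "y \<in> simp (subs K L) n"
      then have y: "y \<in> simp K n" "L n y" by auto
      have "f m (act K n \<alpha> y) = act ?P n \<alpha> (f n y)"
      proof (rule smaps_eqI)
        show "f m (act K n \<alpha> y) \<in> smaps (prism m) E" using f_in LK[OF al y] by simp
        show "act ?P n \<alpha> (f n y) \<in> smaps (prism m) E" by (rule shom_act_in[OF is_sset_simplex al f_in[OF y]])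
        fix k z assume "z \<in> simp (prism m) k"
        then obtain \<chi> \<kappa> where z: "z = (\<chi>, \<kappa>)" "\<chi> \<in> ord_hom k 1" "\<kappa> \<in> ord_hom k m" by auto
        show "f m (act K n \<alpha> y) k z = act ?P n \<alpha> (f n y) k z"
          unfolding z(1) act[OF al z(2,3)] fH[OF z(2,3)] fH[OF z(2) ord_comp_in[OF al z(3)]]
          by (simp add: sset_comp[OF K al z(3) y(1)])
      qed
      then show "f m (act (subs K L) n \<alpha> y) = act ?P n \<alpha> (f n y)" by simp
    qed
    fix n y assume y: "y \<in> simp K n" "L n y"
    show "T n y (f n y)"
    proof (rule TI)
      fix m \<chi> \<alpha> assume c: "\<chi> \<in> ord_hom m 1" "\<alpha> \<in> ord_hom m n"
      show "p m (f n y m (\<chi>, \<alpha>)) = \<beta> m (act K n \<alpha> y, \<chi>)"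
        unfolding fH[OF c] using pH0[OF LK(2,1)[OF c(2) y] c(1)] .
    next
      fix m \<alpha> assume al: "\<alpha> \<in> ord_hom m n"
      show "f n y m (ord_const m \<epsilon>, \<alpha>) = a m (act K n \<alpha> y)"
        unfolding fH[OF ce al] using aH0[OF LK(2,1)[OF al y]] .
    qed
  qed
  obtain G where G: "smor K ?P G" "\<And>n y. y \<in> simp K n \<Longrightarrow> T n y (G n y)"
    "\<And>n y. y \<in> simp K n \<Longrightarrow> L n y \<Longrightarrow> G n y = f n y"
    using skeletal_extension[OF K P L T ext f] by metis
  have Gm: "smor (prism n) E (G n y)" if "y \<in> simp K n" for n y
    using smor_in[OF G(1) that] smaps_smor by simp
  define H where "H n z = G n (fst z) n (snd z, ord_id n)" for n z
  show ?thesis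
  proof (intro exI conjI allI ballI impI)
    show "smor (sprod K (simplex 1)) E H"
    proof (rule smorI)
      fix n z assume "z \<in> simp (sprod K (simplex 1)) n"
      then show "H n z \<in> simp E n"
        using smor_in[OF Gm, of "fst z" n "(snd z, ord_id n)" n] ord_id_in by (auto simp: H_def)
    next
      fix m n \<theta> z assume t: "\<theta> \<in> ord_hom m n" and "z \<in> simp (sprod K (simplex 1)) n"
      then obtain y \<tau> where z: "z = (y, \<tau>)" "y \<in> simp K n" "\<tau> \<in> ord_hom n 1" by auto
      have "H m (act K n \<theta> y, ord_comp \<tau> \<theta>) = act ?P n \<theta> (G n y) m (ord_comp \<tau> \<theta>, ord_id m)"
        using smor_nat[OF G(1) t z(2)] by (simp add: H_def)
      also have "\<dots> = G n y m (ord_comp \<tau> \<theta>, \<theta>)"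
        using act[OF t ord_comp_in[OF z(3) t] ord_id_in] ord_comp_id_right[OF t] by simp
      also have "\<dots> = act E n \<theta> (G n y n (\<tau>, ord_id n))"
        using smor_nat[OF Gm[OF z(2)] t, of "(\<tau>, ord_id n)"] z(3) ord_id_in ord_comp_id_left[OF t] by simp
      finally show "H m (act (sprod K (simplex 1)) n \<theta> z) = act E n \<theta> (H n z)"
        using z(1) by (simp add: H_def)
    qed
    fix n x assume x: "x \<in> simp K n"
    show "H n (x, ord_const n \<epsilon>) = a n x"
      using T2[OF G(2)[OF x] ord_id_in] sset_id[OF K x] by (simp add: H_def)
    fix \<tau> :: "nat list" assume t: "\<tau> \<in> ord_hom n 1"
    show "p n (H n (x, \<tau>)) = \<beta> n (x, \<tau>)"
      using T1[OF G(2)[OF x] t ord_id_in] sset_id[OF K x] by (simp add: H_def)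
    show "H n (x, \<tau>) = H0 n (x, \<tau>)" if "L n x"
      using G(3)[OF x that] fH[OF t ord_id_in] sset_id[OF K x] by (simp add: H_def)
  qed
qed

section \<open>Fibrewise homotopies\<close>

text \<open>A homotopy from \<open>f\<close> to \<open>g\<close> that is constant after applying \<open>p\<close>. The end at which it starts is a
  parameter, so that no reversal of homotopies is needed; the values of \<open>p\<close> are compared only for equality, so
  \<open>p\<close> can be any invariant of the simplices.\<close>

definition fib_homotopy :: "'a sset \<Rightarrow> 'b sset \<Rightarrow> (nat \<Rightarrow> 'b \<Rightarrow> 'c) \<Rightarrow> (nat \<Rightarrow> 'a \<Rightarrow> 'b) \<Rightarrow> (nat \<Rightarrow> 'a \<Rightarrow> 'b) \<Rightarrow>
    nat \<Rightarrow> (nat \<Rightarrow> 'a \<times> nat list \<Rightarrow> 'b) \<Rightarrow> bool" where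
  "fib_homotopy A B p f g \<epsilon> H \<longleftrightarrow> (\<epsilon> = 0 \<or> \<epsilon> = 1) \<and> smor (sprod A (simplex 1)) B H \<and>
     (\<forall>n. \<forall>x\<in>simp A n. H n (x, ord_const n \<epsilon>) = f n x \<and> H n (x, ord_const n (1 - \<epsilon>)) = g n x \<and>
        (\<forall>\<tau>\<in>ord_hom n 1. p n (H n (x, \<tau>)) = p n (f n x)))"

definition hlink :: "'a sset \<Rightarrow> 'b sset \<Rightarrow> (nat \<Rightarrow> 'b \<Rightarrow> 'c) \<Rightarrow> (nat \<Rightarrow> 'a \<Rightarrow> 'b) \<Rightarrow> (nat \<Rightarrow> 'a \<Rightarrow> 'b) \<Rightarrow> bool" where
  "hlink A B p f g \<longleftrightarrow> smor A B f \<and> smor A B g \<and> (\<exists>\<epsilon> H. fib_homotopy A B p f g \<epsilon> H)"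

text \<open>Homotopies cannot be composed directly, so the relation is the one generated by them; this also matches
  the definition of path components.\<close>

definition homotopic_over :: "'a sset \<Rightarrow> 'b sset \<Rightarrow> (nat \<Rightarrow> 'b \<Rightarrow> 'c) \<Rightarrow> (nat \<Rightarrow> 'a \<Rightarrow> 'b) \<Rightarrow> (nat \<Rightarrow> 'a \<Rightarrow> 'b) \<Rightarrow> bool" where
  "homotopic_over A B p f g \<longleftrightarrow> smor A B f \<and> (hlink A B p)\<^sup>*\<^sup>* f g"

lemma hlinkI:
  assumes "smor A B f" "smor A B g" "\<epsilon> = 0 \<or> \<epsilon> = 1" "smor (sprod A (simplex 1)) B H"
    "\<And>n x. x \<in> simp A n \<Longrightarrow> H n (x, ord_const n \<epsilon>) = f n x"
    "\<And>n x. x \<in> simp A n \<Longrightarrow> H n (x, ord_const n (1 - \<epsilon>)) = g n x"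
    "\<And>n x \<tau>. x \<in> simp A n \<Longrightarrow> \<tau> \<in> ord_hom n 1 \<Longrightarrow> p n (H n (x, \<tau>)) = p n (f n x)"
  shows "hlink A B p f g"
proof -
  have "fib_homotopy A B p f g \<epsilon> H"
    unfolding fib_homotopy_def using assms(3-7) by simp
  then show ?thesis unfolding hlink_def using assms(1,2) by blast
qed

lemma fib_homotopyD:
  assumes "fib_homotopy A B p f g \<epsilon> H"
  shows "\<epsilon> = 0 \<or> \<epsilon> = 1" "smor (sprod A (simplex 1)) B H"
    "\<And>n x. x \<in> simp A n \<Longrightarrow> H n (x, ord_const n \<epsilon>) = f n x"
    "\<And>n x. x \<in> simp A n \<Longrightarrow> H n (x, ord_const n (1 - \<epsilon>)) = g n x"
    "\<And>n x \<tau>. x \<in> simp A n \<Longrightarrow> \<tau> \<in> ord_hom n 1 \<Longrightarrow> p n (H n (x, \<tau>)) = p n (f n x)"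
  using assms unfolding fib_homotopy_def by blast+

lemma fib_homotopy_const:
  assumes f: "smor A B f" and e: "\<epsilon> = 0 \<or> \<epsilon> = 1"
  shows "fib_homotopy A B p f f \<epsilon> (\<lambda>n z. f n (fst z))"
proof -
  have "smor (sprod A (simplex 1)) B (\<lambda>n z. f n (fst z))"
    by (rule smorI) (use smor_in[OF f] smor_nat[OF f] in auto)
  then show ?thesis unfolding fib_homotopy_def using e by simp
qed

lemma hlinkE:
  assumes "hlink A B p f g"
  obtains \<epsilon> H where "fib_homotopy A B p f g \<epsilon> H"
  using assms unfolding hlink_def by blast

lemma hlink_smor: "hlink A B p f g \<Longrightarrow> smor A B f" "hlink A B p f g \<Longrightarrow> smor A B g"
  by (simp_all add: hlink_def)

lemma const01: "\<epsilon> = 0 \<or> \<epsilon> = 1 \<Longrightarrow> ord_const n \<epsilon> \<in> ord_hom n 1" "\<epsilon> = 0 \<or> \<epsilon> = 1 \<Longrightarrow> ord_const n (1 - \<epsilon>) \<in> ord_hom n 1"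
  by (auto intro!: ord_const_in)

lemma hlink_over: "hlink A B p f g \<Longrightarrow> x \<in> simp A n \<Longrightarrow> p n (f n x) = p n (g n x)"
proof -
  assume h: "hlink A B p f g" and x: "x \<in> simp A n"
  obtain \<epsilon> H where "fib_homotopy A B p f g \<epsilon> H" by (rule hlinkE[OF h])
  note H = fib_homotopyD[OF this]
  from H(4)[OF x] H(5)[OF x const01(2)[OF H(1)]] show ?thesis by simp
qed

lemma hlink_sym: "hlink A B p f g \<Longrightarrow> hlink A B p g f"
proof -
  assume h: "hlink A B p f g"
  obtain \<epsilon> H where "fib_homotopy A B p f g \<epsilon> H" by (rule hlinkE[OF h])
  note H = fib_homotopyD[OF this]
  have e: "1 - (1 - \<epsilon>) = \<epsilon>" using H(1) by auto
  show ?thesis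
    by (rule hlinkI[OF hlink_smor(2)[OF h] hlink_smor(1)[OF h], of "1 - \<epsilon>" H])
      (use H e hlink_over[OF h] in auto)
qed

lemma hlink_eq:
  assumes "is_sset A" "smor A B f" "\<And>n x. x \<in> simp A n \<Longrightarrow> f n x = g n x"
  shows "hlink A B p f g"
proof -
  have e: "(0::nat) = 0 \<or> (0::nat) = 1" by simp
  note H = fib_homotopyD[OF fib_homotopy_const[where p=p, OF assms(2) e]]
  show ?thesis by (rule hlinkI[OF assms(2) smor_cong[OF assms] H(1,2)]) (simp_all add: assms(3))
qed

lemma hlink_post:
  assumes h: "hlink A B p f g" and k: "smor B C k"
    and q: "\<And>n b b'. b \<in> simp B n \<Longrightarrow> b' \<in> simp B n \<Longrightarrow> p n b = p n b' \<Longrightarrow> q n (k n b) = q n (k n b')"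
  shows "hlink A C q (\<lambda>n x. k n (f n x)) (\<lambda>n x. k n (g n x))"
proof -
  obtain \<epsilon> H where "fib_homotopy A B p f g \<epsilon> H" by (rule hlinkE[OF h])
  note H = fib_homotopyD[OF this]
  show ?thesis
  proof (rule hlinkI[OF smor_comp[OF hlink_smor(1)[OF h] k] smor_comp[OF hlink_smor(2)[OF h] k] H(1) smor_comp[OF H(2) k]])
    fix n x \<tau> assume "x \<in> simp A n" "\<tau> \<in> ord_hom n 1"
    then show "q n (k n (H n (x, \<tau>))) = q n (k n (f n x))"
      using H(5) smor_in[OF H(2), of "(x, \<tau>)" n] smor_in[OF hlink_smor(1)[OF h]] by (intro q) auto
  qed (use H in auto)
qed

lemma hlink_pre:
  assumes h: "hlink A B p f g" and u: "smor D A u"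
  shows "hlink D B p (\<lambda>n x. f n (u n x)) (\<lambda>n x. g n (u n x))"
proof -
  obtain \<epsilon> H where "fib_homotopy A B p f g \<epsilon> H" by (rule hlinkE[OF h])
  note H = fib_homotopyD[OF this]
  show ?thesis
  proof (rule hlinkI[OF smor_comp[OF u hlink_smor(1)[OF h]] smor_comp[OF u hlink_smor(2)[OF h]] H(1)])
    have "smor (sprod D (simplex 1)) (sprod A (simplex 1)) (\<lambda>n z. (u n (fst z), snd z))"
      by (rule smorI) (use smor_in[OF u] smor_nat[OF u] in auto)
    from smor_comp[OF this H(2)] show "smor (sprod D (simplex 1)) B (\<lambda>n z. H n (u n (fst z), snd z))" .
  qed (use H smor_in[OF u] in auto)
qed

lemma homotopic_over_smor: "homotopic_over A B p f g \<Longrightarrow> smor A B f" "homotopic_over A B p f g \<Longrightarrow> smor A B g"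
proof -
  assume h: "homotopic_over A B p f g"
  then show "smor A B f" by (simp add: homotopic_over_def)
  have "(hlink A B p)\<^sup>*\<^sup>* f g" using h by (simp add: homotopic_over_def)
  then show "smor A B g" using \<open>smor A B f\<close> by (cases rule: rtranclp.cases) (auto dest: hlink_smor)
qed

lemma homotopic_over_link: "hlink A B p f g \<Longrightarrow> homotopic_over A B p f g"
  by (auto simp: homotopic_over_def hlink_smor)

lemma homotopic_over_trans: "homotopic_over A B p f g \<Longrightarrow> homotopic_over A B p g h \<Longrightarrow> homotopic_over A B p f h"
  by (auto simp: homotopic_over_def)

lemma homotopic_over_induct [consumes 1, case_names refl link]:
  assumes "homotopic_over A B p f g" "P f"
    "\<And>g h. homotopic_over A B p f g \<Longrightarrow> hlink A B p g h \<Longrightarrow> P g \<Longrightarrow> P h"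
  shows "P g"
proof -
  have "smor A B f" "(hlink A B p)\<^sup>*\<^sup>* f g" using assms(1) by (auto simp: homotopic_over_def)
  from this(2,1) show ?thesis
  proof (induction rule: rtranclp_induct)
    case base show ?case by (rule assms(2))
  next
    case (step g h)
    have "homotopic_over A B p f g" using step by (simp add: homotopic_over_def)
    then show ?case using assms(3)[OF _ step.hyps(2)] step by blast
  qed
qed

lemma homotopic_over_sym:
  assumes h: "homotopic_over A B p f g"
  shows "homotopic_over A B p g f"
  using h
proof (induction rule: homotopic_over_induct)
  case refl show ?case using homotopic_over_smor(1)[OF h] by (simp add: homotopic_over_def)
next
  case (link g h)
  show ?case by (rule homotopic_over_trans[OF homotopic_over_link[OF hlink_sym[OF link.hyps(2)]] link.IH])
qed

lemma homotopic_over_eq: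
  assumes "is_sset A" "smor A B f" "\<And>n x. x \<in> simp A n \<Longrightarrow> f n x = g n x"
  shows "homotopic_over A B p f g"
  using homotopic_over_link[OF hlink_eq[OF assms]] .

lemma homotopic_over_cong:
  assumes "is_sset A" "homotopic_over A B p f g" "\<And>n x. x \<in> simp A n \<Longrightarrow> f n x = f' n x"
     "\<And>n x. x \<in> simp A n \<Longrightarrow> g n x = g' n x"
  shows "homotopic_over A B p f' g'"
  using homotopic_over_trans[OF homotopic_over_sym[OF homotopic_over_eq[OF assms(1) homotopic_over_smor(1)[OF assms(2)] assms(3)]]
      homotopic_over_trans[OF assms(2) homotopic_over_eq[OF assms(1) homotopic_over_smor(2)[OF assms(2)] assms(4)]]] .

lemma homotopic_over_same: "homotopic_over A B p f g \<Longrightarrow> x \<in> simp A n \<Longrightarrow> p n (f n x) = p n (g n x)"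
proof (induction rule: homotopic_over_induct)
  case (link g h) then show ?case using hlink_over[OF link.hyps(2) link.prems] by simp
qed simp

lemma homotopic_over_post:
  assumes h: "homotopic_over A B p f g" and k: "smor B C k"
    and q: "\<And>n b b'. b \<in> simp B n \<Longrightarrow> b' \<in> simp B n \<Longrightarrow> p n b = p n b' \<Longrightarrow> q n (k n b) = q n (k n b')"
  shows "homotopic_over A C q (\<lambda>n x. k n (f n x)) (\<lambda>n x. k n (g n x))"
  using h
proof (induction rule: homotopic_over_induct)
  case refl
  then show ?case using smor_comp[OF homotopic_over_smor(1)[OF h] k] by (simp add: homotopic_over_def)
next
  case (link g h')
  have "hlink A C q (\<lambda>n x. k n (g n x)) (\<lambda>n x. k n (h' n x))"
    by (rule hlink_post[OF link.hyps(2) k, of q]) (rule q)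
  then show ?case using homotopic_over_trans[OF link.IH homotopic_over_link] by blast
qed

lemma homotopic_over_pre:
  assumes h: "homotopic_over A B p f g" and u: "smor D A u"
  shows "homotopic_over D B p (\<lambda>n x. f n (u n x)) (\<lambda>n x. g n (u n x))"
  using h
proof (induction rule: homotopic_over_induct)
  case refl
  then show ?case using smor_comp[OF u homotopic_over_smor(1)[OF h]] by (simp add: homotopic_over_def)
next
  case (link g h')
  show ?case using homotopic_over_trans[OF link.IH homotopic_over_link[OF hlink_pre[OF link.hyps(2) u]]] .
qed

abbreviation no_base :: "nat \<Rightarrow> 'b \<Rightarrow> unit" where "no_base \<equiv> \<lambda>_ _. ()"

lemma path_lifting:
  assumes K: "is_sset K" and E: "is_sset E" and p: "kanfib E B p"
    and \<beta>: "smor (sprod K (simplex 1)) B \<beta>" and a: "smor K E a" and \<epsilon>: "\<epsilon> = 0 \<or> \<epsilon> = 1"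
    and pa: "\<And>n x. x \<in> simp K n \<Longrightarrow> p n (a n x) = \<beta> n (x, ord_const n \<epsilon>)"
  shows "\<exists>H. smor (sprod K (simplex 1)) E H \<and> (\<forall>n. \<forall>x\<in>simp K n. H n (x, ord_const n \<epsilon>) = a n x \<and>
    (\<forall>\<tau>\<in>ord_hom n 1. p n (H n (x, \<tau>)) = \<beta> n (x, \<tau>)))"
proof -
  have L: "closed_in K (\<lambda>_ _. False)" "smor (subs (sprod K (simplex 1)) (\<lambda>n z. False)) E undefined"
    by (simp_all add: closed_in_def smor_def)
  show ?thesis using homotopy_lifting[OF K E p \<beta> a \<epsilon> pa L] by simp
qed

text \<open>The homotopies that link \<open>p \<circ> r\<close> to \<open>h\<close> are lifted one after the other, starting from \<open>r\<close>.\<close>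

theorem section_of_homotopy_section:
  assumes K: "is_sset K" and E: "is_sset E" and p: "kanfib E B p" and r: "smor K E r"
    and h: "homotopic_over K B q (\<lambda>n x. p n (r n x)) h"
  shows "\<exists>s. smor K E s \<and> (\<forall>n. \<forall>x\<in>simp K n. p n (s n x) = h n x)"
  using h
proof (induction rule: homotopic_over_induct)
  case refl then show ?case using r by blast
next
  case (link g h)
  obtain s where s: "smor K E s" "\<And>n x. x \<in> simp K n \<Longrightarrow> p n (s n x) = g n x" using link.IH by blast
  obtain \<epsilon> H where "fib_homotopy K B q g h \<epsilon> H" by (rule hlinkE[OF link.hyps(2)])
  note H = fib_homotopyD[OF this]
  obtain G where G: "smor (sprod K (simplex 1)) E G"
    "\<And>n x \<tau>. x \<in> simp K n \<Longrightarrow> \<tau> \<in> ord_hom n 1 \<Longrightarrow> p n (G n (x, \<tau>)) = H n (x, \<tau>)"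
    "\<And>n x. x \<in> simp K n \<Longrightarrow> G n (x, ord_const n \<epsilon>) = s n x"
    using path_lifting[OF K E p H(2) s(1) H(1)] s(2) H(3) by auto
  have "smor K E (\<lambda>n x. G n (x, ord_const n (1 - \<epsilon>)))"
  proof (rule smorI)
    fix n x assume "x \<in> simp K n"
    then show "G n (x, ord_const n (1 - \<epsilon>)) \<in> simp E n"
      using smor_in[OF G(1), of "(x, ord_const n (1 - \<epsilon>))" n] const01(2)[OF H(1)] by simp
  next
    fix m n \<alpha> x assume t: "\<alpha> \<in> ord_hom m n" and "x \<in> simp K n"
    then show "G m (act K n \<alpha> x, ord_const m (1 - \<epsilon>)) = act E n \<alpha> (G n (x, ord_const n (1 - \<epsilon>)))"
      using smor_nat[OF G(1) t, of "(x, ord_const n (1 - \<epsilon>))"] const01(2)[OF H(1), of n] ord_comp_const_left[OF t] by simp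
  qed
  moreover have "\<forall>n. \<forall>x\<in>simp K n. p n (G n (x, ord_const n (1 - \<epsilon>))) = h n x"
    using G(2) H(4) const01(2)[OF H(1)] by simp
  ultimately show ?case by (intro exI[of _ "\<lambda>n x. G n (x, ord_const n (1 - \<epsilon>))"] conjI)
qed

abbreviation end_at :: "nat \<Rightarrow> (nat \<Rightarrow> 'a \<times> nat list \<Rightarrow> 'b) \<Rightarrow> nat \<Rightarrow> 'a \<Rightarrow> 'b" where
  "end_at \<epsilon> H \<equiv> \<lambda>n x. H n (x, ord_const n \<epsilon>)"

lemma end_at_smor:
  assumes "smor (sprod K (simplex 1)) E H" "\<epsilon> = 0 \<or> \<epsilon> = 1"
  shows "smor K E (end_at \<epsilon> H)"
proof (rule smorI)
  fix n x assume "x \<in> simp K n"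
  then show "H n (x, ord_const n \<epsilon>) \<in> simp E n"
    using smor_in[OF assms(1), of "(x, ord_const n \<epsilon>)" n] const01(1)[OF assms(2)] by simp
next
  fix m n \<alpha> x assume t: "\<alpha> \<in> ord_hom m n" and "x \<in> simp K n"
  then show "H m (act K n \<alpha> x, ord_const m \<epsilon>) = act E n \<alpha> (H n (x, ord_const n \<epsilon>))"
    using smor_nat[OF assms(1) t, of "(x, ord_const n \<epsilon>)"] const01(1)[OF assms(2), of n] ord_comp_const_left[OF t] by simp
qed

text \<open>If two lifts of one homotopy have starting points linked by a fibrewise homotopy \<open>F\<close>, so are their end points:
  the lifts form the two sides, and \<open>F\<close> the given end, of a homotopy on \<open>K \<times> \<Delta>\<^sup>1\<close> that lifts relative to
  \<open>K \<times> \<partial>\<Delta>\<^sup>1\<close>.\<close>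

lemma transport_link:
  assumes K: "is_sset K" and E: "is_sset E" and p: "kanfib E B p" and \<epsilon>: "\<epsilon> = 0 \<or> \<epsilon> = 1"
    and A: "smor (sprod K (simplex 1)) E A" and C: "smor (sprod K (simplex 1)) E C"
    and pAC: "\<And>n x \<tau>. x \<in> simp K n \<Longrightarrow> \<tau> \<in> ord_hom n 1 \<Longrightarrow> p n (A n (x, \<tau>)) = p n (C n (x, \<tau>))"
    and h: "hlink K E p (end_at \<epsilon> A) (end_at \<epsilon> C)"
  shows "hlink K E p (end_at (1 - \<epsilon>) A) (end_at (1 - \<epsilon>) C)"
proof -
  let ?K = "sprod K (simplex 1)"
  have K2: "is_sset ?K" by (intro is_sset_sprod K is_sset_simplex)
  obtain \<delta> F where "fib_homotopy K E p (end_at \<epsilon> A) (end_at \<epsilon> C) \<delta> F" by (rule hlinkE[OF h])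
  note F = fib_homotopyD[OF this]
  have e': "1 - \<epsilon> = 0 \<or> 1 - \<epsilon> = 1" by auto
  have neq: "ord_const n (1 - \<delta>) \<noteq> ord_const n \<delta>" for n using F(1) by auto
  define \<beta> where "\<beta> n z = p n (A n (fst (fst z), snd z))" for n and z :: "('a \<times> nat list) \<times> nat list"
  define L where "L n z \<longleftrightarrow> snd z = ord_const n \<delta> \<or> snd z = ord_const n (1 - \<delta>)" for n and z :: "'a \<times> nat list"
  define H0 where "H0 n z = (if snd (fst z) = ord_const n \<delta> then A n (fst (fst z), snd z) else C n (fst (fst z), snd z))"
    for n and z :: "('a \<times> nat list) \<times> nat list"
  have \<beta>: "smor (sprod ?K (simplex 1)) B \<beta>"
  proof -
    have "smor (sprod ?K (simplex 1)) ?K (\<lambda>n z. (fst (fst z), snd z))" by (rule smorI) auto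
    from smor_comp[OF smor_comp[OF this A] kanfib_smor[OF p]] show ?thesis unfolding \<beta>_def[abs_def] .
  qed
  have pF: "p n (F n z) = \<beta> n (z, ord_const n \<epsilon>)" if "z \<in> simp ?K n" for n z
    using F(5)[of "fst z" n "snd z"] that by (auto simp: \<beta>_def)
  have L: "closed_in ?K L"
    unfolding closed_in_def L_def by (auto simp: ord_comp_const_left)
  have H0: "smor (subs (sprod ?K (simplex 1)) (\<lambda>n z. L n (fst z))) E H0"
  proof (rule smorI)
    fix n z assume "z \<in> simp (subs (sprod ?K (simplex 1)) (\<lambda>n z. L n (fst z))) n"
    then show "H0 n z \<in> simp E n" using smor_in[OF A] smor_in[OF C] by (auto simp: H0_def)
  next
    fix m n \<theta> z assume t: "\<theta> \<in> ord_hom m n" and "z \<in> simp (subs (sprod ?K (simplex 1)) (\<lambda>n z. L n (fst z))) n"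
    then obtain x \<tau> \<rho> where z: "z = ((x, \<tau>), \<rho>)" "x \<in> simp K n" "\<tau> \<in> ord_hom n 1" "\<rho> \<in> ord_hom n 1"
      "\<tau> = ord_const n \<delta> \<or> \<tau> = ord_const n (1 - \<delta>)" by (auto simp: L_def)
    have "H0 m ((act K n \<theta> x, ord_comp \<tau> \<theta>), ord_comp \<rho> \<theta>) = act E n \<theta> (H0 n ((x, \<tau>), \<rho>))"
      using z(5)
    proof
      assume "\<tau> = ord_const n \<delta>"
      then show ?thesis
        using ord_comp_const_left[OF t] smor_nat[OF A t, of "(x, \<rho>)"] z by (simp add: H0_def)
    next
      assume "\<tau> = ord_const n (1 - \<delta>)"
      then show ?thesis
        using ord_comp_const_left[OF t] smor_nat[OF C t, of "(x, \<rho>)"] z neq by (simp add: H0_def)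
    qed
    then show "H0 m (act (subs (sprod ?K (simplex 1)) (\<lambda>n z. L n (fst z))) n \<theta> z) = act E n \<theta> (H0 n z)"
      using z(1) by simp
  qed
  have pH0: "p n (H0 n (z, \<tau>)) = \<beta> n (z, \<tau>)" if "z \<in> simp ?K n" "L n z" "\<tau> \<in> ord_hom n 1" for n z \<tau>
    using that pAC by (auto simp: H0_def \<beta>_def)
  have FH0: "H0 n (z, ord_const n \<epsilon>) = F n z" if "z \<in> simp ?K n" "L n z" for n z
  proof (cases "snd z = ord_const n \<delta>")
    case True then show ?thesis using F(3)[of "fst z" n] that(1) by (auto simp: H0_def)
  next
    case False
    then have "snd z = ord_const n (1 - \<delta>)" using that(2) by (simp add: L_def)
    then show ?thesis using F(4)[of "fst z" n] that(1) False by (auto simp: H0_def)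
  qed
  have "\<exists>H. smor (sprod ?K (simplex 1)) E H \<and> (\<forall>n. \<forall>z\<in>simp ?K n. H n (z, ord_const n \<epsilon>) = F n z \<and>
    (\<forall>\<tau>\<in>ord_hom n 1. p n (H n (z, \<tau>)) = \<beta> n (z, \<tau>) \<and> (L n z \<longrightarrow> H n (z, \<tau>) = H0 n (z, \<tau>))))"
    by (rule homotopy_lifting[OF K2 E p \<beta> F(2) \<epsilon> pF L H0 pH0 FH0])
  then obtain H where H1: "smor (sprod ?K (simplex 1)) E H" and
    HH: "\<forall>n. \<forall>z\<in>simp ?K n. H n (z, ord_const n \<epsilon>) = F n z \<and>
    (\<forall>\<tau>\<in>ord_hom n 1. p n (H n (z, \<tau>)) = \<beta> n (z, \<tau>) \<and> (L n z \<longrightarrow> H n (z, \<tau>) = H0 n (z, \<tau>)))"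
    by (elim exE conjE)
  have H2: "p n (H n (z, \<tau>)) = \<beta> n (z, \<tau>)" if "z \<in> simp ?K n" "\<tau> \<in> ord_hom n 1" for n z \<tau>
    using HH that by blast
  have H4: "H n (z, \<tau>) = H0 n (z, \<tau>)" if "z \<in> simp ?K n" "L n z" "\<tau> \<in> ord_hom n 1" for n z \<tau>
    using HH that by blast
  show ?thesis
  proof (rule hlinkI[OF end_at_smor[OF A e'] end_at_smor[OF C e'] F(1) end_at_smor[OF H1 e']])
    fix n x assume x: "x \<in> simp K n"
    show "H n ((x, ord_const n \<delta>), ord_const n (1 - \<epsilon>)) = A n (x, ord_const n (1 - \<epsilon>))"
      using H4[of "(x, ord_const n \<delta>)" n "ord_const n (1 - \<epsilon>)"] x const01(1)[OF F(1), of n] const01(2)[OF \<epsilon>, of n]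
      by (simp add: L_def H0_def)
    show "H n ((x, ord_const n (1 - \<delta>)), ord_const n (1 - \<epsilon>)) = C n (x, ord_const n (1 - \<epsilon>))"
      using H4[of "(x, ord_const n (1 - \<delta>))" n "ord_const n (1 - \<epsilon>)"] x const01(2)[OF F(1), of n] const01(2)[OF \<epsilon>, of n] neq
      by (simp add: L_def H0_def)
    fix \<tau> :: "nat list" assume "\<tau> \<in> ord_hom n 1"
    then show "p n (H n ((x, \<tau>), ord_const n (1 - \<epsilon>))) = p n (A n (x, ord_const n (1 - \<epsilon>)))"
      using H2[of "(x, \<tau>)" n "ord_const n (1 - \<epsilon>)"] x const01(2)[OF \<epsilon>, of n] by (simp add: \<beta>_def)
  qed
qed

text \<open>The same for a chain of fibrewise homotopies: intermediate lifts exist by the homotopy lifting property.\<close>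

lemma transport_homotopic:
  assumes K: "is_sset K" and E: "is_sset E" and p: "kanfib E B p" and \<epsilon>: "\<epsilon> = 0 \<or> \<epsilon> = 1"
    and A: "smor (sprod K (simplex 1)) E A"
    and h: "homotopic_over K E p (end_at \<epsilon> A) c"
  shows "smor (sprod K (simplex 1)) E C \<Longrightarrow>
    (\<And>n x \<tau>. x \<in> simp K n \<Longrightarrow> \<tau> \<in> ord_hom n 1 \<Longrightarrow> p n (A n (x, \<tau>)) = p n (C n (x, \<tau>))) \<Longrightarrow>
    (\<And>n x. x \<in> simp K n \<Longrightarrow> end_at \<epsilon> C n x = c n x) \<Longrightarrow>
    homotopic_over K E p (end_at (1 - \<epsilon>) A) (end_at (1 - \<epsilon>) C)"
  using h
proof (induction arbitrary: C rule: homotopic_over_induct)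
  case (refl C)
  have "hlink K E p (end_at \<epsilon> A) (end_at \<epsilon> C)"
    using refl.prems(3) by (intro hlink_eq[OF K end_at_smor[OF A \<epsilon>]]) simp
  then show ?case using homotopic_over_link transport_link[OF K E p \<epsilon> A refl.prems(1,2)] by blast
next
  case (link g h C)
  have g: "smor K E g" using hlink_smor(1)[OF link.hyps(2)] .
  have pg: "p n (g n x) = p n (A n (x, ord_const n \<epsilon>))" if "x \<in> simp K n" for n x
    using homotopic_over_same[OF link.hyps(1) that] by simp
  obtain Z where Z: "smor (sprod K (simplex 1)) E Z"
    "\<And>n x \<tau>. x \<in> simp K n \<Longrightarrow> \<tau> \<in> ord_hom n 1 \<Longrightarrow> p n (Z n (x, \<tau>)) = p n (A n (x, \<tau>))"
    "\<And>n x. x \<in> simp K n \<Longrightarrow> Z n (x, ord_const n \<epsilon>) = g n x"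
    using path_lifting[OF K E p smor_comp[OF A kanfib_smor[OF p]] g \<epsilon> pg] by auto
  have 1: "homotopic_over K E p (end_at (1 - \<epsilon>) A) (end_at (1 - \<epsilon>) Z)"
    using Z by (intro link.IH) auto
  have "hlink K E p (end_at \<epsilon> Z) (end_at \<epsilon> C)"
  proof -
    obtain \<delta> H where "fib_homotopy K E p g h \<delta> H" by (rule hlinkE[OF link.hyps(2)])
  note H = fib_homotopyD[OF this]
    show ?thesis
      by (rule hlinkI[OF end_at_smor[OF Z(1) \<epsilon>] end_at_smor[OF link.prems(1) \<epsilon>] H(1,2)])
        (use H(3-5) Z(3) link.prems(3) in auto)
  qed
  then have "hlink K E p (end_at (1 - \<epsilon>) Z) (end_at (1 - \<epsilon>) C)"
    using Z(2) link.prems(2) by (intro transport_link[OF K E p \<epsilon> Z(1) link.prems(1)]) auto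
  then show ?case using homotopic_over_trans[OF 1] homotopic_over_link by blast
qed

text \<open>A homotopy \<open>H\<close> from \<open>g\<close> to \<open>h\<close> and its image \<open>s \<circ> p \<circ> H\<close> lie over the same homotopy in \<open>B\<close>. By transport, if
  \<open>g\<close> is fibrewise homotopic to \<open>s \<circ> p \<circ> g\<close>, then \<open>h\<close> is to \<open>s \<circ> p \<circ> h\<close>. This passes along the chain from
  \<open>s \<circ> p\<close>, where the two maps are equal, to the identity.\<close>

theorem fibrewise_deformation:
  assumes E: "is_sset E" and p: "kanfib E B p" and s: "smor B E s"
    and ps: "\<And>n b. b \<in> simp B n \<Longrightarrow> p n (s n b) = b"
    and h: "homotopic_over E E q (\<lambda>n x. s n (p n x)) (\<lambda>n x. x)"
  shows "homotopic_over E E p (\<lambda>n x. x) (\<lambda>n x. s n (p n x))"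
proof -
  have sp: "smor E E (\<lambda>n x. s n (p n x))" using smor_comp[OF kanfib_smor[OF p] s] .
  have pE: "p n x \<in> simp B n" if "x \<in> simp E n" for n x using smor_in[OF kanfib_smor[OF p] that] .
  have "homotopic_over E E p (\<lambda>n x. g n x) (\<lambda>n x. s n (p n (g n x)))"
    if "homotopic_over E E q (\<lambda>n x. s n (p n x)) g" for g
    using that
  proof (induction rule: homotopic_over_induct)
    case refl
    show ?case by (rule homotopic_over_eq[OF E sp]) (simp add: ps pE)
  next
    case (link g h)
    obtain \<epsilon> H where "fib_homotopy E E q g h \<epsilon> H" by (rule hlinkE[OF link.hyps(2)])
  note H = fib_homotopyD[OF this]
    have H_in: "H n (x, \<tau>) \<in> simp E n" if "x \<in> simp E n" "\<tau> \<in> ord_hom n 1" for n x \<tau>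
      using smor_in[OF H(2), of "(x, \<tau>)" n] that by simp
    let ?C = "\<lambda>n z. s n (p n (H n z))"
    have 1: "homotopic_over E E p (end_at \<epsilon> H) (\<lambda>n x. s n (p n (g n x)))"
      by (rule homotopic_over_cong[OF E link.IH]) (use H(3) in auto)
    have "homotopic_over E E p (end_at (1 - \<epsilon>) H) (end_at (1 - \<epsilon>) ?C)"
    proof (rule transport_homotopic[OF E E p H(1,2) 1])
      show "smor (sprod E (simplex 1)) E ?C" using smor_comp[OF H(2) sp] .
    qed (use H(3) H_in ps pE in auto)
    then show ?case by (rule homotopic_over_cong[OF E]) (use H(4) in auto)
  qed
  from this[OF h] show ?thesis .
qed

section \<open>Homotopy inverses of weak equivalences\<close>

text \<open>A copy of a simplicial set along an injection; weak equivalences are tested only on Kan complexes with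
  simplices in a particular type, and source and target have copies there.\<close>

definition relabel :: "('a \<Rightarrow> 'b) \<Rightarrow> 'a sset \<Rightarrow> 'b sset" where
  "relabel i A = \<lparr>simp = \<lambda>n. i ` simp A n, act = \<lambda>n \<alpha> y. i (act A n \<alpha> (inv i y))\<rparr>"

lemma relabel_simps [simp]:
  "simp (relabel i A) n = i ` simp A n" "act (relabel i A) n \<alpha> y = i (act A n \<alpha> (inv i y))"
  by (simp_all add: relabel_def)

lemma relabel_smor:
  assumes "inj i"
  shows "smor A (relabel i A) (\<lambda>n. i)" "smor (relabel i A) A (\<lambda>n. inv i)"
  using assms by (auto intro!: smorI)

lemma is_sset_relabel:
  assumes i: "inj i" and A: "is_sset A"
  shows "is_sset (relabel i A)"
  by (rule is_ssetI) (use i A in \<open>auto simp: sset_act sset_id sset_comp\<close>)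

lemma kan_complex_fill:
  assumes A: "kan_complex A" and n: "1 \<le> n" "k \<le> n" and u: "smor (horn n k) A u"
  shows "\<exists>e\<in>simp A n. \<forall>m. \<forall>\<alpha>\<in>simp (horn n k) m. act A n \<alpha> e = u m \<alpha>"
proof -
  have ex: "\<forall>n k. \<forall>u\<in>smaps (horn n k) A. 1 \<le> n \<and> k \<le> n \<longrightarrow>
        (\<exists>w\<in>smaps (simplex n) A. \<forall>m. \<forall>\<alpha>\<in>simp (horn n k) m. w m \<alpha> = u m \<alpha>)"
    using A unfolding kan_complex_def by simp
  have "\<exists>w\<in>smaps (simplex n) A. \<forall>m. \<forall>\<alpha>\<in>simp (horn n k) m. w m \<alpha> = sres (horn n k) u m \<alpha>"
    using ex[rule_format, OF smor_sres[OF is_sset_horn u]] n by simp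
  then obtain w where w: "w \<in> smaps (simplex n) A" "\<And>m \<alpha>. \<alpha>\<in>simp (horn n k) m \<Longrightarrow> w m \<alpha> = sres (horn n k) u m \<alpha>"
    by blast
  show ?thesis
  proof (intro bexI allI ballI)
    show "w n (ord_id n) \<in> simp A n"
      using smor_in[OF smaps_smor[OF w(1)], of "ord_id n" n] by (simp add: ord_id_in)
    fix m \<alpha> assume a: "\<alpha> \<in> simp (horn n k) m"
    then have "\<alpha> \<in> ord_hom m n" by simp
    from smor_nat[OF smaps_smor[OF w(1)] this, of "ord_id n"]
    show "act A n \<alpha> (w n (ord_id n)) = u m \<alpha>"
      using w(2)[OF a] sres_eq[OF a, of u] ord_comp_id_left[OF \<open>\<alpha> \<in> ord_hom m n\<close>] by (simp add: ord_id_in)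
  qed
qed

lemma kan_complex_sset: "kan_complex A \<Longrightarrow> is_sset A"
  by (simp add: kan_complex_def)

lemma kan_complex_relabel:
  assumes i: "inj i" and A: "kan_complex A"
  shows "kan_complex (relabel i A)"
proof (rule kan_complexI[OF is_sset_relabel[OF i kan_complex_sset[OF A]]])
  fix n k u assume n: "1 \<le> n" "k \<le> n" and u: "smor (horn n k) (relabel i A) u"
  obtain e where e: "e \<in> simp A n" "\<And>m \<alpha>. \<alpha> \<in> simp (horn n k) m \<Longrightarrow> act A n \<alpha> e = inv i (u m \<alpha>)"
    using kan_complex_fill[OF A n smor_comp[OF u relabel_smor(2)[OF i]]] by blast
  show "\<exists>e\<in>simp (relabel i A) n. \<forall>m. \<forall>\<alpha>\<in>simp (horn n k) m. act (relabel i A) n \<alpha> e = u m \<alpha>"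
  proof (intro bexI allI ballI)
    show "i e \<in> simp (relabel i A) n" using e by simp
    fix m \<alpha> assume a: "\<alpha> \<in> simp (horn n k) m"
    have "u m \<alpha> \<in> i ` simp A m" using smor_in[OF u a] by simp
    then show "act (relabel i A) n \<alpha> (i e) = u m \<alpha>" using e(2)[OF a] i by (auto simp: f_inv_into_f)
  qed
qed

definition edge_rel :: "'a sset \<Rightarrow> ('a \<times> 'a) set" where
  "edge_rel A = (let E = {(sface A 1 1 e, sface A 1 0 e) | e. e \<in> simp A 1} in E \<union> E\<inverse>)"

lemma pi0_rel_edge: "pi0_rel A = Restr ((edge_rel A)\<^sup>*) (simp A 0)"
  by (simp add: pi0_rel_def edge_rel_def Let_def)

lemma edge_relI: "e \<in> simp A 1 \<Longrightarrow> (act A 1 [0] e, act A 1 [1] e) \<in> edge_rel A"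
  "e \<in> simp A 1 \<Longrightarrow> (act A 1 [1] e, act A 1 [0] e) \<in> edge_rel A"
  unfolding edge_rel_def Let_def sface_def coface_def by (auto simp: upt_rec)

lemma edge_relE:
  assumes "(a, b) \<in> edge_rel A"
  obtains \<epsilon> e where "\<epsilon> = 0 \<or> \<epsilon> = 1" "e \<in> simp A 1" "a = act A 1 [\<epsilon>] e" "b = act A 1 [1 - \<epsilon>] e"
proof -
  obtain e where "e \<in> simp A 1" "a = act A 1 [0] e \<and> b = act A 1 [1] e \<or> a = act A 1 [1] e \<and> b = act A 1 [0] e"
    using assms unfolding edge_rel_def Let_def sface_def coface_def by (auto simp: upt_rec)
  then show thesis using that[of 0 e] that[of 1 e] by auto
qed

lemma edge_rel_sym: "sym (edge_rel A)"
  unfolding edge_rel_def Let_def by (auto simp: sym_def)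

lemma pi0_equiv: "equiv (simp A 0) (pi0_rel A)"
proof (rule equivI)
  show "pi0_rel A \<subseteq> simp A 0 \<times> simp A 0" by (auto simp: pi0_rel_edge)
  show "refl_on (simp A 0) (pi0_rel A)" by (auto simp: refl_on_def pi0_rel_edge)
  show "sym (pi0_rel A)" using sym_rtrancl[OF edge_rel_sym[of A]] unfolding pi0_rel_edge sym_def by auto
  show "trans (pi0_rel A)" unfolding pi0_rel_edge trans_def by auto
qed

lemma pi0_class_eq_iff:
  "x \<in> simp A 0 \<Longrightarrow> y \<in> simp A 0 \<Longrightarrow> pi0_class A x = pi0_class A y \<longleftrightarrow> (x, y) \<in> pi0_rel A"
  unfolding pi0_class_def by (rule eq_equiv_class_iff[OF pi0_equiv])

lemma pi0_class_in: "x \<in> simp A 0 \<Longrightarrow> pi0_class A x \<in> pi0 A"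
  unfolding pi0_class_def pi0_def by (rule quotientI)

lemma pi0_class_self: "x \<in> simp A 0 \<Longrightarrow> x \<in> pi0_class A x"
  unfolding pi0_class_def by (rule equiv_class_self[OF pi0_equiv])

lemma pi0_cases:
  assumes "c \<in> pi0 A" obtains x where "x \<in> simp A 0" "c = pi0_class A x"
  using assms unfolding pi0_class_def pi0_def by (rule quotientE)

text \<open>The next two definitions are the bijection between maps \<open>A \<times> \<Delta>\<^sup>0 \<rightarrow> Z\<close> and maps \<open>A \<rightarrow> Z\<close>.\<close>

definition at_pt :: "(nat \<Rightarrow> 'a \<times> nat list \<Rightarrow> 'c) \<Rightarrow> nat \<Rightarrow> 'a \<Rightarrow> 'c" where
  "at_pt h = (\<lambda>n x. h n (x, ord_const n 0))"

definition const_pt :: "'a sset \<Rightarrow> (nat \<Rightarrow> 'a \<Rightarrow> 'c) \<Rightarrow> nat \<Rightarrow> 'a \<times> nat list \<Rightarrow> 'c" where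
  "const_pt A f = sres (sprod A (simplex 0)) (\<lambda>n z. f n (fst z))"

lemma at_pt_smor:
  assumes "h \<in> smaps (sprod A (simplex 0)) Z" shows "smor A Z (at_pt h)"
proof (rule smorI)
  have s: "smor (sprod A (simplex 0)) Z h" using assms smaps_smor by blast
  fix n x assume "x \<in> simp A n"
  then show "at_pt h n x \<in> simp Z n" 
    using smor_in[OF s, of "(x, ord_const n 0)" n] by (simp add: at_pt_def ord_hom_0)
next
  have s: "smor (sprod A (simplex 0)) Z h" using assms smaps_smor by blast
  fix m n \<alpha> x assume t: "\<alpha> \<in> ord_hom m n" and "x \<in> simp A n"
  then show "at_pt h m (act A n \<alpha> x) = act Z n \<alpha> (at_pt h n x)"
    using smor_nat[OF s t, of "(x, ord_const n 0)"] by (simp add: at_pt_def ord_hom_0 ord_comp_const_left[OF t])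
qed

lemma const_pt_in:
  assumes "is_sset A" "smor A Z f" shows "const_pt A f \<in> smaps (sprod A (simplex 0)) Z"
  unfolding const_pt_def
  by (rule smor_sres, intro is_sset_sprod is_sset_simplex assms(1), rule smorI)
    (use smor_in[OF assms(2)] smor_nat[OF assms(2)] in auto)

lemma const_pt_apply: "x \<in> simp A n \<Longrightarrow> const_pt A f n (x, ord_const n 0) = f n x"
  unfolding const_pt_def by (subst sres_eq) (simp_all add: ord_hom_0)

lemma const_pt_eqI:
  assumes A: "is_sset A" and h: "h \<in> smaps (sprod A (simplex 0)) Z"
    and eq: "\<And>n x. x \<in> simp A n \<Longrightarrow> at_pt h n x = f n x"
  shows "const_pt A f = h"
proof (rule smaps_eqI[OF _ h])
  show "const_pt A f \<in> smaps (sprod A (simplex 0)) Z"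
    using smor_cong[OF A at_pt_smor[OF h] eq] by (rule const_pt_in[OF A])
  fix n z assume "z \<in> simp (sprod A (simplex 0)) n"
  then obtain x where "z = (x, ord_const n 0)" "x \<in> simp A n" by (auto simp: ord_hom_0)
  then show "const_pt A f n z = h n z" using eq const_pt_apply[of x A n f] by (simp add: at_pt_def)
qed

lemma shom_vertex:
  assumes A: "is_sset A" and e: "e \<in> smaps (sprod A (simplex 1)) Z" and \<epsilon>: "\<epsilon> = 0 \<or> \<epsilon> = 1"
  shows "act (shom A Z) 1 [\<epsilon>] e \<in> smaps (sprod A (simplex 0)) Z"
    "x \<in> simp A n \<Longrightarrow> at_pt (act (shom A Z) 1 [\<epsilon>] e) n x = e n (x, ord_const n \<epsilon>)"
proof -
  have v: "[\<epsilon>] \<in> ord_hom 0 1" using const01(1)[OF \<epsilon>, of 0] by (simp add: replicate_Suc)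
  show "act (shom A Z) 1 [\<epsilon>] e \<in> smaps (sprod A (simplex 0)) Z" by (rule shom_act_in[OF A v e])
  assume x: "x \<in> simp A n"
  have "ord_const n 0 \<in> ord_hom n 0" by (simp add: ord_hom_0)
  from shom_act[OF v x this, of Z e] show "at_pt (act (shom A Z) 1 [\<epsilon>] e) n x = e n (x, ord_const n \<epsilon>)"
    by (simp add: at_pt_def ord_comp_const_right)
qed

text \<open>Vertices of the internal hom are maps \<open>A \<times> \<Delta>\<^sup>0 \<rightarrow> Z\<close>, and its edges are homotopies.\<close>

lemma pi0_shom_iff:
  fixes A :: "'a sset" and Z :: "'c sset"
  assumes A: "is_sset A"
  shows "(h, h') \<in> pi0_rel (shom A Z) \<longleftrightarrow> h \<in> smaps (sprod A (simplex 0)) Z \<and>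
    h' \<in> smaps (sprod A (simplex 0)) Z \<and> homotopic_over A Z no_base (at_pt h) (at_pt h')" (is "?l \<longleftrightarrow> ?r")
proof
  assume ?l
  then have h: "h \<in> smaps (sprod A (simplex 0)) Z" "h' \<in> smaps (sprod A (simplex 0)) Z"
    and "(h, h') \<in> (edge_rel (shom A Z))\<^sup>*" by (auto simp: pi0_rel_edge)
  have "homotopic_over A Z no_base (at_pt h) (at_pt h')"
    using \<open>(h, h') \<in> (edge_rel (shom A Z))\<^sup>*\<close>
  proof (induction rule: rtrancl_induct)
    case base
    show ?case using at_pt_smor[OF h(1)] by (simp add: homotopic_over_def)
  next
    case (step a b)
    obtain \<epsilon> e where e: "\<epsilon> = 0 \<or> \<epsilon> = 1" "e \<in> simp (shom A Z) 1"
      "a = act (shom A Z) 1 [\<epsilon>] e" "b = act (shom A Z) 1 [1 - \<epsilon>] e"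
      using edge_relE[OF step.hyps(2)] by blast
    have e2: "e \<in> smaps (sprod A (simplex 1)) Z" using e(2) by simp
    have e': "1 - \<epsilon> = 0 \<or> 1 - \<epsilon> = 1" by auto
    have "hlink A Z no_base (at_pt a) (at_pt b)"
    proof (rule hlinkI[OF _ _ e(1) smaps_smor[OF e2]])
      show "smor A Z (at_pt a)" "smor A Z (at_pt b)"
        unfolding e(3,4) by (intro at_pt_smor shom_vertex(1)[OF A e2] e(1) e')+
    qed (simp_all only: e(3,4) shom_vertex(2)[OF A e2 e(1)] shom_vertex(2)[OF A e2 e'])
    then show ?case using homotopic_over_trans[OF step.IH homotopic_over_link] by blast
  qed
  then show ?r using h by blast
next
  assume r: ?r
  have all: "(h, const_pt A g) \<in> (edge_rel (shom A Z))\<^sup>*" if "homotopic_over A Z no_base (at_pt h) g" for g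
    using that
  proof (induction rule: homotopic_over_induct)
    case refl
    have "const_pt A (at_pt h) = h" using r by (intro const_pt_eqI[OF A]) auto
    then show ?case by simp
  next
    case (link g g')
    obtain \<epsilon> H where "fib_homotopy A Z no_base g g' \<epsilon> H" by (rule hlinkE[OF link.hyps(2)])
    note H = fib_homotopyD[OF this]
    let ?e = "sres (sprod A (simplex 1)) H"
    have e: "?e \<in> smaps (sprod A (simplex 1)) Z"
      by (intro smor_sres is_sset_sprod A is_sset_simplex H(2))
    have e': "1 - \<epsilon> = 0 \<or> 1 - \<epsilon> = 1" by auto
    have eH: "?e n (x, ord_const n \<delta>) = H n (x, ord_const n \<delta>)" if "x \<in> simp A n" "\<delta> = 0 \<or> \<delta> = 1" for n x \<delta>
      using that const01(1)[OF that(2), of n] by (intro sres_eq) simp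
    have "const_pt A g = act (shom A Z) 1 [\<epsilon>] ?e"
      by (rule const_pt_eqI[OF A shom_vertex(1)[OF A e H(1)]]) (simp only: shom_vertex(2)[OF A e H(1)] eH[OF _ H(1)] H(3))
    moreover have "const_pt A g' = act (shom A Z) 1 [1 - \<epsilon>] ?e"
      by (rule const_pt_eqI[OF A shom_vertex(1)[OF A e e']]) (simp only: shom_vertex(2)[OF A e e'] eH[OF _ e'] H(4))
    moreover have "(act (shom A Z) 1 [\<epsilon>] ?e, act (shom A Z) 1 [1 - \<epsilon>] ?e) \<in> edge_rel (shom A Z)"
    proof -
      have "?e \<in> simp (shom A Z) 1" using e by simp
      then show ?thesis using edge_relI[of ?e "shom A Z"] H(1) by auto
    qed
    ultimately have "(const_pt A g, const_pt A g') \<in> edge_rel (shom A Z)" by simp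
    with link.IH show ?case by (rule rtrancl_into_rtrancl)
  qed
  have "const_pt A (at_pt h') = h'" using r by (intro const_pt_eqI[OF A]) auto
  then have "(h, h') \<in> (edge_rel (shom A Z))\<^sup>*" using all r by metis
  then show ?l using r by (simp add: pi0_rel_edge)
qed

lemma shom_pre_in:
  assumes A: "is_sset A" and f: "smor A B f" and h: "h \<in> smaps (sprod B (simplex 0)) Z"
  shows "shom_pre A f 0 h \<in> smaps (sprod A (simplex 0)) Z"
    "x \<in> simp A n \<Longrightarrow> at_pt (shom_pre A f 0 h) n x = at_pt h n (f n x)"
proof -
  have "const_pt A (\<lambda>n x. at_pt h n (f n x)) n z = shom_pre A f 0 h n z" for n z
    by (auto simp: const_pt_def shom_pre_def sres_def at_pt_def restrict_def fun_eq_iff ord_hom_0 split: prod.splits)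
  then have eq: "const_pt A (\<lambda>n x. at_pt h n (f n x)) = shom_pre A f 0 h" by blast
  show "shom_pre A f 0 h \<in> smaps (sprod A (simplex 0)) Z"
    using const_pt_in[OF A smor_comp[OF f at_pt_smor[OF h]]] eq by simp
  show "x \<in> simp A n \<Longrightarrow> at_pt (shom_pre A f 0 h) n x = at_pt h n (f n x)"
    unfolding eq[symmetric] at_pt_def[of "const_pt _ _"] by (rule const_pt_apply)
qed

lemma pi0_map_class:
  assumes A: "is_sset A" and B: "is_sset B" and f: "smor A B f" and h: "h \<in> smaps (sprod B (simplex 0)) Z"
  shows "pi0_map (shom B Z) (shom A Z) (shom_pre A f) (pi0_class (shom B Z) h) =
    pi0_class (shom A Z) (shom_pre A f 0 h)"
proof -
  have "pi0_class (shom A Z) (shom_pre A f 0 h') = pi0_class (shom A Z) (shom_pre A f 0 h)"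
    if "h' \<in> pi0_class (shom B Z) h" for h'
  proof -
    have "(h, h') \<in> pi0_rel (shom B Z)" using that by (simp add: pi0_class_def)
    then have r: "h' \<in> smaps (sprod B (simplex 0)) Z" "homotopic_over B Z no_base (at_pt h) (at_pt h')"
      unfolding pi0_shom_iff[OF B] by auto
    have "homotopic_over A Z no_base (at_pt (shom_pre A f 0 h)) (at_pt (shom_pre A f 0 h'))"
      by (rule homotopic_over_cong[OF A homotopic_over_pre[OF r(2) f]])
        (simp_all add: shom_pre_in(2)[OF A f h] shom_pre_in(2)[OF A f r(1)])
    then have "(shom_pre A f 0 h, shom_pre A f 0 h') \<in> pi0_rel (shom A Z)"
      unfolding pi0_shom_iff[OF A] by (intro conjI shom_pre_in(1)[OF A f h] shom_pre_in(1)[OF A f r(1)])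
    then show ?thesis unfolding pi0_class_def by (rule equiv_class_eq[OF pi0_equiv, symmetric])
  qed
  note eq = this
  have "h \<in> pi0_class (shom B Z) h" using h by (intro pi0_class_self) simp
  then have "(\<Union>h'\<in>pi0_class (shom B Z) h. pi0_class (shom A Z) (shom_pre A f 0 h')) =
      pi0_class (shom A Z) (shom_pre A f 0 h)"
    by (rule UN_constant_eq, intro ballI eq)
  then show ?thesis unfolding pi0_map_def .
qed

text \<open>The Yoneda argument. Surjectivity for (a copy of) \<open>A\<close> as test object yields \<open>g\<close> with \<open>g \<circ> f \<sim> 1\<close>. Then
  \<open>f \<circ> g\<close> and \<open>1\<close> become homotopic after composition with \<open>f\<close>, so injectivity for (a copy of) \<open>B\<close> gives
  \<open>f \<circ> g \<sim> 1\<close>.\<close>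

theorem weak_equivalence_homotopy_inverse:
  fixes A :: "'a sset" and B :: "'b sset"
  assumes w: "weak_equivalence A B f" and A: "kan_complex A" and B: "kan_complex B"
  obtains g where "smor B A g"
    "homotopic_over A A no_base (\<lambda>n x. g n (f n x)) (\<lambda>n x. x)"
    "homotopic_over B B no_base (\<lambda>n x. f n (g n x)) (\<lambda>n x. x)"
proof -
  note sA = kan_complex_sset[OF A] and sB = kan_complex_sset[OF B]
  have f: "smor A B f" using w smaps_smor unfolding weak_equivalence_def by blast
  have bij: "bij_betw (pi0_map (shom B Z) (shom A Z) (shom_pre A f)) (pi0 (shom B Z)) (pi0 (shom A Z))"
    if "kan_complex Z" for Z :: "('a + 'b) list sset"
    using w that unfolding weak_equivalence_def by blast
  define i :: "'a \<Rightarrow> ('a + 'b) list" where "i x = [Inl x]" for x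
  define j :: "'b \<Rightarrow> ('a + 'b) list" where "j x = [Inr x]" for x
  have i: "inj i" and j: "inj j" by (auto simp: inj_def i_def j_def)
  let ?Z = "relabel i A"
  have h0: "const_pt A (\<lambda>n. i) \<in> smaps (sprod A (simplex 0)) ?Z"
    by (rule const_pt_in[OF sA relabel_smor(1)[OF i]])
  have "pi0_class (shom A ?Z) (const_pt A (\<lambda>n. i)) \<in> pi0 (shom A ?Z)"
    using h0 by (intro pi0_class_in) simp
  then have "pi0_class (shom A ?Z) (const_pt A (\<lambda>n. i)) \<in>
      pi0_map (shom B ?Z) (shom A ?Z) (shom_pre A f) ` pi0 (shom B ?Z)"
    unfolding bij_betw_imp_surj_on[OF bij[OF kan_complex_relabel[OF i A]]] .
  then obtain c where c: "pi0_class (shom A ?Z) (const_pt A (\<lambda>n. i)) =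
      pi0_map (shom B ?Z) (shom A ?Z) (shom_pre A f) c" "c \<in> pi0 (shom B ?Z)" by (rule imageE)
  obtain h where h': "h \<in> simp (shom B ?Z) 0" "c = pi0_class (shom B ?Z) h"
    using c(2) by (rule pi0_cases)
  then have h: "h \<in> smaps (sprod B (simplex 0)) ?Z" by simp
  have "pi0_class (shom A ?Z) (const_pt A (\<lambda>n. i)) = pi0_class (shom A ?Z) (shom_pre A f 0 h)"
    unfolding c(1) h'(2) by (rule pi0_map_class[OF sA sB f h])
  then have "(const_pt A (\<lambda>n. i), shom_pre A f 0 h) \<in> pi0_rel (shom A ?Z)"
    using h0 shom_pre_in(1)[OF sA f h] by (subst pi0_class_eq_iff[symmetric]) simp_all
  then have "homotopic_over A ?Z no_base (at_pt (const_pt A (\<lambda>n. i))) (at_pt (shom_pre A f 0 h))"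
    unfolding pi0_shom_iff[OF sA] by blast
  then have 1: "homotopic_over A A no_base (\<lambda>n x. inv i (at_pt (const_pt A (\<lambda>n. i)) n x))
      (\<lambda>n x. inv i (at_pt (shom_pre A f 0 h) n x))"
    by (rule homotopic_over_post[OF _ relabel_smor(2)[OF i]]) simp
  define g where "g n x = inv i (at_pt h n x)" for n x
  have g: "smor B A g" unfolding g_def by (rule smor_comp[OF at_pt_smor[OF h] relabel_smor(2)[OF i]])
  have gf: "homotopic_over A A no_base (\<lambda>n x. g n (f n x)) (\<lambda>n x. x)"
    by (rule homotopic_over_sym, rule homotopic_over_cong[OF sA 1])
      (simp_all add: g_def shom_pre_in(2)[OF sA f h] at_pt_def[of "const_pt _ _"] const_pt_apply inv_f_f[OF i])
  let ?W = "relabel j B"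
  have fg: "smor B B (\<lambda>n x. f n (g n x))" using smor_comp[OF g f] .
  have j': "smor B ?W (\<lambda>n. j)" by (rule relabel_smor(1)[OF j])
  let ?a = "const_pt B (\<lambda>n x. j (f n (g n x)))" and ?b = "const_pt B (\<lambda>n. j)"
  have a: "?a \<in> smaps (sprod B (simplex 0)) ?W" using const_pt_in[OF sB smor_comp[OF fg j']] .
  have b: "?b \<in> smaps (sprod B (simplex 0)) ?W" using const_pt_in[OF sB j'] .
  have fin: "f n x \<in> simp B n" if "x \<in> simp A n" for n x using smor_in[OF f that] .
  have "homotopic_over A ?W no_base (\<lambda>n x. j (f n (g n (f n x)))) (\<lambda>n x. j (f n x))"
    by (rule homotopic_over_post[OF gf smor_comp[OF f j']]) simp
  then have "homotopic_over A ?W no_base (at_pt (shom_pre A f 0 ?a)) (at_pt (shom_pre A f 0 ?b))"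
    by (rule homotopic_over_cong[OF sA])
      (simp_all add: shom_pre_in(2)[OF sA f a] shom_pre_in(2)[OF sA f b] at_pt_def[of "const_pt _ _"] const_pt_apply fin)
  then have "(shom_pre A f 0 ?a, shom_pre A f 0 ?b) \<in> pi0_rel (shom A ?W)"
    unfolding pi0_shom_iff[OF sA] using shom_pre_in(1)[OF sA f] a b by blast
  then have "pi0_class (shom A ?W) (shom_pre A f 0 ?a) = pi0_class (shom A ?W) (shom_pre A f 0 ?b)"
    unfolding pi0_class_def by (rule equiv_class_eq[OF pi0_equiv])
  then have "pi0_map (shom B ?W) (shom A ?W) (shom_pre A f) (pi0_class (shom B ?W) ?a) =
      pi0_map (shom B ?W) (shom A ?W) (shom_pre A f) (pi0_class (shom B ?W) ?b)"
    unfolding pi0_map_class[OF sA sB f a] pi0_map_class[OF sA sB f b] .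
  moreover have ab: "?a \<in> simp (shom B ?W) 0" "?b \<in> simp (shom B ?W) 0" using a b by simp_all
  ultimately have "pi0_class (shom B ?W) ?a = pi0_class (shom B ?W) ?b"
    by (intro inj_onD[OF bij_betw_imp_inj_on[OF bij[OF kan_complex_relabel[OF j B]]]] pi0_class_in)
  then have "(?a, ?b) \<in> pi0_rel (shom B ?W)" unfolding pi0_class_eq_iff[OF ab] .
  then have "homotopic_over B ?W no_base (at_pt ?a) (at_pt ?b)"
    unfolding pi0_shom_iff[OF sB] by blast
  then have "homotopic_over B B no_base (\<lambda>n x. inv j (at_pt ?a n x)) (\<lambda>n x. inv j (at_pt ?b n x))"
    by (rule homotopic_over_post[OF _ relabel_smor(2)[OF j]]) simp
  then have "homotopic_over B B no_base (\<lambda>n x. f n (g n x)) (\<lambda>n x. x)"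
    by (rule homotopic_over_cong[OF sB])
      (simp_all add: at_pt_def[of "const_pt _ _"] const_pt_apply inv_f_f[OF j])
  with g gf show thesis by (rule that)
qed

section \<open>Restriction maps of Reedy fibrant bisimplicial sets\<close>

lemma bi_act: "is_bisset X \<Longrightarrow> \<alpha> \<in> ord_hom k n \<Longrightarrow> \<beta> \<in> ord_hom l m \<Longrightarrow> x \<in> bisimp X n m \<Longrightarrow>
    bact X n m \<alpha> \<beta> x \<in> bisimp X k l"
  unfolding is_bisset_def by (elim conjE) (simp add: Pi_iff)

lemma bi_id: "is_bisset X \<Longrightarrow> x \<in> bisimp X n m \<Longrightarrow> bact X n m (ord_id n) (ord_id m) x = x"
  unfolding is_bisset_def by (elim conjE) simp

lemma bi_comp:
  assumes "is_bisset X" "\<alpha> \<in> ord_hom k n" "\<beta> \<in> ord_hom l m" "\<alpha>' \<in> ord_hom k' k" "\<beta>' \<in> ord_hom l' l" "x \<in> bisimp X n m"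
  shows "bact X k l \<alpha>' \<beta>' (bact X n m \<alpha> \<beta> x) = bact X n m (ord_comp \<alpha> \<alpha>') (ord_comp \<beta> \<beta>') x"
proof -
  have "\<forall>k l m n k' l'. \<forall>\<alpha>\<in>ord_hom k n. \<forall>\<beta>\<in>ord_hom l m. \<forall>\<alpha>'\<in>ord_hom k' k. \<forall>\<beta>'\<in>ord_hom l' l.
        \<forall>x\<in>bisimp X n m.
        bact X n m (ord_comp \<alpha> \<alpha>') (ord_comp \<beta> \<beta>') x = bact X k l \<alpha>' \<beta>' (bact X n m \<alpha> \<beta> x)"
    using assms(1) unfolding is_bisset_def by (elim conjE)
  from this[rule_format, OF assms(2-6)] show ?thesis by simp
qed

lemma column_simps [simp]:
  "simp (column X n) = bisimp X n" "act (column X n) m = bact X n m (ord_id n)"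
  by (simp_all add: column_def)

lemma is_sset_column: "is_bisset X \<Longrightarrow> is_sset (column X n)"
  by (rule is_ssetI)
    (simp_all add: bi_act bi_id ord_id_in bi_comp[OF _ ord_id_in _ ord_id_in] ord_comp_id_left[OF ord_id_in])

text \<open>Restriction to \<open>A\<close>: simplices of \<open>A \ X\<close> are extensional families, so the values elsewhere are cut off.\<close>

definition bres :: "'b sset \<Rightarrow> nat \<Rightarrow> (nat \<Rightarrow> nat \<Rightarrow> 'b \<times> nat list \<Rightarrow> 'a) \<Rightarrow> nat \<Rightarrow> nat \<Rightarrow> 'b \<times> nat list \<Rightarrow> 'a" where
  "bres A m \<phi> = (\<lambda>k l. restrict (\<phi> k l) (simp A k \<times> ord_hom l m))"

lemma bres_eq: "a \<in> simp A k \<Longrightarrow> \<tau> \<in> ord_hom l m \<Longrightarrow> bres A m \<phi> k l (a, \<tau>) = \<phi> k l (a, \<tau>)"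
  by (simp add: bres_def)

lemma ldiv_simp: "simp (ldiv A X) m = bimaps (box A (simplex m)) X"
  by (simp add: ldiv_def)

lemma ldiv_in: "\<phi> \<in> simp (ldiv A X) m \<Longrightarrow> a \<in> simp A k \<Longrightarrow> \<tau> \<in> ord_hom l m \<Longrightarrow> \<phi> k l (a, \<tau>) \<in> bisimp X k l"
proof -
  assume p: "\<phi> \<in> simp (ldiv A X) m" and a: "a \<in> simp A k" "\<tau> \<in> ord_hom l m"
  have "\<phi> k l \<in> bisimp (box A (simplex m)) k l \<rightarrow>\<^sub>E bisimp X k l" using p unfolding ldiv_simp bimaps_def by blast
  then have "\<phi> k l \<in> simp A k \<times> ord_hom l m \<rightarrow> bisimp X k l" by (simp add: box_def PiE_def)
  then show ?thesis using a by (simp add: Pi_iff)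
qed

lemma ldiv_nat:
  assumes "\<phi> \<in> simp (ldiv A X) m" "\<alpha> \<in> ord_hom k n" "\<beta> \<in> ord_hom l j" "a \<in> simp A n" "\<tau> \<in> ord_hom j m"
  shows "\<phi> k l (act A n \<alpha> a, ord_comp \<tau> \<beta>) = bact X n j \<alpha> \<beta> (\<phi> n j (a, \<tau>))"
proof -
  have "\<forall>k l m' n. \<forall>\<alpha>\<in>ord_hom k n. \<forall>\<beta>\<in>ord_hom l m'. \<forall>x\<in>bisimp (box A (simplex m)) n m'.
        \<phi> k l (bact (box A (simplex m)) n m' \<alpha> \<beta> x) = bact X n m' \<alpha> \<beta> (\<phi> n m' x)"
    using assms(1) unfolding ldiv_simp bimaps_def by blast
  from this[rule_format, OF assms(2,3), of "(a, \<tau>)"] show ?thesis using assms(4,5) by (simp add: box_def)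
qed

lemma ldivI:
  assumes A: "is_sset A" and \<phi>: "\<And>k l a \<tau>. a \<in> simp A k \<Longrightarrow> \<tau> \<in> ord_hom l m \<Longrightarrow> \<phi> k l (a, \<tau>) \<in> bisimp X k l"
    "\<And>k l n j \<alpha> \<beta> a \<tau>. \<alpha> \<in> ord_hom k n \<Longrightarrow> \<beta> \<in> ord_hom l j \<Longrightarrow> a \<in> simp A n \<Longrightarrow> \<tau> \<in> ord_hom j m \<Longrightarrow>
      \<phi> k l (act A n \<alpha> a, ord_comp \<tau> \<beta>) = bact X n j \<alpha> \<beta> (\<phi> n j (a, \<tau>))"
  shows "bres A m \<phi> \<in> simp (ldiv A X) m"
  unfolding ldiv_simp bimaps_def
proof (intro CollectI conjI allI ballI)
  fix k l show "bres A m \<phi> k l \<in> bisimp (box A (simplex m)) k l \<rightarrow>\<^sub>E bisimp X k l"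
    using \<phi>(1) by (auto simp: box_def bres_def)
next
  fix k l j n \<alpha> \<beta> x assume a: "\<alpha> \<in> ord_hom k n" and b: "\<beta> \<in> ord_hom l j"
    and "x \<in> bisimp (box A (simplex m)) n j"
  then obtain y \<tau> where x: "x = (y, \<tau>)" "y \<in> simp A n" "\<tau> \<in> ord_hom j m" by (auto simp: box_def)
  show "bres A m \<phi> k l (bact (box A (simplex m)) n j \<alpha> \<beta> x) = bact X n j \<alpha> \<beta> (bres A m \<phi> n j x)"
    using \<phi>(2)[OF a b x(2,3)] x(1)
    by (simp add: box_def bres_eq[OF x(2,3)] bres_eq[OF sset_act[OF A a x(2)] ord_comp_in[OF x(3) b]])
qed

lemma ldiv_eqI:
  assumes "\<phi> \<in> simp (ldiv A X) m" "\<psi> \<in> simp (ldiv A X) m"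
    "\<And>k l a \<tau>. a \<in> simp A k \<Longrightarrow> \<tau> \<in> ord_hom l m \<Longrightarrow> \<phi> k l (a, \<tau>) = \<psi> k l (a, \<tau>)"
  shows "\<phi> = \<psi>"
proof -
  have e: "\<chi> k l \<in> simp A k \<times> ord_hom l m \<rightarrow>\<^sub>E bisimp X k l" if "\<chi> \<in> simp (ldiv A X) m" for \<chi> k l
  proof -
    have "\<chi> k l \<in> bisimp (box A (simplex m)) k l \<rightarrow>\<^sub>E bisimp X k l" using that unfolding ldiv_simp bimaps_def by blast
    then show ?thesis by (simp add: box_def)
  qed
  have "\<phi> k l = \<psi> k l" for k l
    by (rule PiE_ext[OF e[OF assms(1)] e[OF assms(2)]]) (use assms(3) in auto)
  then show ?thesis by blast
qed

lemma ldiv_act: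
  assumes "\<beta> \<in> ord_hom j m" "a \<in> simp A k" "\<tau> \<in> ord_hom l j"
  shows "act (ldiv A X) m \<beta> \<phi> k l (a, \<tau>) = \<phi> k l (a, ord_comp \<beta> \<tau>)"
  using assms by (simp add: ldiv_def ord_hom_length)

lemma ldiv_act_in:
  assumes A: "is_sset A" and b: "\<beta> \<in> ord_hom j m" and p: "\<phi> \<in> simp (ldiv A X) m"
  shows "act (ldiv A X) m \<beta> \<phi> \<in> simp (ldiv A X) j"
proof -
  have "act (ldiv A X) m \<beta> \<phi> = bres A j (\<lambda>k l (a, \<tau>). \<phi> k l (a, ord_comp \<beta> \<tau>))"
    using ord_hom_length[OF b] by (simp add: ldiv_def bres_def)
  also have "\<dots> \<in> simp (ldiv A X) j"
  proof (rule ldivI[OF A])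
    fix k l a \<tau> assume "a \<in> simp A k" "\<tau> \<in> ord_hom l j"
    then show "(case (a, \<tau>) of (a, \<tau>) \<Rightarrow> \<phi> k l (a, ord_comp \<beta> \<tau>)) \<in> bisimp X k l"
      using ldiv_in[OF p _ ord_comp_in[OF b]] by simp
  next
    fix k l n i \<alpha> \<theta> a \<tau> assume t: "\<alpha> \<in> ord_hom k n" "\<theta> \<in> ord_hom l i" "a \<in> simp A n" "\<tau> \<in> ord_hom i j"
    show "(case (act A n \<alpha> a, ord_comp \<tau> \<theta>) of (a, \<tau>) \<Rightarrow> \<phi> k l (a, ord_comp \<beta> \<tau>)) =
        bact X n i \<alpha> \<theta> (case (a, \<tau>) of (a, \<tau>) \<Rightarrow> \<phi> n i (a, ord_comp \<beta> \<tau>))"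
      using ldiv_nat[OF p t(1-3) ord_comp_in[OF b t(4)]] ord_comp_assoc[OF t(4,2), of \<beta>] by simp
  qed
  finally show ?thesis .
qed

lemma is_sset_ldiv:
  assumes A: "is_sset A"
  shows "is_sset (ldiv A X)"
proof (rule is_ssetI)
  fix m n \<alpha> \<phi> assume "\<alpha> \<in> ord_hom m n" "\<phi> \<in> simp (ldiv A X) n"
  then show "act (ldiv A X) n \<alpha> \<phi> \<in> simp (ldiv A X) m" by (rule ldiv_act_in[OF A])
next
  fix n \<phi> assume p: "\<phi> \<in> simp (ldiv A X) n"
  show "act (ldiv A X) n (ord_id n) \<phi> = \<phi>"
    by (rule ldiv_eqI[OF ldiv_act_in[OF A ord_id_in p] p])
      (simp add: ldiv_act[OF ord_id_in] ord_comp_id_left)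
next
  fix k m n \<alpha> \<beta> \<phi> assume a: "\<alpha> \<in> ord_hom m n" and b: "\<beta> \<in> ord_hom k m" and p: "\<phi> \<in> simp (ldiv A X) n"
  show "act (ldiv A X) n (ord_comp \<alpha> \<beta>) \<phi> = act (ldiv A X) m \<beta> (act (ldiv A X) n \<alpha> \<phi>)"
    by (rule ldiv_eqI[OF ldiv_act_in[OF A ord_comp_in[OF a b] p] ldiv_act_in[OF A b ldiv_act_in[OF A a p]]])
      (simp add: ldiv_act[OF ord_comp_in[OF a b]] ldiv_act[OF b] ldiv_act[OF a] ord_comp_in[OF b] ord_comp_assoc[OF b])
qed

text \<open>A downward closed predicate on vertex sets describes the subcomplex of \<open>\<Delta>\<^sup>n\<close> of all faces that
  satisfy it.\<close>

definition down_closed :: "nat \<Rightarrow> (nat set \<Rightarrow> bool) \<Rightarrow> bool" where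
  "down_closed n P \<longleftrightarrow> (\<forall>V W. V \<subseteq> {..n} \<longrightarrow> P V \<longrightarrow> W \<subseteq> V \<longrightarrow> P W)"

lemma down_closedD: "down_closed n P \<Longrightarrow> V \<subseteq> {..n} \<Longrightarrow> P V \<Longrightarrow> W \<subseteq> V \<Longrightarrow> P W"
  unfolding down_closed_def by blast

lemma is_sset_down_closed: "down_closed n P \<Longrightarrow> is_sset (subsimplex n P)"
  by (rule is_sset_subsimplex) (rule down_closedD)

lemma is_sset_boundary: "is_sset (boundary n)"
  unfolding boundary_def by (rule is_sset_down_closed) (auto simp: down_closed_def)

lemma kanfib_comp:
  assumes p: "kanfib E B p" and q: "kanfib B D q"
  shows "kanfib E D (\<lambda>n x. q n (p n x))"
proof (rule kanfibI[OF smor_comp[OF kanfib_smor[OF p] kanfib_smor[OF q]]])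
  fix n k u d assume n: "1 \<le> n" "k \<le> n" and d: "d \<in> simp D n" and u: "smor (horn n k) E u"
    and eq: "\<And>m \<alpha>. \<alpha> \<in> simp (horn n k) m \<Longrightarrow> q m (p m (u m \<alpha>)) = act D n \<alpha> d"
  obtain b where b: "b \<in> simp B n" "q n b = d" "\<And>m \<alpha>. \<alpha> \<in> simp (horn n k) m \<Longrightarrow> act B n \<alpha> b = p m (u m \<alpha>)"
    using kanfib_lift[OF q n d smor_comp[OF u kanfib_smor[OF p]] eq] by metis
  obtain e where "e \<in> simp E n" "p n e = b" "\<And>m \<alpha>. \<alpha> \<in> simp (horn n k) m \<Longrightarrow> act E n \<alpha> e = u m \<alpha>"
    using kanfib_lift[OF p n b(1) u] b(3) by metis
  then show "\<exists>e\<in>simp E n. q n (p n e) = d \<and> (\<forall>m. \<forall>\<alpha>\<in>simp (horn n k) m. act E n \<alpha> e = u m \<alpha>)"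
    using b(2) by (intro bexI[of _ e]) simp_all
qed

lemma kanfib_cong:
  assumes E: "is_sset E" and p: "kanfib E B p" and eq: "\<And>n x. x \<in> simp E n \<Longrightarrow> p n x = p' n x"
  shows "kanfib E B p'"
proof (rule kanfibI[OF smor_cong[OF E kanfib_smor[OF p] eq]])
  fix n k u b assume n: "1 \<le> n" "k \<le> n" and b: "b \<in> simp B n" and u: "smor (horn n k) E u"
    and e: "\<And>m \<alpha>. \<alpha> \<in> simp (horn n k) m \<Longrightarrow> p' m (u m \<alpha>) = act B n \<alpha> b"
  have "\<And>m \<alpha>. \<alpha> \<in> simp (horn n k) m \<Longrightarrow> p m (u m \<alpha>) = act B n \<alpha> b"
    using e eq[OF smor_in[OF u]] by simp
  from kanfib_lift[OF p n b u this] obtain e where "e \<in> simp E n" "p n e = b"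
    "\<And>m \<alpha>. \<alpha> \<in> simp (horn n k) m \<Longrightarrow> act E n \<alpha> e = u m \<alpha>" by metis
  then show "\<exists>e\<in>simp E n. p' n e = b \<and> (\<forall>m. \<forall>\<alpha>\<in>simp (horn n k) m. act E n \<alpha> e = u m \<alpha>)"
    using eq by (intro bexI[of _ e]) auto
qed

lemma kanfib_id:
  assumes E: "is_sset E"
  shows "kanfib E E (\<lambda>n x. x)"
  by (rule kanfibI[OF smor_id]) auto

lemma lres_smor:
  assumes A: "is_sset A" and B: "is_sset B" and sub: "\<And>k. simp A k \<subseteq> simp B k"
    and ac: "\<And>k n \<alpha> a. a \<in> simp A n \<Longrightarrow> act A n \<alpha> a = act B n \<alpha> a"
  shows "smor (ldiv B X) (ldiv A X) (bres A)"
proof -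
  have AB: "a \<in> simp B k" if "a \<in> simp A k" for a k using sub that by blast
  have r: "bres A i \<psi> \<in> simp (ldiv A X) i" if p: "\<psi> \<in> simp (ldiv B X) i" for i \<psi>
    by (rule ldivI[OF A]) (simp_all add: ldiv_in[OF p AB] ac ldiv_nat[OF p _ _ AB])
  show ?thesis
  proof (rule smorI)
    fix m \<phi> assume "\<phi> \<in> simp (ldiv B X) m"
    then show "bres A m \<phi> \<in> simp (ldiv A X) m" by (rule r)
  next
    fix j m \<beta> \<phi> assume b: "\<beta> \<in> ord_hom j m" and p: "\<phi> \<in> simp (ldiv B X) m"
    show "bres A j (act (ldiv B X) m \<beta> \<phi>) = act (ldiv A X) m \<beta> (bres A m \<phi>)"
    proof (rule ldiv_eqI[OF r[OF ldiv_act_in[OF B b p]] ldiv_act_in[OF A b r[OF p]]])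
      fix k l a \<tau> assume a: "a \<in> simp A k" and t: "\<tau> \<in> ord_hom l j"
      show "bres A j (act (ldiv B X) m \<beta> \<phi>) k l (a, \<tau>) = act (ldiv A X) m \<beta> (bres A m \<phi>) k l (a, \<tau>)"
        using a sub by (simp add: bres_eq[OF a t] ldiv_act[OF b _ t] bres_eq[OF a ord_comp_in[OF b t]] subset_iff)
    qed
  qed
qed

lemma ldiv_restrict_bres:
  "\<sigma> \<in> bisimp X n m \<Longrightarrow> ldiv_restrict X n A m \<sigma> = bres A m (\<lambda>k l (\<alpha>, \<beta>). bact X n m \<alpha> \<beta> \<sigma>)"
  by (simp add: ldiv_restrict_def bres_def)

lemma ldiv_restrict_apply:
  "\<sigma> \<in> bisimp X n m \<Longrightarrow> \<alpha> \<in> simp A k \<Longrightarrow> \<beta> \<in> ord_hom l m \<Longrightarrow>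
    ldiv_restrict X n A m \<sigma> k l (\<alpha>, \<beta>) = bact X n m \<alpha> \<beta> \<sigma>"
  by (simp add: ldiv_restrict_bres bres_eq)

lemma ldiv_restrict_in:
  assumes X: "is_bisset X" and P: "down_closed n P" and s: "\<sigma> \<in> bisimp X n m"
  shows "ldiv_restrict X n (subsimplex n P) m \<sigma> \<in> simp (ldiv (subsimplex n P) X) m"
  unfolding ldiv_restrict_bres[OF s]
  by (rule ldivI[OF is_sset_down_closed[OF P]]) (use bi_act[OF X _ _ s] bi_comp[OF X _ _ _ _ s] in auto)

lemma ldiv_restrict_smor:
  assumes X: "is_bisset X" and P: "down_closed n P"
  shows "smor (column X n) (ldiv (subsimplex n P) X) (ldiv_restrict X n (subsimplex n P))"
proof (rule smorI)
  fix m \<sigma> assume "\<sigma> \<in> simp (column X n) m"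
  then show "ldiv_restrict X n (subsimplex n P) m \<sigma> \<in> simp (ldiv (subsimplex n P) X) m"
    using ldiv_restrict_in[OF X P] by simp
next
  fix j m \<beta> \<sigma> assume b: "\<beta> \<in> ord_hom j m" and "\<sigma> \<in> simp (column X n) m"
  then have s: "\<sigma> \<in> bisimp X n m" by simp
  have s': "bact X n m (ord_id n) \<beta> \<sigma> \<in> bisimp X n j" by (rule bi_act[OF X ord_id_in b s])
  let ?A = "subsimplex n P"
  show "ldiv_restrict X n ?A j (act (column X n) m \<beta> \<sigma>) = act (ldiv ?A X) m \<beta> (ldiv_restrict X n ?A m \<sigma>)"
    unfolding column_simps
  proof (rule ldiv_eqI[OF ldiv_restrict_in[OF X P s'] ldiv_act_in[OF is_sset_down_closed[OF P] b ldiv_restrict_in[OF X P s]]])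
    fix k l a \<tau> assume a: "a \<in> simp ?A k" and t: "\<tau> \<in> ord_hom l j"
    then have a': "a \<in> ord_hom k n" by simp
    show "ldiv_restrict X n ?A j (bact X n m (ord_id n) \<beta> \<sigma>) k l (a, \<tau>) =
      act (ldiv ?A X) m \<beta> (ldiv_restrict X n ?A m \<sigma>) k l (a, \<tau>)"
      unfolding ldiv_restrict_apply[OF s' a t] ldiv_act[OF b a t] ldiv_restrict_apply[OF s a ord_comp_in[OF b t]]
        bi_comp[OF X ord_id_in b a' t s] ord_comp_id_left[OF a'] ..
  qed
qed

text \<open>Deleting a maximal face \<open>F\<close> with \<open>c + 1\<close> vertices is a pushout along \<open>\<partial>\<Delta>\<^sup>c \<rightarrow> \<Delta>\<^sup>c\<close>, so the
  restriction map is a pullback of the matching map of \<open>X\<^sub>c\<close>.\<close>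

lemma restriction_kanfib_face:
  assumes X: "v_fibrant X" and P: "down_closed n P" and F: "F \<subseteq> {..n}" "F \<noteq> {}" "P F"
    and maxF: "\<And>V. V \<subseteq> {..n} \<Longrightarrow> P V \<Longrightarrow> F \<subseteq> V \<Longrightarrow> V = F"
  defines "Q \<equiv> \<lambda>V. P V \<and> V \<noteq> F"
  shows "kanfib (ldiv (subsimplex n P) X) (ldiv (subsimplex n Q) X) (bres (subsimplex n Q))"
proof -
  have X': "is_bisset X" using X by (simp add: v_fibrant_def)
  have finF: "finite F" using F(1) finite_subset by blast
  then obtain c where c: "card F = Suc c" using F(2) by (metis card_gt_0_iff gr0_implies_Suc)
  let ?i = "sorted_list_of_set F"
  have i: "?i \<in> ord_hom c n" using face_in[OF F(1) c] .
  have seti: "set ?i = F" using finF by simp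
  have Q: "down_closed n Q"
    unfolding down_closed_def Q_def using maxF down_closedD[OF P] by metis
  let ?A = "subsimplex n P" and ?B = "subsimplex n Q"
  have A: "is_sset ?A" and B: "is_sset ?B" using is_sset_down_closed P Q by auto
  have res: "smor (ldiv ?A X) (ldiv ?B X) (bres ?B)"
    by (rule lres_smor[OF B A]) (auto simp: Q_def)
  have fib: "kanfib (column X c) (ldiv (boundary c) X) (ldiv_restrict X c (boundary c))"
    using X unfolding v_fibrant_def
    by (intro kan_fibration_kanfib is_sset_column is_sset_ldiv is_sset_boundary) auto
  have surj_iff: "set (ord_comp ?i \<alpha>) = F \<longleftrightarrow> set \<alpha> = {..c}" if a: "\<alpha> \<in> ord_hom l c" for l \<alpha>
  proof
    assume "set \<alpha> = {..c}"
    then have "set (ord_comp ?i \<alpha>) = (!) ?i ` {..c}" by (simp add: ord_comp_set)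
    also have "\<dots> = set ?i" using ord_hom_length[OF i] by (auto simp: set_conv_nth less_Suc_eq_le)
    finally show "set (ord_comp ?i \<alpha>) = F" using seti by simp
  next
    assume s: "set (ord_comp ?i \<alpha>) = F"
    then have "card F \<le> card (set \<alpha>)" unfolding ord_comp_set by (metis card_image_le List.finite_set)
    then show "set \<alpha> = {..c}" using c ord_hom_set[OF a] by (intro card_seteq) auto
  qed
  have subF: "P (set (ord_comp ?i \<alpha>))" if a: "\<alpha> \<in> ord_hom l c" for l \<alpha>
    using down_closedD[OF P F(1,3)] ord_comp_set_subset[OF i a] seti by simp
  show ?thesis
  proof (rule kanfibI[OF res])
    fix m k u b assume mk: "1 \<le> m" "k \<le> m" and b: "b \<in> simp (ldiv ?B X) m" and u: "smor (horn m k) (ldiv ?A X) u"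
      and ub: "\<And>j \<kappa>. \<kappa> \<in> simp (horn m k) j \<Longrightarrow> bres ?B j (u j \<kappa>) = act (ldiv ?B X) m \<kappa> b"
    have iA: "?i \<in> simp ?A c" using i seti F(3) by simp
    have uin: "u j \<kappa> \<in> simp (ldiv ?A X) j" if "\<kappa> \<in> simp (horn m k) j" for j \<kappa> using smor_in[OF u that] .
    have ub': "u j \<kappa> q l (\<alpha>, \<beta>) = b q l (\<alpha>, ord_comp \<kappa> \<beta>)"
      if "\<kappa> \<in> simp (horn m k) j" "\<alpha> \<in> simp ?B q" "\<beta> \<in> ord_hom l j" for j \<kappa> q l \<alpha> \<beta>
    proof -
      have k: "\<kappa> \<in> ord_hom j m" using that(1) by simp
      have "u j \<kappa> q l (\<alpha>, \<beta>) = bres ?B j (u j \<kappa>) q l (\<alpha>, \<beta>)"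
        by (rule bres_eq[OF that(2,3), symmetric])
      also have "\<dots> = b q l (\<alpha>, ord_comp \<kappa> \<beta>)" unfolding ub[OF that(1)] by (rule ldiv_act[OF k that(2,3)])
      finally show ?thesis .
    qed
    define u' where "u' j \<kappa> = u j \<kappa> c j (?i, ord_id j)" for j \<kappa>
    have u': "smor (horn m k) (column X c) u'"
    proof (rule smorI)
      fix j \<kappa> assume "\<kappa> \<in> simp (horn m k) j"
      then show "u' j \<kappa> \<in> simp (column X c) j" using ldiv_in[OF uin iA ord_id_in] by (simp add: u'_def)
    next
      fix j j' \<theta> \<kappa> assume t: "\<theta> \<in> ord_hom j' j" and k: "\<kappa> \<in> simp (horn m k) j"
      have "u' j' (act (horn m k) j \<theta> \<kappa>) = act (ldiv ?A X) j \<theta> (u j \<kappa>) c j' (?i, ord_id j')"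
        using smor_nat[OF u t k] by (simp add: u'_def)
      also have "\<dots> = u j \<kappa> c j' (?i, \<theta>)" using ldiv_act[OF t iA ord_id_in] ord_comp_id_right[OF t] by simp
      also have "\<dots> = bact X c j (ord_id c) \<theta> (u' j \<kappa>)"
        using ldiv_nat[OF uin[OF k] ord_id_in t iA ord_id_in] ord_comp_id_right[OF i] ord_comp_id_left[OF t]
        by (simp add: u'_def)
      finally show "u' j' (act (horn m k) j \<theta> \<kappa>) = act (column X c) j \<theta> (u' j \<kappa>)" by simp
    qed
    have u'_act: "bact X c j \<alpha> \<beta> (u' j \<kappa>) = u j \<kappa> q l (ord_comp ?i \<alpha>, \<beta>)"
      if "\<kappa> \<in> simp (horn m k) j" "\<alpha> \<in> ord_hom q c" "\<beta> \<in> ord_hom l j" for j \<kappa> q l \<alpha> \<beta>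
      using ldiv_nat[OF uin[OF that(1)] that(2,3) iA ord_id_in] ord_comp_id_left[OF that(3)] by (simp add: u'_def)
    define b' where "b' = bres (boundary c) m (\<lambda>q l (\<alpha>, \<beta>). b q l (ord_comp ?i \<alpha>, \<beta>))"
    have iB: "ord_comp ?i \<alpha> \<in> simp ?B q" if "\<alpha> \<in> simp (boundary c) q" for q \<alpha>
      using that surj_iff[of \<alpha> q] subF[of \<alpha> q] ord_comp_in[OF i, of \<alpha> q] by (simp add: Q_def)
    have b': "b' \<in> simp (ldiv (boundary c) X) m"
      unfolding b'_def
    proof (rule ldivI[OF is_sset_boundary])
      fix q l \<alpha> \<beta> assume "\<alpha> \<in> simp (boundary c) q" "\<beta> \<in> ord_hom l m"
      then show "(case (\<alpha>, \<beta>) of (\<alpha>, \<beta>) \<Rightarrow> b q l (ord_comp ?i \<alpha>, \<beta>)) \<in> bisimp X q l"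
        using ldiv_in[OF b iB] by simp
    next
      fix q l p j \<theta> \<zeta> \<alpha> \<beta> assume t: "\<theta> \<in> ord_hom q p" "\<zeta> \<in> ord_hom l j" "\<alpha> \<in> simp (boundary c) p" "\<beta> \<in> ord_hom j m"
      have "\<alpha> \<in> ord_hom p c" using t(3) by simp
      then show "(case (act (boundary c) p \<theta> \<alpha>, ord_comp \<beta> \<zeta>) of (\<alpha>, \<beta>) \<Rightarrow> b q l (ord_comp ?i \<alpha>, \<beta>)) =
        bact X p j \<theta> \<zeta> (case (\<alpha>, \<beta>) of (\<alpha>, \<beta>) \<Rightarrow> b p j (ord_comp ?i \<alpha>, \<beta>))"
        using ldiv_nat[OF b t(1,2) iB[OF t(3)] t(4)] ord_comp_assoc[OF _ t(1), of \<alpha> c ?i] by simp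
    qed
    have u'b': "ldiv_restrict X c (boundary c) j (u' j \<kappa>) = act (ldiv (boundary c) X) m \<kappa> b'"
      if k: "\<kappa> \<in> simp (horn m k) j" for j \<kappa>
    proof (rule ldiv_eqI)
      have k': "\<kappa> \<in> ord_hom j m" using k by simp
      have uj: "u' j \<kappa> \<in> simp (column X c) j" using smor_in[OF u' k] .
      show "ldiv_restrict X c (boundary c) j (u' j \<kappa>) \<in> simp (ldiv (boundary c) X) j"
        using smor_in[OF kanfib_smor[OF fib] uj] .
      show "act (ldiv (boundary c) X) m \<kappa> b' \<in> simp (ldiv (boundary c) X) j"
        using ldiv_act_in[OF is_sset_boundary k' b'] .
      fix q l \<alpha> \<beta> assume a: "\<alpha> \<in> simp (boundary c) q" and t: "\<beta> \<in> ord_hom l j"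
      have a': "\<alpha> \<in> ord_hom q c" using a by simp
      have uj': "u' j \<kappa> \<in> bisimp X c j" using uj by simp
      have "ldiv_restrict X c (boundary c) j (u' j \<kappa>) q l (\<alpha>, \<beta>) = u j \<kappa> q l (ord_comp ?i \<alpha>, \<beta>)"
        unfolding ldiv_restrict_apply[OF uj' a t] by (rule u'_act[OF k a' t])
      also have "\<dots> = b q l (ord_comp ?i \<alpha>, ord_comp \<kappa> \<beta>)" by (rule ub'[OF k iB[OF a] t])
      also have "\<dots> = act (ldiv (boundary c) X) m \<kappa> b' q l (\<alpha>, \<beta>)"
        unfolding ldiv_act[OF k' a t] b'_def bres_eq[OF a ord_comp_in[OF k' t]] by simp
      finally show "ldiv_restrict X c (boundary c) j (u' j \<kappa>) q l (\<alpha>, \<beta>) = act (ldiv (boundary c) X) m \<kappa> b' q l (\<alpha>, \<beta>)" .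
    qed
    obtain x where x: "x \<in> simp (column X c) m" "ldiv_restrict X c (boundary c) m x = b'"
      "\<And>j \<kappa>. \<kappa> \<in> simp (horn m k) j \<Longrightarrow> act (column X c) m \<kappa> x = u' j \<kappa>"
      using kanfib_lift[OF fib mk b' u' u'b'] by metis
    have x1: "x \<in> bisimp X c m" using x(1) by simp
    define e where "e q l z = (if set (fst z) = F
      then bact X c m (THE \<alpha>. \<alpha> \<in> ord_hom q c \<and> fst z = ord_comp ?i \<alpha>) (snd z) x else b q l z)" for q l z
    have e_new: "e q l (ord_comp ?i \<alpha>, \<beta>) = bact X c m \<alpha> \<beta> x"
      if a: "\<alpha> \<in> ord_hom q c" and t: "\<beta> \<in> ord_hom l m" for q l \<alpha> \<beta>
    proof (cases "set (ord_comp ?i \<alpha>) = F")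
      case True
      have "(THE \<alpha>'. \<alpha>' \<in> ord_hom q c \<and> ord_comp ?i \<alpha> = ord_comp ?i \<alpha>') = \<alpha>"
        using a face_mono[OF F(1) c] by (intro the_equality) auto
      then show ?thesis using True by (simp add: e_def)
    next
      case False
      then have ab: "\<alpha> \<in> simp (boundary c) q" using surj_iff[OF a] a by simp
      have "bact X c m \<alpha> \<beta> x = b' q l (\<alpha>, \<beta>)" using ldiv_restrict_apply[OF x1 ab t] x(2) by simp
      then show ?thesis using False by (simp add: e_def b'_def bres_eq[OF ab t])
    qed
    have cases: "a \<in> simp ?B q \<or> (\<exists>\<alpha>\<in>ord_hom q c. a = ord_comp ?i \<alpha>)" if a: "a \<in> simp ?A q" for q a
    proof (cases "set a = F")
      case True
      then show ?thesis using face_factor[OF F(1) c, of a q] a by auto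
    qed (use a in \<open>simp add: Q_def\<close>)
    have e_old: "e q l (a, \<beta>) = b q l (a, \<beta>)" if "a \<in> simp ?B q" for q l a \<beta>
      using that by (simp add: e_def Q_def)
    let ?e = "bres ?A m e"
    have e: "?e \<in> simp (ldiv ?A X) m"
    proof (rule ldivI[OF A])
      fix q l a \<tau> assume a: "a \<in> simp ?A q" and t: "\<tau> \<in> ord_hom l m"
      from cases[OF a] show "e q l (a, \<tau>) \<in> bisimp X q l"
        using e_old ldiv_in[OF b _ t] e_new[OF _ t] bi_act[OF X' _ t x1] by auto
    next
      fix q l p j \<theta> \<zeta> a \<tau> assume t: "\<theta> \<in> ord_hom q p" "\<zeta> \<in> ord_hom l j" and a: "a \<in> simp ?A p" and s: "\<tau> \<in> ord_hom j m"
      from cases[OF a] show "e q l (act ?A p \<theta> a, ord_comp \<tau> \<zeta>) = bact X p j \<theta> \<zeta> (e p j (a, \<tau>))"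
      proof
        assume aB: "a \<in> simp ?B p"
        have "act ?B p \<theta> a \<in> simp ?B q" using sset_act[OF B t(1) aB] .
        then show ?thesis using e_old[of "act ?B p \<theta> a" q] e_old[OF aB] ldiv_nat[OF b t aB s] by simp
      next
        assume "\<exists>\<alpha>\<in>ord_hom p c. a = ord_comp ?i \<alpha>"
        then obtain \<alpha> where al: "\<alpha> \<in> ord_hom p c" "a = ord_comp ?i \<alpha>" by blast
        show ?thesis
          using e_new[OF ord_comp_in[OF al(1) t(1)] ord_comp_in[OF s t(2)]] e_new[OF al(1) s] al(2)
            bi_comp[OF X' al(1) s t x1] ord_comp_assoc[OF al(1) t(1), of ?i] by simp
      qed
    qed
    show "\<exists>e\<in>simp (ldiv ?A X) m. bres ?B m e = b \<and>
        (\<forall>j. \<forall>\<kappa>\<in>simp (horn m k) j. act (ldiv ?A X) m \<kappa> e = u j \<kappa>)"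
    proof (intro bexI[OF _ e] conjI allI ballI)
      show "bres ?B m ?e = b"
      proof (rule ldiv_eqI[OF smor_in[OF res e] b])
        fix q l a \<tau> assume a: "a \<in> simp ?B q" and t: "\<tau> \<in> ord_hom l m"
        have aA: "a \<in> simp ?A q" using a by (simp add: Q_def)
        show "bres ?B m ?e q l (a, \<tau>) = b q l (a, \<tau>)"
          unfolding bres_eq[OF a t] bres_eq[OF aA t] by (rule e_old[OF a])
      qed
      fix j \<kappa> assume k: "\<kappa> \<in> simp (horn m k) j"
      then have k': "\<kappa> \<in> ord_hom j m" by simp
      show "act (ldiv ?A X) m \<kappa> ?e = u j \<kappa>"
      proof (rule ldiv_eqI[OF ldiv_act_in[OF A k' e] uin[OF k]])
        fix q l a \<tau> assume a: "a \<in> simp ?A q" and t: "\<tau> \<in> ord_hom l j"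
        have kt: "ord_comp \<kappa> \<tau> \<in> ord_hom l m" using ord_comp_in[OF k' t] .
        have "e q l (a, ord_comp \<kappa> \<tau>) = u j \<kappa> q l (a, \<tau>)"
          using cases[OF a]
        proof
          assume aB: "a \<in> simp ?B q"
          then show ?thesis using e_old[OF aB] ub'[OF k aB t] by simp
        next
          assume "\<exists>\<alpha>\<in>ord_hom q c. a = ord_comp ?i \<alpha>"
          then obtain \<alpha> where al: "\<alpha> \<in> ord_hom q c" "a = ord_comp ?i \<alpha>" by blast
          have "bact X c m \<alpha> (ord_comp \<kappa> \<tau>) x = bact X c j \<alpha> \<tau> (bact X c m (ord_id c) \<kappa> x)"
            using bi_comp[OF X' ord_id_in k' al(1) t x1] ord_comp_id_left[OF al(1)] by simp
          also have "\<dots> = u j \<kappa> q l (ord_comp ?i \<alpha>, \<tau>)"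
            using x(3)[OF k] u'_act[OF k al(1) t] by simp
          finally show ?thesis using e_new[OF al(1) kt] al(2) by simp
        qed
        then show "act (ldiv ?A X) m \<kappa> ?e q l (a, \<tau>) = u j \<kappa> q l (a, \<tau>)"
          unfolding ldiv_act[OF k' a t] bres_eq[OF a kt] .
      qed
    qed
  qed
qed

text \<open>The faces that are in \<open>P\<close> but not in \<open>Q\<close> are removed one at a time, the maximal ones first.\<close>

theorem restriction_kanfib:
  assumes X: "v_fibrant X"
  shows "down_closed n P \<Longrightarrow> down_closed n Q \<Longrightarrow> (\<And>V. Q V \<Longrightarrow> P V) \<Longrightarrow>
    kanfib (ldiv (subsimplex n P) X) (ldiv (subsimplex n Q) X) (bres (subsimplex n Q))"
proof (induction "card {V. V \<subseteq> {..n} \<and> V \<noteq> {} \<and> P V \<and> \<not> Q V}" arbitrary: P rule: less_induct)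
  case (less P)
  let ?D = "{V. V \<subseteq> {..n} \<and> V \<noteq> {} \<and> P V \<and> \<not> Q V}"
  have fin: "finite ?D" by (rule finite_subset[of _ "Pow {..n}"]) auto
  have A: "is_sset (subsimplex n R)" if "down_closed n R" for R using is_sset_down_closed that .
  show ?case
  proof (cases "?D = {}")
    case True
    have "P (set \<alpha>) \<longleftrightarrow> Q (set \<alpha>)" if "\<alpha> \<in> ord_hom m n" for m \<alpha>
      using True less.prems(3) ord_hom_set[OF that] ord_hom_nonempty[OF that] by blast
    then have eq: "subsimplex n P = subsimplex n Q" unfolding subsimplex_def by (auto intro!: ext)
    have "kanfib (ldiv (subsimplex n Q) X) (ldiv (subsimplex n Q) X) (bres (subsimplex n Q))"
    proof (rule kanfib_cong[OF is_sset_ldiv[OF A[OF less.prems(2)]] kanfib_id[OF is_sset_ldiv[OF A[OF less.prems(2)]]]])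
      fix m \<phi> assume p: "\<phi> \<in> simp (ldiv (subsimplex n Q) X) m"
      have s: "smor (ldiv (subsimplex n Q) X) (ldiv (subsimplex n Q) X) (bres (subsimplex n Q))"
        by (rule lres_smor[OF A[OF less.prems(2)] A[OF less.prems(2)]]) auto
      show "\<phi> = bres (subsimplex n Q) m \<phi>"
        by (rule ldiv_eqI[OF p smor_in[OF s p]]) (simp add: bres_def)
    qed
    then show ?thesis unfolding eq .
  next
    case False
    from finite_has_maximal[OF fin False] obtain F where F: "F \<in> ?D" and F_max: "\<forall>V\<in>?D. F \<subseteq> V \<longrightarrow> F = V" ..
    have maxF: "V = F" if "V \<subseteq> {..n}" "P V" "F \<subseteq> V" for V
    proof -
      have "\<not> Q V" using down_closedD[OF less.prems(2) that(1) _ that(3)] F by blast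
      then have "V \<in> ?D" using that F by blast
      then show ?thesis using F_max that(3) by blast
    qed
    let ?R = "\<lambda>V. P V \<and> V \<noteq> F"
    have R: "down_closed n ?R"
      unfolding down_closed_def using maxF down_closedD[OF less.prems(1)] by metis
    have "{V. V \<subseteq> {..n} \<and> V \<noteq> {} \<and> ?R V \<and> \<not> Q V} \<subset> ?D" using F(1) by blast
    then have "card {V. V \<subseteq> {..n} \<and> V \<noteq> {} \<and> ?R V \<and> \<not> Q V} < card ?D" by (rule psubset_card_mono[OF fin])
    moreover have "?R V" if "Q V" for V using that less.prems(3) F(1) by blast
    ultimately have 1: "kanfib (ldiv (subsimplex n ?R) X) (ldiv (subsimplex n Q) X) (bres (subsimplex n Q))"
      by (intro less.hyps R less.prems(2))
    have 2: "kanfib (ldiv (subsimplex n P) X) (ldiv (subsimplex n ?R) X) (bres (subsimplex n ?R))"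
      using F(1) maxF by (intro restriction_kanfib_face[OF X less.prems(1)]) auto
    show ?thesis
    proof (rule kanfib_cong[OF is_sset_ldiv[OF A[OF less.prems(1)]] kanfib_comp[OF 2 1]])
      fix m \<phi>
      have "simp (subsimplex n Q) k \<subseteq> simp (subsimplex n ?R) k" for k
        using \<open>\<And>V. Q V \<Longrightarrow> ?R V\<close> by auto
      then show "bres (subsimplex n Q) m (bres (subsimplex n ?R) m \<phi>) = bres (subsimplex n Q) m \<phi>"
        unfolding bres_def by (intro ext) (auto simp: restrict_def)
    qed
  qed
qed

text \<open>By the Yoneda isomorphism \<open>\<Delta>\<^sup>n \ X \<cong> X\<^sub>n\<close> this is the restriction from the full simplex.\<close>

theorem column_restriction_kanfib:
  assumes X: "v_fibrant X" and Q: "down_closed n Q"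
  shows "kanfib (column X n) (ldiv (subsimplex n Q) X) (ldiv_restrict X n (subsimplex n Q))"
proof -
  have X': "is_bisset X" using X by (simp add: v_fibrant_def)
  let ?T = "subsimplex n (\<lambda>_. True)" and ?Q = "subsimplex n Q"
  have T: "down_closed n (\<lambda>_. True)" by (simp add: down_closed_def)
  have fib: "kanfib (ldiv ?T X) (ldiv ?Q X) (bres ?Q)"
    by (rule restriction_kanfib[OF X T Q]) simp
  have i: "smor (column X n) (ldiv ?T X) (ldiv_restrict X n ?T)" by (rule ldiv_restrict_smor[OF X' T])
  have idT: "ord_id n \<in> simp ?T n" by (simp add: ord_id_in)
  have sub: "bres ?Q m (ldiv_restrict X n ?T m \<sigma>) = ldiv_restrict X n ?Q m \<sigma>" if "\<sigma> \<in> bisimp X n m" for m \<sigma>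
    unfolding ldiv_restrict_bres[OF that] bres_def by (intro ext) (auto simp: restrict_def)
  show ?thesis
  proof (rule kanfibI[OF ldiv_restrict_smor[OF X' Q]])
    fix m k u b assume mk: "1 \<le> m" "k \<le> m" and b: "b \<in> simp (ldiv ?Q X) m" and u: "smor (horn m k) (column X n) u"
      and ub: "\<And>j \<kappa>. \<kappa> \<in> simp (horn m k) j \<Longrightarrow> ldiv_restrict X n ?Q j (u j \<kappa>) = act (ldiv ?Q X) m \<kappa> b"
    have ub': "bres ?Q j (ldiv_restrict X n ?T j (u j \<kappa>)) = act (ldiv ?Q X) m \<kappa> b"
      if "\<kappa> \<in> simp (horn m k) j" for j \<kappa> using ub[OF that] sub smor_in[OF u that] by simp
    obtain \<phi> where p: "\<phi> \<in> simp (ldiv ?T X) m" "bres ?Q m \<phi> = b"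
      "\<And>j \<kappa>. \<kappa> \<in> simp (horn m k) j \<Longrightarrow> act (ldiv ?T X) m \<kappa> \<phi> = ldiv_restrict X n ?T j (u j \<kappa>)"
      using kanfib_lift[where p="bres ?Q" and u="\<lambda>j \<kappa>. ldiv_restrict X n ?T j (u j \<kappa>)", OF fib mk b smor_comp[OF u i] ub'] by metis
    define e where "e = \<phi> n m (ord_id n, ord_id m)"
    have e: "e \<in> bisimp X n m" using ldiv_in[OF p(1) idT ord_id_in] by (simp add: e_def)
    have e_act: "bact X n m \<alpha> \<beta> e = \<phi> k l (\<alpha>, \<beta>)" if "\<alpha> \<in> ord_hom k n" "\<beta> \<in> ord_hom l m" for k l \<alpha> \<beta>
      using ldiv_nat[OF p(1) that idT ord_id_in] ord_comp_id_left[OF that(1)] ord_comp_id_left[OF that(2)] by (simp add: e_def)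
    have ie: "ldiv_restrict X n ?T m e = \<phi>"
      by (rule ldiv_eqI[OF ldiv_restrict_in[OF X' T e] p(1)]) (simp add: ldiv_restrict_apply[OF e] e_act)
    show "\<exists>e\<in>simp (column X n) m. ldiv_restrict X n ?Q m e = b \<and>
       (\<forall>j. \<forall>\<kappa>\<in>simp (horn m k) j. act (column X n) m \<kappa> e = u j \<kappa>)"
    proof (intro bexI conjI allI ballI)
      show "e \<in> simp (column X n) m" using e by simp
      show "ldiv_restrict X n ?Q m e = b" using sub[OF e] ie p(2) by simp
      fix j \<kappa> assume k: "\<kappa> \<in> simp (horn m k) j"
      then have k': "\<kappa> \<in> ord_hom j m" by simp
      have uk: "u j \<kappa> \<in> bisimp X n j" using smor_in[OF u k] by simp
      have "bact X n m (ord_id n) \<kappa> e = \<phi> n j (ord_id n, \<kappa>)" by (rule e_act[OF ord_id_in k'])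
      also have "\<dots> = act (ldiv ?T X) m \<kappa> \<phi> n j (ord_id n, ord_id j)"
        by (simp only: ldiv_act[OF k' idT ord_id_in] ord_comp_id_right[OF k'])
      also have "\<dots> = u j \<kappa>"
        unfolding p(3)[OF k] using ldiv_restrict_apply[OF uk idT ord_id_in] bi_id[OF X' uk] by simp
      finally show "act (column X n) m \<kappa> e = u j \<kappa>" by simp
    qed
  qed
qed

text \<open>The empty subcomplex makes \<open>\<emptyset> \ X\<close> a terminal simplicial set.\<close>

lemma kan_complex_over_empty:
  assumes E: "is_sset E" and p: "kanfib E (ldiv (subsimplex n (\<lambda>_. False)) X) p"
  shows "kan_complex E"
proof (rule kan_complexI[OF E])
  fix m k u assume mk: "1 \<le> m" "k \<le> m" and u: "smor (horn m k) E u"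
  let ?A = "subsimplex n (\<lambda>_. False)"
  have A: "is_sset ?A" by (rule is_sset_down_closed) (simp add: down_closed_def)
  have b: "bres ?A m undefined \<in> simp (ldiv ?A X) m" by (rule ldivI[OF A]) auto
  have "p j (u j \<kappa>) = act (ldiv ?A X) m \<kappa> (bres ?A m undefined)" if "\<kappa> \<in> simp (horn m k) j" for j \<kappa>
  proof (rule ldiv_eqI)
    show "p j (u j \<kappa>) \<in> simp (ldiv ?A X) j" using smor_in[OF kanfib_smor[OF p] smor_in[OF u that]] .
    show "act (ldiv ?A X) m \<kappa> (bres ?A m undefined) \<in> simp (ldiv ?A X) j"
      using that by (intro ldiv_act_in[OF A _ b]) simp
  qed simp
  from kanfib_lift[OF p mk b u this] show "\<exists>e\<in>simp E m. \<forall>j. \<forall>\<alpha>\<in>simp (horn m k) j. act E m \<alpha> e = u j \<alpha>"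
    by metis
qed

lemma kan_complex_ldiv:
  assumes X: "v_fibrant X" and P: "down_closed n P"
  shows "kan_complex (ldiv (subsimplex n P) X)"
  by (rule kan_complex_over_empty[OF is_sset_ldiv[OF is_sset_down_closed[OF P]]
      restriction_kanfib[OF X P]]) (simp_all add: down_closed_def)

lemma kan_complex_column:
  assumes X: "v_fibrant X"
  shows "kan_complex (column X n)"
proof -
  have "is_bisset X" using X by (simp add: v_fibrant_def)
  then show ?thesis
    by (intro kan_complex_over_empty[OF is_sset_column column_restriction_kanfib[OF X]]) (simp_all add: down_closed_def)
qed

section \<open>Maps out of graphs\<close>

text \<open>The horizontal operator \<open>\<alpha>\<^sup>*\<close>; in particular \<open>hop X n [i, j]\<close> is the edge from the vertex \<open>i\<close> to the vertex \<open>j\<close>.\<close>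

definition hop :: "'a bisset \<Rightarrow> nat \<Rightarrow> nat list \<Rightarrow> nat \<Rightarrow> 'a \<Rightarrow> 'a" where
  "hop X n \<alpha> m x = bact X n m \<alpha> (ord_id m) x"

lemma hop_in: "is_bisset X \<Longrightarrow> \<alpha> \<in> ord_hom k n \<Longrightarrow> x \<in> bisimp X n m \<Longrightarrow> hop X n \<alpha> m x \<in> bisimp X k m"
  unfolding hop_def by (rule bi_act[OF _ _ ord_id_in])

lemma hop_hop: "is_bisset X \<Longrightarrow> \<alpha> \<in> ord_hom k n \<Longrightarrow> \<beta> \<in> ord_hom l k \<Longrightarrow> x \<in> bisimp X n m \<Longrightarrow>
    hop X k \<beta> m (hop X n \<alpha> m x) = hop X n (ord_comp \<alpha> \<beta>) m x"
  unfolding hop_def by (simp add: bi_comp[OF _ _ ord_id_in _ ord_id_in] ord_comp_id_left[OF ord_id_in])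

lemma hop_id: "is_bisset X \<Longrightarrow> x \<in> bisimp X n m \<Longrightarrow> hop X n (ord_id n) m x = x"
  unfolding hop_def by (rule bi_id)

lemma hop_vert: "is_bisset X \<Longrightarrow> \<alpha> \<in> ord_hom k n \<Longrightarrow> \<gamma> \<in> ord_hom l k \<Longrightarrow> \<beta> \<in> ord_hom j m \<Longrightarrow> x \<in> bisimp X n m \<Longrightarrow>
    bact X k m \<gamma> \<beta> (hop X n \<alpha> m x) = bact X n m (ord_comp \<alpha> \<gamma>) \<beta> x"
  unfolding hop_def by (simp add: bi_comp[OF _ _ ord_id_in] ord_comp_id_left)

lemma hop_bact: "is_bisset X \<Longrightarrow> \<alpha> \<in> ord_hom k n \<Longrightarrow> \<gamma> \<in> ord_hom l k \<Longrightarrow> \<beta> \<in> ord_hom j m \<Longrightarrow> x \<in> bisimp X n m \<Longrightarrow>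
    hop X k \<gamma> j (bact X n m \<alpha> \<beta> x) = bact X n m (ord_comp \<alpha> \<gamma>) \<beta> x"
  unfolding hop_def by (simp add: bi_comp[OF _ _ _ _ ord_id_in] ord_comp_id_right)

lemma hop_smor:
  assumes X: "is_bisset X" and a: "\<alpha> \<in> ord_hom k n"
  shows "smor (column X n) (column X k) (hop X n \<alpha>)"
proof (rule smorI)
  fix m x assume "x \<in> simp (column X n) m"
  then show "hop X n \<alpha> m x \<in> simp (column X k) m" using hop_in[OF X a] by simp
next
  fix j m \<beta> x assume b: "\<beta> \<in> ord_hom j m" and "x \<in> simp (column X n) m"
  then have x: "x \<in> bisimp X n m" by simp
  show "hop X n \<alpha> j (act (column X n) m \<beta> x) = act (column X k) m \<beta> (hop X n \<alpha> m x)"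
    unfolding column_simps hop_bact[OF X ord_id_in a b x] hop_vert[OF X a ord_id_in b x]
      ord_comp_id_left[OF a] ord_comp_id_right[OF a] ..
qed

text \<open>A family of vertices and edges indexed by a subgraph \<open>P\<close> of \<open>\<Delta>\<^sup>n\<close> extends to a map on the
  subcomplex \<open>P\<close>, since its simplices are degeneracies of vertices and edges.\<close>

definition gmap :: "'a bisset \<Rightarrow> nat \<Rightarrow> (nat set \<Rightarrow> bool) \<Rightarrow> nat \<Rightarrow> (nat \<Rightarrow> 'a) \<Rightarrow> (nat \<Rightarrow> nat \<Rightarrow> 'a) \<Rightarrow>
    nat \<Rightarrow> nat \<Rightarrow> nat list \<times> nat list \<Rightarrow> 'a" where
  "gmap X n P m V F = bres (subsimplex n P) m (\<lambda>k l (\<alpha>, \<beta>).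
     if \<alpha> ! 0 = \<alpha> ! k then bact X 0 m (ord_const k 0) \<beta> (V (\<alpha> ! 0))
     else bact X 1 m (map (\<lambda>v. if v = \<alpha> ! 0 then 0 else 1) \<alpha>) \<beta> (F (\<alpha> ! 0) (\<alpha> ! k)))"

definition graph :: "nat \<Rightarrow> (nat set \<Rightarrow> bool) \<Rightarrow> bool" where
  "graph n P \<longleftrightarrow> down_closed n P \<and> (\<forall>V. P V \<longrightarrow> (\<exists>i j. V \<subseteq> {i, j}))"

lemma graph_down: "graph n P \<Longrightarrow> down_closed n P"
  by (simp add: graph_def)

lemma ord_hom_const:
  assumes "\<alpha> \<in> ord_hom k n" "\<alpha> ! 0 = \<alpha> ! k"
  shows "\<alpha> = ord_const k (\<alpha> ! 0)"
proof (rule nth_equalityI)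
  fix i assume "i < length \<alpha>"
  then have i: "i \<le> k" using ord_hom_length[OF assms(1)] by simp
  show "\<alpha> ! i = ord_const k (\<alpha> ! 0) ! i"
    using ord_hom_mono[OF assms(1), of 0 i] ord_hom_mono[OF assms(1) i] assms(2) i by simp
qed (simp add: ord_hom_length[OF assms(1)])

lemma graph_simplex:
  assumes g: "graph n P" and a: "\<alpha> \<in> ord_hom k n" and P: "P (set \<alpha>)" and ne: "\<alpha> ! 0 \<noteq> \<alpha> ! k"
  shows "\<alpha> ! 0 < \<alpha> ! k" "\<alpha> ! k \<le> n" "P {\<alpha> ! 0, \<alpha> ! k}" "i \<le> k \<Longrightarrow> \<alpha> ! i = \<alpha> ! 0 \<or> \<alpha> ! i = \<alpha> ! k"
    "map (\<lambda>v. if v = \<alpha> ! 0 then 0 else 1) \<alpha> \<in> ord_hom k 1"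
    "ord_comp [\<alpha> ! 0, \<alpha> ! k] (map (\<lambda>v. if v = \<alpha> ! 0 then 0 else 1) \<alpha>) = \<alpha>"
proof -
  have len: "length \<alpha> = Suc k" using ord_hom_length[OF a] .
  have mem: "\<alpha> ! i \<in> set \<alpha>" if "i \<le> k" for i using that len by simp
  show lt: "\<alpha> ! 0 < \<alpha> ! k" using ord_hom_mono[OF a, of 0 k] ne by simp
  show "\<alpha> ! k \<le> n" using ord_hom_nth_le[OF a] by simp
  show "P {\<alpha> ! 0, \<alpha> ! k}"
    using down_closedD[OF graph_down[OF g] ord_hom_set[OF a] P] mem by simp
  obtain i0 j0 where "set \<alpha> \<subseteq> {i0, j0}" using g P unfolding graph_def by blast
  then show two: "\<alpha> ! i = \<alpha> ! 0 \<or> \<alpha> ! i = \<alpha> ! k" if "i \<le> k" for i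
    using mem[OF that] mem[of 0] mem[of k] ne by auto
  let ?c = "map (\<lambda>v. if v = \<alpha> ! 0 then 0 else 1 :: nat) \<alpha>"
  have c: "?c = map (\<lambda>i. if \<alpha> ! i = \<alpha> ! 0 then 0 else 1) [0..<Suc k]"
    using len by (intro nth_equalityI) auto
  show "?c \<in> ord_hom k 1"
    unfolding c
  proof (rule ord_hom_mapI)
    fix i j assume ij: "i \<le> j" "j \<le> k"
    show "(if \<alpha> ! i = \<alpha> ! 0 then 0 else 1::nat) \<le> (if \<alpha> ! j = \<alpha> ! 0 then 0 else 1)"
      using ord_hom_mono[OF a ij] ord_hom_mono[OF a, of 0 i] ij by auto
  qed simp
  show "ord_comp [\<alpha> ! 0, \<alpha> ! k] ?c = \<alpha>"
  proof (rule nth_equalityI)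
    fix i assume "i < length (ord_comp [\<alpha> ! 0, \<alpha> ! k] ?c)"
    then have "i \<le> k" "i < length \<alpha>" using len by (simp_all add: ord_comp_def)
    then show "ord_comp [\<alpha> ! 0, \<alpha> ! k] ?c ! i = \<alpha> ! i" using two[of i] by (auto simp: ord_comp_def)
  qed (simp add: ord_comp_def)
qed

lemma pair_in: "i \<le> j \<Longrightarrow> j \<le> n \<Longrightarrow> [i, j] \<in> ord_hom 1 n"
  by (simp add: ord_hom_def)

lemma single_in: "i \<le> n \<Longrightarrow> [i] \<in> ord_hom 0 n"
  by (simp add: ord_hom_def)

lemma ord_id_1: "ord_id 1 = [0, 1]" by (simp add: ord_id_def upt_rec)
lemma ord_id_0: "ord_id 0 = [0]" by (simp add: ord_id_def upt_rec)

text \<open>Compatible families of vertices and edges of \<open>X\<close>, parametrised by a simplicial set \<open>K\<close>; \<open>F i j\<close> is the edge from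
  the vertex \<open>i\<close> to the vertex \<open>j\<close>.\<close>

locale graph_family =
  fixes X :: "'a bisset" and n :: nat and P :: "nat set \<Rightarrow> bool" and K :: "'k sset"
    and V :: "nat \<Rightarrow> nat \<Rightarrow> 'k \<Rightarrow> 'a" and F :: "nat \<Rightarrow> nat \<Rightarrow> nat \<Rightarrow> 'k \<Rightarrow> 'a"
  assumes X: "is_bisset X" and P: "graph n P" and K: "is_sset K"
    and V: "\<And>i. i \<le> n \<Longrightarrow> smor K (column X 0) (V i)"
    and F: "\<And>i j. i < j \<Longrightarrow> j \<le> n \<Longrightarrow> P {i, j} \<Longrightarrow> smor K (column X 1) (F i j)"
    and F0: "\<And>i j m x. i < j \<Longrightarrow> j \<le> n \<Longrightarrow> P {i, j} \<Longrightarrow> x \<in> simp K m \<Longrightarrow> hop X 1 [0] m (F i j m x) = V i m x"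
    and F1: "\<And>i j m x. i < j \<Longrightarrow> j \<le> n \<Longrightarrow> P {i, j} \<Longrightarrow> x \<in> simp K m \<Longrightarrow> hop X 1 [1] m (F i j m x) = V j m x"
begin

definition fam :: "nat \<Rightarrow> 'k \<Rightarrow> nat \<Rightarrow> nat \<Rightarrow> nat list \<times> nat list \<Rightarrow> 'a" where
  "fam m x = gmap X n P m (\<lambda>i. V i m x) (\<lambda>i j. F i j m x)"

lemma fam_vertex:
  assumes "\<alpha> \<in> ord_hom k n" "P (set \<alpha>)" "\<beta> \<in> ord_hom l m" "\<alpha> ! 0 = \<alpha> ! k"
  shows "fam m x k l (\<alpha>, \<beta>) = bact X 0 m (ord_const k 0) \<beta> (V (\<alpha> ! 0) m x)"
  unfolding fam_def gmap_def using assms by (subst bres_eq) auto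

lemma fam_edge:
  assumes "\<alpha> \<in> ord_hom k n" "P (set \<alpha>)" "\<beta> \<in> ord_hom l m" "\<alpha> ! 0 \<noteq> \<alpha> ! k"
  shows "fam m x k l (\<alpha>, \<beta>) =
    bact X 1 m (map (\<lambda>v. if v = \<alpha> ! 0 then 0 else 1) \<alpha>) \<beta> (F (\<alpha> ! 0) (\<alpha> ! k) m x)"
  unfolding fam_def gmap_def using assms by (subst bres_eq) auto

lemma V_in: "i \<le> n \<Longrightarrow> x \<in> simp K m \<Longrightarrow> V i m x \<in> bisimp X 0 m"
  using smor_in[OF V] by simp

lemma F_in: "i < j \<Longrightarrow> j \<le> n \<Longrightarrow> P {i, j} \<Longrightarrow> x \<in> simp K m \<Longrightarrow> F i j m x \<in> bisimp X 1 m"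
  using smor_in[OF F] by simp

lemma fam_in:
  assumes x: "x \<in> simp K m"
  shows "fam m x \<in> simp (ldiv (subsimplex n P) X) m"
proof -
  have "bres (subsimplex n P) m (fam m x) \<in> simp (ldiv (subsimplex n P) X) m"
  proof (rule ldivI[OF is_sset_down_closed[OF graph_down[OF P]]])
    fix k l \<alpha> \<tau> assume "\<alpha> \<in> simp (subsimplex n P) k" and t: "\<tau> \<in> ord_hom l m"
    then have a: "\<alpha> \<in> ord_hom k n" "P (set \<alpha>)" by auto
    show "fam m x k l (\<alpha>, \<tau>) \<in> bisimp X k l"
    proof (cases "\<alpha> ! 0 = \<alpha> ! k")
      case True
      have "\<alpha> ! 0 \<le> n" using ord_hom_nth_le[OF a(1)] by simp
      then show ?thesis unfolding fam_vertex[OF a t True] by (intro bi_act[OF X _ t] V_in x) (simp_all add: ord_hom_0)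
    next
      case False
      note g = graph_simplex[OF P a False]
      show ?thesis unfolding fam_edge[OF a t False] by (intro bi_act[OF X _ t] F_in x g)
    qed
  next
    fix q l k j \<theta> \<zeta> \<alpha> \<tau> assume th: "\<theta> \<in> ord_hom q k" and z: "\<zeta> \<in> ord_hom l j"
      and "\<alpha> \<in> simp (subsimplex n P) k" and t: "\<tau> \<in> ord_hom j m"
    then have a: "\<alpha> \<in> ord_hom k n" "P (set \<alpha>)" by auto
    let ?a = "ord_comp \<alpha> \<theta>"
    have a': "?a \<in> ord_hom q n" "P (set ?a)"
      using ord_comp_in[OF a(1) th] down_closedD[OF graph_down[OF P] ord_hom_set[OF a(1)] a(2) ord_comp_set_subset[OF a(1) th]]
      by auto
    have tz: "ord_comp \<tau> \<zeta> \<in> ord_hom l m" using ord_comp_in[OF t z] .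
    have nth: "?a ! i = \<alpha> ! (\<theta> ! i)" "\<theta> ! i \<le> k" if "i \<le> q" for i
      using that ord_comp_nth[of i \<theta> \<alpha>] ord_hom_length[OF th] ord_hom_nth_le[OF th] by auto
    have "fam m x q l (?a, ord_comp \<tau> \<zeta>) = bact X k j \<theta> \<zeta> (fam m x k j (\<alpha>, \<tau>))"
    proof (cases "\<alpha> ! 0 = \<alpha> ! k")
      case True
      have n0: "\<alpha> ! 0 \<le> n" using ord_hom_nth_le[OF a(1)] by simp
      have ac: "\<alpha> = ord_const k (\<alpha> ! 0)" by (rule ord_hom_const[OF a(1) True])
      have ac': "?a = ord_const q (\<alpha> ! 0)" by (subst ac) (rule ord_comp_const_left[OF th])
      have T': "?a ! 0 = ?a ! q" "?a ! 0 = \<alpha> ! 0" unfolding ac' by auto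
      have c: "ord_const k 0 \<in> ord_hom k 0" by (simp add: ord_hom_0)
      show ?thesis
        unfolding fam_vertex[OF a t True] fam_vertex[OF a' tz T'(1)] T'(2)
          bi_comp[OF X c t th z V_in[OF n0 x]] ord_comp_const_left[OF th] ..
    next
      case False
      note g = graph_simplex[OF P a False]
      let ?c = "map (\<lambda>v. if v = \<alpha> ! 0 then 0 else 1) \<alpha>"
      let ?F = "F (\<alpha> ! 0) (\<alpha> ! k) m x"
      have Fi: "?F \<in> bisimp X 1 m" by (rule F_in[OF g(1-3) x])
      have cn: "?c ! (\<theta> ! i) = (if ?a ! i = \<alpha> ! 0 then 0 else 1)" if "i \<le> q" for i
        using nth[OF that] ord_hom_length[OF a(1)] by simp
      have rhs: "bact X k j \<theta> \<zeta> (fam m x k j (\<alpha>, \<tau>)) = bact X 1 m (ord_comp ?c \<theta>) (ord_comp \<tau> \<zeta>) ?F"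
        unfolding fam_edge[OF a t False] by (rule bi_comp[OF X g(5) t th z Fi])
      show ?thesis
      proof (cases "?a ! 0 = ?a ! q")
        case T': True
        have ac': "?a = ord_const q (?a ! 0)" by (rule ord_hom_const[OF a'(1) T'])
        let ?e = "if ?a ! 0 = \<alpha> ! 0 then 0 else 1 :: nat"
        have V: "hop X 1 [?e] m ?F = V (?a ! 0) m x"
          using F0[OF g(1-3) x] F1[OF g(1-3) x] g(4)[of "\<theta> ! 0"] nth[of 0] by auto
        have e: "[?e] \<in> ord_hom 0 1" by (rule single_in) simp
        have "ord_comp ?c \<theta> = ord_const q ?e"
        proof (rule nth_equalityI)
          fix i assume "i < length (ord_comp ?c \<theta>)"
          then have i: "i \<le> q" "i < length \<theta>" using ord_hom_length[OF th] by (auto simp: ord_comp_length)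
          have "?a ! i = ?a ! 0" by (subst ac') (use i in simp)
          then show "ord_comp ?c \<theta> ! i = ord_const q ?e ! i"
            using cn[OF i(1)] ord_comp_nth[OF i(2)] i(1) by simp
        qed (simp add: ord_comp_length ord_hom_length[OF th])
        also have "\<dots> = ord_comp [?e] (ord_const q 0)" by (simp add: ord_comp_const_right)
        finally have cc: "ord_comp ?c \<theta> = ord_comp [?e] (ord_const q 0)" .
        have c0: "ord_const q 0 \<in> ord_hom q 0" by (simp add: ord_hom_0)
        show ?thesis
          unfolding rhs fam_vertex[OF a' tz T'] V[symmetric] cc by (rule hop_vert[OF X e c0 tz Fi])
      next
        case F': False
        note g' = graph_simplex[OF P a' F']
        have "?a ! 0 = \<alpha> ! 0 \<or> ?a ! 0 = \<alpha> ! k" "?a ! q = \<alpha> ! 0 \<or> ?a ! q = \<alpha> ! k"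
          using g(4) nth[of 0] nth[of q] by auto
        then have ends: "?a ! 0 = \<alpha> ! 0" "?a ! q = \<alpha> ! k" using g(1) g'(1) by auto
        have "map (\<lambda>v. if v = ?a ! 0 then 0 else 1) ?a = ord_comp ?c \<theta>"
        proof (rule nth_equalityI)
          fix i assume "i < length (map (\<lambda>v. if v = ?a ! 0 then 0 else 1::nat) ?a)"
          then have i: "i \<le> q" "i < length \<theta>" "i < length ?a" using ord_hom_length[OF th] by (auto simp: ord_comp_length)
          show "map (\<lambda>v. if v = ?a ! 0 then 0 else 1) ?a ! i = ord_comp ?c \<theta> ! i"
            unfolding nth_map[OF i(3)] ord_comp_nth[OF i(2), of ?c] cn[OF i(1)] ends(1) ..
        qed (simp add: ord_comp_length)
        then show ?thesis unfolding rhs fam_edge[OF a' tz F'] by (simp only: ends)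
      qed
    qed
    then show "fam m x q l (act (subsimplex n P) k \<theta> \<alpha>, ord_comp \<tau> \<zeta>) = bact X k j \<theta> \<zeta> (fam m x k j (\<alpha>, \<tau>))"
      by simp
  qed
  moreover have "bres (subsimplex n P) m (fam m x) = fam m x"
    unfolding fam_def gmap_def bres_def by simp
  ultimately show ?thesis by simp
qed

lemma fam_restrict:
  assumes x: "x \<in> simp K m" and s: "\<sigma> \<in> bisimp X n m"
    and sV: "\<And>i. i \<le> n \<Longrightarrow> hop X n [i] m \<sigma> = V i m x"
    and sF: "\<And>i j. i < j \<Longrightarrow> j \<le> n \<Longrightarrow> P {i, j} \<Longrightarrow> hop X n [i, j] m \<sigma> = F i j m x"
  shows "ldiv_restrict X n (subsimplex n P) m \<sigma> = fam m x"
proof (rule ldiv_eqI[OF ldiv_restrict_in[OF X graph_down[OF P] s] fam_in[OF x]])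
  fix k l \<alpha> \<tau> assume as: "\<alpha> \<in> simp (subsimplex n P) k" and t: "\<tau> \<in> ord_hom l m"
  then have a: "\<alpha> \<in> ord_hom k n" "P (set \<alpha>)" by auto
  show "ldiv_restrict X n (subsimplex n P) m \<sigma> k l (\<alpha>, \<tau>) = fam m x k l (\<alpha>, \<tau>)"
  proof (cases "\<alpha> ! 0 = \<alpha> ! k")
    case True
    have n0: "\<alpha> ! 0 \<le> n" using ord_hom_nth_le[OF a(1)] by simp
    have ac: "ord_comp [\<alpha> ! 0] (ord_const k 0) = \<alpha>"
      by (subst (2) ord_hom_const[OF a(1) True]) (simp add: ord_comp_const_right)
    have c: "ord_const k 0 \<in> ord_hom k 0" by (simp add: ord_hom_0)
    show ?thesis
      unfolding ldiv_restrict_apply[OF s as t] fam_vertex[OF a t True] sV[OF n0, symmetric]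
        hop_vert[OF X single_in[OF n0] c t s] ac ..
  next
    case False
    note g = graph_simplex[OF P a False]
    have p: "[\<alpha> ! 0, \<alpha> ! k] \<in> ord_hom 1 n" using g(1,2) by (intro pair_in) auto
    show ?thesis
      unfolding ldiv_restrict_apply[OF s as t] fam_edge[OF a t False] sF[OF g(1-3), symmetric]
        hop_vert[OF X p g(5) t s] g(6) ..
  qed
qed

lemma restrict_fam_edge:
  assumes s: "\<sigma> \<in> bisimp X n m" and r: "ldiv_restrict X n (subsimplex n P) m \<sigma> = fam m x" and x: "x \<in> simp K m"
    and ij: "i < j" "j \<le> n" "P {i, j}"
  shows "hop X n [i, j] m \<sigma> = F i j m x"
proof -
  have p: "[i, j] \<in> ord_hom 1 n" using ij by (intro pair_in) auto
  then have ps: "[i, j] \<in> simp (subsimplex n P) 1" using ij by simp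
  have "hop X n [i, j] m \<sigma> = fam m x 1 m ([i, j], ord_id m)"
    unfolding hop_def r[symmetric] by (rule ldiv_restrict_apply[OF s ps ord_id_in, symmetric])
  also have "\<dots> = hop X 1 [0, 1] m (F i j m x)"
    unfolding hop_def using ij by (subst fam_edge[OF p _ ord_id_in]) simp_all
  also have "\<dots> = F i j m x" unfolding ord_id_1[symmetric] by (rule hop_id[OF X F_in[OF ij x]])
  finally show ?thesis .
qed

lemma fam_smor: "smor K (ldiv (subsimplex n P) X) fam"
proof (rule smorI)
  fix m x assume "x \<in> simp K m" then show "fam m x \<in> simp (ldiv (subsimplex n P) X) m" by (rule fam_in)
next
  fix j m \<kappa> x assume k: "\<kappa> \<in> ord_hom j m" and x: "x \<in> simp K m"
  have kx: "act K m \<kappa> x \<in> simp K j" using sset_act[OF K k x] .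
  show "fam j (act K m \<kappa> x) = act (ldiv (subsimplex n P) X) m \<kappa> (fam m x)"
  proof (rule ldiv_eqI[OF fam_in[OF kx] ldiv_act_in[OF is_sset_down_closed[OF graph_down[OF P]] k fam_in[OF x]]])
    fix q l \<alpha> \<tau> assume as: "\<alpha> \<in> simp (subsimplex n P) q" and t: "\<tau> \<in> ord_hom l j"
    then have a: "\<alpha> \<in> ord_hom q n" "P (set \<alpha>)" by auto
    have kt: "ord_comp \<kappa> \<tau> \<in> ord_hom l m" using ord_comp_in[OF k t] .
    show "fam j (act K m \<kappa> x) q l (\<alpha>, \<tau>) = act (ldiv (subsimplex n P) X) m \<kappa> (fam m x) q l (\<alpha>, \<tau>)"
    proof (cases "\<alpha> ! 0 = \<alpha> ! q")
      case True
      have n0: "\<alpha> ! 0 \<le> n" using ord_hom_nth_le[OF a(1)] by simp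
      have c: "ord_const q 0 \<in> ord_hom q 0" by (simp add: ord_hom_0)
      have "V (\<alpha> ! 0) j (act K m \<kappa> x) = bact X 0 m (ord_id 0) \<kappa> (V (\<alpha> ! 0) m x)"
        using smor_nat[OF V[OF n0] k x] by simp
      then show ?thesis
        unfolding ldiv_act[OF k as t] fam_vertex[OF a t True] fam_vertex[OF a kt True]
        by (simp only: bi_comp[OF X ord_id_in k c t V_in[OF n0 x]] ord_comp_id_left[OF c])
    next
      case False
      note g = graph_simplex[OF P a False]
      have "F (\<alpha> ! 0) (\<alpha> ! q) j (act K m \<kappa> x) = bact X 1 m (ord_id 1) \<kappa> (F (\<alpha> ! 0) (\<alpha> ! q) m x)"
        using smor_nat[OF F[OF g(1-3)] k x] by simp
      then show ?thesis
        unfolding ldiv_act[OF k as t] fam_edge[OF a t False] fam_edge[OF a kt False]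
        by (simp only: bi_comp[OF X ord_id_in k g(5) t F_in[OF g(1-3) x]] ord_comp_id_left[OF g(5)])
    qed
  qed
qed

end

section \<open>Groupoids from division\<close>

text \<open>Groupoids in terms of division, after Ward: \<open>quot f g\<close> stands for \<open>f \<circ> g\<inverse>\<close>, for \<open>f\<close> and \<open>g\<close> with a common
  source. The laws hold up to an equivalence \<open>E\<close>, since they are applied to edges up to homotopy.\<close>

locale ward_groupoid =
  fixes Hom :: "'o \<Rightarrow> 'o \<Rightarrow> 'm \<Rightarrow> bool" and E :: "'m \<Rightarrow> 'm \<Rightarrow> bool"
    and quot :: "'m \<Rightarrow> 'm \<Rightarrow> 'm" and one :: "'o \<Rightarrow> 'm" and ob :: "'o \<Rightarrow> bool"
  assumes E_refl: "Hom x y f \<Longrightarrow> E f f"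
    and E_sym: "E f g \<Longrightarrow> E g f"
    and E_trans [trans]: "E f g \<Longrightarrow> E g h \<Longrightarrow> E f h"
    and Hom_ob: "Hom x y f \<Longrightarrow> ob x \<and> ob y"
    and one_Hom: "ob x \<Longrightarrow> Hom x x (one x)"
    and quot_Hom: "Hom x y f \<Longrightarrow> Hom x z g \<Longrightarrow> Hom z y (quot f g)"
    and quot_cong: "Hom x y f \<Longrightarrow> Hom x y f' \<Longrightarrow> Hom x z g \<Longrightarrow> Hom x z g' \<Longrightarrow> E f f' \<Longrightarrow> E g g' \<Longrightarrow>
      E (quot f g) (quot f' g')"
    and quot_self: "Hom x y f \<Longrightarrow> E (quot f f) (one y)"
    and quot_one: "Hom x y f \<Longrightarrow> E (quot f (one x)) f"
    and quot_quot: "Hom x y f \<Longrightarrow> Hom x z g \<Longrightarrow> Hom x w h \<Longrightarrow> E (quot (quot h f) (quot g f)) (quot h g)"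
begin

definition comp :: "'o \<Rightarrow> 'm \<Rightarrow> 'm \<Rightarrow> 'm" where
  "comp x g f = quot g (quot (one x) f)"

lemma inv_Hom: "Hom x y f \<Longrightarrow> Hom y x (quot (one x) f)"
  using quot_Hom[OF one_Hom] Hom_ob by blast

lemma comp_Hom: "Hom x y f \<Longrightarrow> Hom y z g \<Longrightarrow> Hom x z (comp x g f)"
  unfolding comp_def by (rule quot_Hom[OF _ inv_Hom])

lemma comp_cong:
  assumes "Hom x y f" "Hom x y f'" "Hom y z g" "Hom y z g'" "E f f'" "E g g'"
  shows "E (comp x g f) (comp x g' f')"
proof -
  have x: "Hom x x (one x)" using one_Hom Hom_ob[OF assms(1)] by blast
  have "E (quot (one x) f) (quot (one x) f')" using quot_cong[OF x x assms(1,2) E_refl[OF x] assms(5)] .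
  then show ?thesis
    unfolding comp_def by (rule quot_cong[OF assms(3,4) inv_Hom[OF assms(1)] inv_Hom[OF assms(2)] assms(6)])
qed

lemma quot_comp_cancel:
  assumes f: "Hom x y f" and h: "Hom x z h"
  shows "E (comp x (quot h f) f) h"
proof -
  have x: "Hom x x (one x)" using one_Hom Hom_ob[OF f] by blast
  have "E (quot (quot h f) (quot (one x) f)) (quot h (one x))" by (rule quot_quot[OF f x h])
  also have "E (quot h (one x)) h" by (rule quot_one[OF h])
  finally show ?thesis unfolding comp_def .
qed

text \<open>Since \<open>1 \<sim> f/f\<close>, the law \<open>(h/f)/(g/f) \<sim> h/g\<close> applies with \<open>h = f\<close> and \<open>g = 1\<close>.\<close>

lemma inv_inv:
  assumes f: "Hom x y f"
  shows "E (quot (one y) (quot (one x) f)) f"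
proof -
  have x: "Hom x x (one x)" and y: "Hom y y (one y)" using one_Hom Hom_ob[OF f] by auto
  note f' = inv_Hom[OF f]
  have "E (quot (one y) (quot (one x) f)) (quot (quot f f) (quot (one x) f))"
    by (rule quot_cong[OF y quot_Hom[OF f f] f' f' E_sym[OF quot_self[OF f]] E_refl[OF f']])
  also have "E (quot (quot f f) (quot (one x) f)) (quot f (one x))" by (rule quot_quot[OF f x f])
  also have "E (quot f (one x)) f" by (rule quot_one[OF f])
  finally show ?thesis .
qed

lemma comp_quot_cancel:
  assumes f: "Hom x y f" and g: "Hom y z g"
  shows "E (quot (comp x g f) f) g"
proof -
  have y: "Hom y y (one y)" using one_Hom Hom_ob[OF f] by auto
  note f' = inv_Hom[OF f]
  have gf: "Hom x z (comp x g f)" using comp_Hom[OF f g] .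
  have "E (quot (comp x g f) f) (quot (comp x g f) (quot (one y) (quot (one x) f)))"
    by (rule quot_cong[OF gf gf f inv_Hom[OF f'] E_refl[OF gf] E_sym[OF inv_inv[OF f]]])
  also have "E (quot (comp x g f) (quot (one y) (quot (one x) f))) (quot g (one y))"
    unfolding comp_def by (rule quot_quot[OF f' y g])
  also have "E (quot g (one y)) g" by (rule quot_one[OF g])
  finally show ?thesis .
qed

lemma comp_one_right:
  assumes f: "Hom x y f" shows "E (comp x f (one x)) f"
proof -
  have x: "Hom x x (one x)" using one_Hom Hom_ob[OF f] by auto
  have "E (comp x f (one x)) (quot f (one x))"
    unfolding comp_def by (rule quot_cong[OF f f quot_Hom[OF x x] x E_refl[OF f] quot_self[OF x]])
  also have "E (quot f (one x)) f" by (rule quot_one[OF f])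
  finally show ?thesis .
qed

lemma comp_one_left: "Hom x y f \<Longrightarrow> E (comp x (one y) f) f"
  unfolding comp_def by (rule inv_inv)

lemma comp_inv_left:
  assumes f: "Hom x y f" shows "E (comp x (quot (one x) f) f) (one x)"
  unfolding comp_def by (rule quot_self[OF inv_Hom[OF f]])

lemma comp_inv_right:
  assumes f: "Hom x y f" shows "E (comp y f (quot (one x) f)) (one y)"
proof -
  note f' = inv_Hom[OF f]
  have "E (comp y f (quot (one x) f)) (quot f f)"
    unfolding comp_def by (rule quot_cong[OF f f inv_Hom[OF f'] f E_refl[OF f] inv_inv[OF f]])
  also have "E (quot f f) (one y)" by (rule quot_self[OF f])
  finally show ?thesis .
qed

text \<open>Let \<open>k = g \<circ> f\<close> and \<open>l = h \<circ> k\<close>. Then \<open>h \<sim> l/k \<sim> (l/f)/(k/f)\<close> and \<open>g \<sim> k/f\<close>, so \<open>h \<circ> g \<sim> l/f\<close>.\<close>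

lemma comp_assoc:
  assumes f: "Hom w x f" and g: "Hom x y g" and h: "Hom y z h"
  shows "E (comp w (comp x h g) f) (comp w h (comp w g f))"
proof -
  let ?k = "comp w g f" let ?l = "comp w h ?k"
  have k: "Hom w y ?k" and l: "Hom w z ?l" using comp_Hom f g h by blast+
  have lf: "Hom x z (quot ?l f)" and kf: "Hom x y (quot ?k f)" and lk: "Hom y z (quot ?l ?k)"
    using quot_Hom k l f by blast+
  have lkf: "Hom y z (quot (quot ?l f) (quot ?k f))" using quot_Hom[OF lf kf] .
  have 1: "E h (quot (quot ?l f) (quot ?k f))"
    using E_trans[OF E_sym[OF comp_quot_cancel[OF k h]] E_sym[OF quot_quot[OF f k l]]] .
  have 2: "E g (quot ?k f)" using E_sym[OF comp_quot_cancel[OF f g]] .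
  have "E (comp x h g) (comp x (quot (quot ?l f) (quot ?k f)) (quot ?k f))"
    by (rule comp_cong[OF g kf h lkf 2 1])
  also have "E (comp x (quot (quot ?l f) (quot ?k f)) (quot ?k f)) (quot ?l f)"
    by (rule quot_comp_cancel[OF kf lf])
  finally have "E (comp x h g) (quot ?l f)" .
  then have "E (comp w (comp x h g) f) (comp w (quot ?l f) f)"
    by (rule comp_cong[OF f f comp_Hom[OF g h] lf E_refl[OF f]])
  also have "E (comp w (quot ?l f) f) ?l" by (rule quot_comp_cancel[OF f l])
  finally show ?thesis .
qed

end

section \<open>Division in a Bousfield-Segal space\<close>

text \<open>Pairs of edges such that the vertex \<open>i\<close> of the first is the source of the second: a common source for
  \<open>i = 0\<close>, composable edges for \<open>i = 1\<close>.\<close>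

definition fibre_pairs :: "'a bisset \<Rightarrow> nat \<Rightarrow> ('a \<times> 'a) sset" where
  "fibre_pairs X i =
     \<lparr>simp = \<lambda>m. {(f, g). f \<in> bisimp X 1 m \<and> g \<in> bisimp X 1 m \<and> hop X 1 [i] m f = hop X 1 [0] m g},
      act = act (sprod (column X 1) (column X 1))\<rparr>"

lemma coface_small: "coface 1 0 = [1]" "coface 1 1 = [0]" "coface 2 0 = [1, 2]" "coface 2 1 = [0, 2]" "coface 2 2 = [0, 1]"
  "codegen 0 0 = [0, 0]"
  by (simp_all add: coface_def codegen_def upt_rec)

lemma hface_hop: "hface X 1 m 0 = hop X 1 [1] m" "hface X 1 m 1 = hop X 1 [0] m"
  "hface X 2 m 0 = hop X 2 [1, 2] m" "hface X 2 m 1 = hop X 2 [0, 2] m" "hface X 2 m 2 = hop X 2 [0, 1] m"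
  "hdegen X 0 m 0 = hop X 0 [0, 0] m"
  unfolding hface_def hdegen_def hop_def coface_small by (rule refl)+

lemma pairs_fibre: "bousfield_pairs X = fibre_pairs X 0" "segal_pairs X = fibre_pairs X 1"
  unfolding bousfield_pairs_def segal_pairs_def fibre_pairs_def hface_hop by (rule refl)+

lemma fibre_pairs_simps [simp]:
  "(f, g) \<in> simp (fibre_pairs X i) m \<longleftrightarrow> f \<in> bisimp X 1 m \<and> g \<in> bisimp X 1 m \<and> hop X 1 [i] m f = hop X 1 [0] m g"
  "act (fibre_pairs X i) m \<beta> (f, g) = (bact X 1 m (ord_id 1) \<beta> f, bact X 1 m (ord_id 1) \<beta> g)"
  by (simp_all add: fibre_pairs_def)

lemma edge_ops: "i \<le> 1 \<Longrightarrow> [i] \<in> ord_hom 0 1" "i \<le> j \<Longrightarrow> j \<le> 2 \<Longrightarrow> [i, j] \<in> ord_hom 1 2"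
  using single_in pair_in by blast+

lemma is_sset_fibre_pairs:
  assumes X: "is_bisset X" and i: "i \<le> 1"
  shows "is_sset (fibre_pairs X i)"
proof -
  note C = is_sset_column[OF X, of 1]
  have S: "is_sset (sprod (column X 1) (column X 1))" using is_sset_sprod[OF C C] .
  have "fibre_pairs X i = subs (sprod (column X 1) (column X 1)) (\<lambda>m p. hop X 1 [i] m (fst p) = hop X 1 [0] m (snd p))"
    unfolding fibre_pairs_def subs_def by (auto intro!: ext)
  moreover have "closed_in (sprod (column X 1) (column X 1)) (\<lambda>m p. hop X 1 [i] m (fst p) = hop X 1 [0] m (snd p))"
    unfolding closed_in_def
  proof (intro allI ballI impI)
    fix k m \<beta> p assume b: "\<beta> \<in> ord_hom k m" and "p \<in> simp (sprod (column X 1) (column X 1)) m"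
      and e: "hop X 1 [i] m (fst p) = hop X 1 [0] m (snd p)"
    then obtain f g where p: "p = (f, g)" "f \<in> simp (column X 1) m" "g \<in> simp (column X 1) m" by auto
    have "hop X 1 [i] k (act (column X 1) m \<beta> f) = hop X 1 [0] k (act (column X 1) m \<beta> g)"
      using smor_nat[OF hop_smor[OF X edge_ops(1)[OF i]] b p(2)] smor_nat[OF hop_smor[OF X edge_ops(1)[of 0]] b p(3)] e p(1)
      by simp
    then show "hop X 1 [i] k (fst (act (sprod (column X 1) (column X 1)) m \<beta> p)) =
      hop X 1 [0] k (snd (act (sprod (column X 1) (column X 1)) m \<beta> p))" using p(1) by simp
  qed
  ultimately show ?thesis using is_sset_subs[OF S] by simp
qed

lemma fibre_pairs_proj: "smor (fibre_pairs X i) (column X 1) (\<lambda>m. fst)" "smor (fibre_pairs X i) (column X 1) (\<lambda>m. snd)"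
  by (rule smorI; auto)+

lemma fibre_pairs_pair:
  assumes "smor K (column X 1) f" "smor K (column X 1) g"
    "\<And>m x. x \<in> simp K m \<Longrightarrow> hop X 1 [i] m (f m x) = hop X 1 [0] m (g m x)"
  shows "smor K (fibre_pairs X i) (\<lambda>m x. (f m x, g m x))"
  by (rule smorI) (use smor_in[OF assms(1)] smor_in[OF assms(2)] smor_nat[OF assms(1)] smor_nat[OF assms(2)] assms(3) in auto)

text \<open>Homotopies over this map fix the end points of edges.\<close>

definition ends :: "'a bisset \<Rightarrow> nat \<Rightarrow> 'a \<Rightarrow> 'a \<times> 'a" where
  "ends X m f = (hop X 1 [0] m f, hop X 1 [1] m f)"

definition pair_ends :: "'a bisset \<Rightarrow> nat \<Rightarrow> 'a \<times> 'a \<Rightarrow> ('a \<times> 'a) \<times> ('a \<times> 'a)" where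
  "pair_ends X m p = (ends X m (fst p), ends X m (snd p))"

lemma hlink_pair:
  assumes f: "smor K (column X 1) f" "smor K (column X 1) f'" and g: "smor K (column X 1) g" "smor K (column X 1) g'"
    and F: "fib_homotopy K (column X 1) (ends X) f f' \<epsilon> H" and G: "fib_homotopy K (column X 1) (ends X) g g' \<epsilon> G"
    and i: "i \<le> 1" and c: "\<And>m x. x \<in> simp K m \<Longrightarrow> hop X 1 [i] m (f m x) = hop X 1 [0] m (g m x)"
  shows "hlink K (fibre_pairs X i) (pair_ends X) (\<lambda>m x. (f m x, g m x)) (\<lambda>m x. (f' m x, g' m x))"
proof -
  note H = fib_homotopyD[OF F] and G = fib_homotopyD[OF G]
  have vert: "hop X 1 [v] m a = hop X 1 [v] m b" if "ends X m a = ends X m b" "v \<le> 1" for m a b v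
    using that by (cases "v = 0") (auto simp: ends_def le_Suc_eq)
  have HG: "hop X 1 [i] m (H m (x, \<tau>)) = hop X 1 [0] m (G m (x, \<tau>))" if "x \<in> simp K m" "\<tau> \<in> ord_hom m 1" for m x \<tau>
    using vert[OF H(5)[OF that] i] vert[OF G(5)[OF that], of 0] c[OF that(1)] by simp
  have c': "hop X 1 [i] m (f' m x) = hop X 1 [0] m (g' m x)" if "x \<in> simp K m" for m x
    using HG[OF that const01(2)[OF H(1)]] H(4)[OF that] G(4)[OF that] by simp
  have HG_smor: "smor (sprod K (simplex 1)) (fibre_pairs X i) (\<lambda>m z. (H m z, G m z))"
    by (rule fibre_pairs_pair[OF H(2) G(2)]) (use HG in auto)
  show ?thesis
    by (rule hlinkI[OF fibre_pairs_pair[OF f(1) g(1) c] fibre_pairs_pair[OF f(2) g(2) c'] H(1) HG_smor])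
      (simp_all add: H(3-5) G(3-5) pair_ends_def del: One_nat_def)
qed

lemma homotopic_pair:
  assumes F: "homotopic_over K (column X 1) (ends X) f f'" and G: "homotopic_over K (column X 1) (ends X) g g'"
    and i: "i \<le> 1" and c: "\<And>m x. x \<in> simp K m \<Longrightarrow> hop X 1 [i] m (f m x) = hop X 1 [0] m (g m x)"
  shows "homotopic_over K (fibre_pairs X i) (pair_ends X) (\<lambda>m x. (f m x, g m x)) (\<lambda>m x. (f' m x, g' m x))"
proof -
  let ?E = "homotopic_over K (column X 1) (ends X)"
  let ?P = "homotopic_over K (fibre_pairs X i) (pair_ends X)"
  have compat: "hop X 1 [i] m (a m x) = hop X 1 [0] m (b m x)" if "?E f a" "?E g b" "x \<in> simp K m" for a b m x
    using homotopic_over_same[OF that(1,3)] homotopic_over_same[OF that(2,3)] c[OF that(3)] i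
    by (cases "i = 0") (auto simp: ends_def le_Suc_eq)
  have "?P (\<lambda>m x. (f m x, g m x)) (\<lambda>m x. (f' m x, g m x))"
    using F
  proof (induction rule: homotopic_over_induct)
    case refl
    show ?case using fibre_pairs_pair[OF homotopic_over_smor(1)[OF F] homotopic_over_smor(1)[OF G] c]
      by (simp add: homotopic_over_def)
  next
    case (link a b)
    obtain \<epsilon> H where H: "fib_homotopy K (column X 1) (ends X) a b \<epsilon> H" by (rule hlinkE[OF link.hyps(2)])
    note g = homotopic_over_smor(1)[OF G]
    have "?E g g" using g by (simp add: homotopic_over_def)
    then have "hlink K (fibre_pairs X i) (pair_ends X) (\<lambda>m x. (a m x, g m x)) (\<lambda>m x. (b m x, g m x))"
      by (intro hlink_pair[OF hlink_smor[OF link.hyps(2)] g g H fib_homotopy_const[OF g fib_homotopyD(1)[OF H]] i]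
        compat[OF link.hyps(1)])
    then show ?case using homotopic_over_trans[OF link.IH homotopic_over_link] by blast
  qed
  moreover have "?P (\<lambda>m x. (f' m x, g m x)) (\<lambda>m x. (f' m x, g' m x))"
    using G
  proof (induction rule: homotopic_over_induct)
    case refl
    have gg: "?E g g" using homotopic_over_smor(1)[OF G] by (simp add: homotopic_over_def)
    show ?case
      using fibre_pairs_pair[OF homotopic_over_smor(2)[OF F] homotopic_over_smor(1)[OF G] compat[OF F gg]]
      by (simp add: homotopic_over_def)
  next
    case (link a b)
    obtain \<epsilon> H where H: "fib_homotopy K (column X 1) (ends X) a b \<epsilon> H" by (rule hlinkE[OF link.hyps(2)])
    note f = homotopic_over_smor(2)[OF F]
    have "hlink K (fibre_pairs X i) (pair_ends X) (\<lambda>m x. (f' m x, a m x)) (\<lambda>m x. (f' m x, b m x))"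
      by (intro hlink_pair[OF f f hlink_smor[OF link.hyps(2)] fib_homotopy_const[OF f fib_homotopyD(1)[OF H]] H i]
        compat[OF F link.hyps(1)])
    then show ?case using homotopic_over_trans[OF link.IH homotopic_over_link] by blast
  qed
  ultimately show ?thesis by (rule homotopic_over_trans)
qed

abbreviation star_faces :: "nat \<Rightarrow> nat set \<Rightarrow> bool" where
  "star_faces n \<equiv> \<lambda>V. \<exists>i. 0 < i \<and> i \<le> n \<and> V \<subseteq> {0, i}"

abbreviation spine_faces :: "nat set \<Rightarrow> bool" where
  "spine_faces \<equiv> \<lambda>V. V \<subseteq> {0, 1} \<or> V \<subseteq> {1, 2}"

lemma graph_star: "graph n (star_faces n)"
  unfolding graph_def down_closed_def by (blast intro: subset_trans)

lemma graph_spine: "graph 2 spine_faces"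
  unfolding graph_def down_closed_def by (blast intro: subset_trans)

lemma star_faces_edge: "star_faces n {i, j} \<Longrightarrow> i < j \<Longrightarrow> i = 0"
  by auto

lemma bss_fibrant: "bousfield_segal_space X \<Longrightarrow> v_fibrant X"
  by (simp add: bousfield_segal_space_def)

lemma bss_bisset: "bousfield_segal_space X \<Longrightarrow> is_bisset X"
  by (simp add: bousfield_segal_space_def v_fibrant_def)

text \<open>The Bousfield map is a Kan fibration by Reedy fibrancy and a weak equivalence by assumption, hence it has
  a homotopy inverse. The inverse is deformed to a section, and the deformation to one within the fibres.\<close>

theorem star_section:
  assumes X: "bousfield_segal_space X" and n: "2 \<le> n"
  shows "\<exists>s. smor (ldiv (star n) X) (column X n) s \<and>
    (\<forall>m. \<forall>\<phi>\<in>simp (ldiv (star n) X) m. ldiv_restrict X n (star n) m (s m \<phi>) = \<phi>) \<and>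
    homotopic_over (column X n) (column X n) (ldiv_restrict X n (star n)) (\<lambda>m x. x)
      (\<lambda>m x. s m (ldiv_restrict X n (star n) m x))"
proof -
  let ?E = "column X n" and ?B = "ldiv (star n) X" and ?p = "ldiv_restrict X n (star n)"
  note D = graph_down[OF graph_star[of n]]
  have E: "is_sset ?E" and B: "is_sset ?B"
    using is_sset_column[OF bss_bisset[OF X]] is_sset_ldiv[OF is_sset_down_closed[OF D]] by (auto simp: star_def)
  have p: "kanfib ?E ?B ?p" unfolding star_def by (rule column_restriction_kanfib[OF bss_fibrant[OF X] D])
  have w: "weak_equivalence ?E ?B ?p" using X n unfolding bousfield_segal_space_def by blast
  have kB: "kan_complex ?B" unfolding star_def by (rule kan_complex_ldiv[OF bss_fibrant[OF X] D])
  obtain g where g: "smor ?B ?E g"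
    "homotopic_over ?E ?E no_base (\<lambda>m x. g m (?p m x)) (\<lambda>m x. x)"
    "homotopic_over ?B ?B no_base (\<lambda>m x. ?p m (g m x)) (\<lambda>m x. x)"
    by (rule weak_equivalence_homotopy_inverse[OF w kan_complex_column[OF bss_fibrant[OF X]] kB])
  obtain s where s: "smor ?B ?E s" "\<forall>m. \<forall>\<phi>\<in>simp ?B m. ?p m (s m \<phi>) = \<phi>"
    using section_of_homotopy_section[OF B E p g(1,3)] by blast
  have sp: "smor ?E ?E (\<lambda>m x. s m (?p m x))" using smor_comp[OF kanfib_smor[OF p] s(1)] .
  \<comment> \<open>\<open>s \<circ> p \<sim> g \<circ> p \<circ> s \<circ> p = g \<circ> p \<sim> 1\<close>\<close>
  have "homotopic_over ?E ?E no_base (\<lambda>m x. g m (?p m (s m (?p m x)))) (\<lambda>m x. s m (?p m x))"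
    using homotopic_over_pre[OF g(2) sp] .
  then have "homotopic_over ?E ?E no_base (\<lambda>m x. g m (?p m x)) (\<lambda>m x. s m (?p m x))"
    by (rule homotopic_over_cong[OF E]) (use s(2) smor_in[OF kanfib_smor[OF p]] in auto)
  then have h: "homotopic_over ?E ?E no_base (\<lambda>m x. s m (?p m x)) (\<lambda>m x. x)"
    using homotopic_over_trans[OF homotopic_over_sym g(2)] by blast
  have ps: "?p m (s m \<phi>) = \<phi>" if "\<phi> \<in> simp ?B m" for m \<phi> using s(2) that by blast
  have "homotopic_over ?E ?E ?p (\<lambda>m x. x) (\<lambda>m x. s m (?p m x))"
    by (rule fibrewise_deformation[where q=no_base and p="?p" and s=s, OF E p s(1) ps h])
  with s show ?thesis by (intro exI conjI)
qed

text \<open>Edges with a common source form a map out of the star, which a section of \<open>\<beta>\<^sub>n\<close> extends to \<open>\<Delta>\<^sup>n\<close>.\<close>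

lemma star_lift:
  fixes F :: "nat \<Rightarrow> nat \<Rightarrow> 'k \<Rightarrow> 'a"
  assumes X: "bousfield_segal_space X" and n: "2 \<le> n" and K: "is_sset K"
    and F: "\<And>i. 0 < i \<Longrightarrow> i \<le> n \<Longrightarrow> smor K (column X 1) (F i)"
    and c: "\<And>i m x. 0 < i \<Longrightarrow> i \<le> n \<Longrightarrow> x \<in> simp K m \<Longrightarrow> hop X 1 [0] m (F i m x) = hop X 1 [0] m (F 1 m x)"
  obtains \<omega> where "smor K (column X n) \<omega>"
    "\<And>i m x. 0 < i \<Longrightarrow> i \<le> n \<Longrightarrow> x \<in> simp K m \<Longrightarrow> hop X n [0, i] m (\<omega> m x) = F i m x"
proof -
  define V where "V i m x = (if i = 0 then hop X 1 [0] m (F 1 m x) else hop X 1 [1] m (F i m x))" for i m x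
  have h: "smor (column X 1) (column X 0) (hop X 1 [v])" if "v \<le> 1" for v
    using hop_smor[OF bss_bisset[OF X] edge_ops(1)[OF that]] .
  interpret G: graph_family X n "star_faces n" K V "\<lambda>i j. F j"
  proof (unfold_locales)
    show "is_bisset X" using bss_bisset[OF X] .
    show "graph n (star_faces n)" using graph_star .
    show "is_sset K" using K .
    fix i assume i: "i \<le> n"
    show "smor K (column X 0) (V i)"
      using smor_comp[OF F h] i n unfolding V_def by (cases "i = 0") auto
  next
    fix i j assume ij: "i < j" "j \<le> n" "star_faces n {i, j}"
    have i0: "i = 0" using star_faces_edge[OF ij(3,1)] .
    show "smor K (column X 1) (F j)" using F ij by simp
    fix m x assume x: "x \<in> simp K m"
    show "hop X 1 [0] m (F j m x) = V i m x" using c[OF _ ij(2) x] ij(1) i0 by (simp add: V_def)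
    show "hop X 1 [1] m (F j m x) = V j m x" using ij(1) by (simp add: V_def)
  qed
  obtain s where s: "smor (ldiv (star n) X) (column X n) s"
    and s_sec: "\<forall>m. \<forall>\<phi>\<in>simp (ldiv (star n) X) m. ldiv_restrict X n (star n) m (s m \<phi>) = \<phi>"
    using star_section[OF X n] by (elim exE conjE)
  have fam: "smor K (ldiv (star n) X) G.fam" using G.fam_smor by (simp add: star_def)
  have w: "smor K (column X n) (\<lambda>m x. s m (G.fam m x))" by (rule smor_comp[OF fam s])
  show thesis
  proof (rule that[OF w])
    fix i m x assume i: "0 < i" "i \<le> n" and x: "x \<in> simp K m"
    have "ldiv_restrict X n (subsimplex n (star_faces n)) m (s m (G.fam m x)) = G.fam m x"
      using s_sec smor_in[OF fam x] by (simp add: star_def)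
    moreover have "s m (G.fam m x) \<in> bisimp X n m" using smor_in[OF w x] by simp
    ultimately show "hop X n [0, i] m (s m (G.fam m x)) = F i m x"
      using i by (intro G.restrict_fam_edge[OF _ _ x]) auto
  qed
qed

text \<open>Both triangles deform, within the fibres of \<open>\<beta>\<^sub>2\<close>, to the value of a section of \<open>\<beta>\<^sub>2\<close> at the same pair
  of edges. The end points of the third edge are vertices of the other two, so the deformation fixes them.\<close>

lemma star_unique:
  assumes X: "bousfield_segal_space X" and K: "is_sset K"
    and s: "smor K (column X 2) \<sigma>" "smor K (column X 2) \<sigma>'"
    and e1: "\<And>m x. x \<in> simp K m \<Longrightarrow> hop X 2 [0, 1] m (\<sigma> m x) = hop X 2 [0, 1] m (\<sigma>' m x)"
    and e2: "\<And>m x. x \<in> simp K m \<Longrightarrow> hop X 2 [0, 2] m (\<sigma> m x) = hop X 2 [0, 2] m (\<sigma>' m x)"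
  shows "homotopic_over K (column X 1) (ends X) (\<lambda>m x. hop X 2 [1, 2] m (\<sigma> m x)) (\<lambda>m x. hop X 2 [1, 2] m (\<sigma>' m x))"
proof -
  let ?p = "ldiv_restrict X 2 (star 2)"
  note X' = bss_bisset[OF X]
  obtain r where r: "smor (ldiv (star 2) X) (column X 2) r"
    and h: "homotopic_over (column X 2) (column X 2) ?p (\<lambda>m x. x) (\<lambda>m x. r m (?p m x))"
    using star_section[OF X order_refl] by (elim exE conjE)
  have vert: "hop X 1 [v] m (hop X 2 [i, j] m x) = hop X 2 [if v = 0 then i else j] m x"
    if "v \<le> 1" "i \<le> j" "j \<le> 2" "x \<in> bisimp X 2 m" for v i j m x
    using hop_hop[OF X' edge_ops(2) edge_ops(1)[OF that(1)] that(4), of i j] that by (auto simp: ord_comp_def le_Suc_eq)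
  interpret G: graph_family X 2 "star_faces 2" K "\<lambda>i m x. hop X 2 [i] m (\<sigma> m x)" "\<lambda>i j m x. hop X 2 [i, j] m (\<sigma> m x)"
  proof (unfold_locales)
    show "is_bisset X" "graph 2 (star_faces 2)" "is_sset K" using X' graph_star K by auto
    fix i :: nat assume i: "i \<le> 2"
    show "smor K (column X 0) (\<lambda>m x. hop X 2 [i] m (\<sigma> m x))"
      using smor_comp[OF s(1) hop_smor[OF X' single_in[OF i]]] .
  next
    fix i j :: nat assume ij: "i < j" "j \<le> 2" "star_faces 2 {i, j}"
    show "smor K (column X 1) (\<lambda>m x. hop X 2 [i, j] m (\<sigma> m x))"
      using ij by (intro smor_comp[OF s(1) hop_smor[OF X' edge_ops(2)]]) auto
    fix m x assume "x \<in> simp K m"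
    then have "\<sigma> m x \<in> bisimp X 2 m" using smor_in[OF s(1)] by simp
    then show "hop X 1 [0] m (hop X 2 [i, j] m (\<sigma> m x)) = hop X 2 [i] m (\<sigma> m x)"
      "hop X 1 [1] m (hop X 2 [i, j] m (\<sigma> m x)) = hop X 2 [j] m (\<sigma> m x)"
      using vert[of 0 i j] vert[of 1 i j] ij by auto
  qed
  have peq: "?p m (\<sigma> m x) = ?p m (\<sigma>' m x)" if x: "x \<in> simp K m" for m x
  proof -
    have i1: "\<sigma> m x \<in> bisimp X 2 m" "\<sigma>' m x \<in> bisimp X 2 m" using smor_in[OF s(1) x] smor_in[OF s(2) x] by auto
    have ee: "hop X 2 [i, j] m (\<sigma>' m x) = hop X 2 [i, j] m (\<sigma> m x)" if "i < j" "j \<le> 2" "star_faces 2 {i, j}" for i j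
    proof -
      have "i = 0" using star_faces_edge[OF that(3,1)] .
      moreover have "j = 1 \<or> j = 2" using that by auto
      ultimately show ?thesis using e1[OF x] e2[OF x] by auto
    qed
    have vv: "hop X 2 [i] m (\<sigma>' m x) = hop X 2 [i] m (\<sigma> m x)" if i: "i \<le> 2" for i
    proof -
      have v: "hop X 2 [0] m y = hop X 1 [0] m (hop X 2 [0, 1] m y)" "hop X 2 [1] m y = hop X 1 [1] m (hop X 2 [0, 1] m y)"
        "hop X 2 [2] m y = hop X 1 [1] m (hop X 2 [0, 2] m y)" if "y \<in> bisimp X 2 m" for y
        using vert[of 0 0 1 y] vert[of 1 0 1 y] vert[of 1 0 2 y] that by auto
      have "i = 0 \<or> i = 1 \<or> i = 2" using i by auto
      then show ?thesis using v[OF i1(1)] v[OF i1(2)] e1[OF x] e2[OF x] by auto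
    qed
    show ?thesis unfolding star_def using G.fam_restrict[OF x i1(1)] G.fam_restrict[OF x i1(2)] ee vv by simp
  qed
  have "homotopic_over K (column X 2) ?p \<sigma> (\<lambda>m x. r m (?p m (\<sigma> m x)))" using homotopic_over_pre[OF h s(1)] .
  moreover have "homotopic_over K (column X 2) ?p \<sigma>' (\<lambda>m x. r m (?p m (\<sigma> m x)))"
    by (rule homotopic_over_cong[OF K homotopic_over_pre[OF h s(2)]]) (simp_all add: peq)
  ultimately have "homotopic_over K (column X 2) ?p \<sigma> \<sigma>'"
    using homotopic_over_trans[OF _ homotopic_over_sym] by blast
  then show ?thesis
  proof (rule homotopic_over_post[OF _ hop_smor[OF X' edge_ops(2)]])
    fix m b b' assume b: "b \<in> simp (column X 2) m" "b' \<in> simp (column X 2) m" and e: "?p m b = ?p m b'"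
    have b': "b \<in> bisimp X 2 m" "b' \<in> bisimp X 2 m" using b by auto
    have ed: "hop X 2 [0, j] m b = hop X 2 [0, j] m b'" if "0 < j" "j \<le> 2" for j
    proof -
      have j: "[0, j] \<in> simp (star 2) 1" using that pair_in[of 0 j 2] by (auto simp: star_def)
      then show ?thesis unfolding hop_def
        using ldiv_restrict_apply[OF b'(1) j ord_id_in] ldiv_restrict_apply[OF b'(2) j ord_id_in] e by simp
    qed
    have "hop X 2 [1] m b = hop X 2 [1] m b'" "hop X 2 [2] m b = hop X 2 [2] m b'"
      using vert[of 1 0 1 b m] vert[of 1 0 1 b' m] vert[of 1 0 2 b m] vert[of 1 0 2 b' m] ed[of 1] ed[of 2] b' by auto
    then show "ends X m (hop X 2 [1, 2] m b) = ends X m (hop X 2 [1, 2] m b')"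
      using vert[of 0 1 2 b m] vert[of 0 1 2 b' m] vert[of 1 1 2 b m] vert[of 1 1 2 b' m] b' by (simp add: ends_def)
  qed simp_all
qed

text \<open>Families of edges with the families \<open>a\<close> and \<open>b\<close> of end points: the morphisms of a groupoid whose objects are the maps
  \<open>K \<rightarrow> X\<^sub>0\<close>.\<close>

definition map_hom :: "'k sset \<Rightarrow> 'a bisset \<Rightarrow> (nat \<Rightarrow> 'k \<Rightarrow> 'a) \<Rightarrow> (nat \<Rightarrow> 'k \<Rightarrow> 'a) \<Rightarrow> (nat \<Rightarrow> 'k \<Rightarrow> 'a) \<Rightarrow> bool" where
  "map_hom K X a b f \<longleftrightarrow> smor K (column X 0) a \<and> smor K (column X 0) b \<and> smor K (column X 1) f \<and>
     (\<forall>m. \<forall>x\<in>simp K m. hop X 1 [0] m (f m x) = a m x \<and> hop X 1 [1] m (f m x) = b m x)"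

lemma map_homD:
  assumes "map_hom K X a b f"
  shows "smor K (column X 0) a" "smor K (column X 0) b" "smor K (column X 1) f"
    "x \<in> simp K m \<Longrightarrow> hop X 1 [0] m (f m x) = a m x" "x \<in> simp K m \<Longrightarrow> hop X 1 [1] m (f m x) = b m x"
    "x \<in> simp K m \<Longrightarrow> f m x \<in> bisimp X 1 m"
proof -
  show f: "smor K (column X 1) f" "smor K (column X 0) a" "smor K (column X 0) b"
    using assms unfolding map_hom_def by blast+
  show "x \<in> simp K m \<Longrightarrow> hop X 1 [0] m (f m x) = a m x" "x \<in> simp K m \<Longrightarrow> hop X 1 [1] m (f m x) = b m x"
    using assms unfolding map_hom_def by blast+
  show "x \<in> simp K m \<Longrightarrow> f m x \<in> bisimp X 1 m" using smor_in[OF f(1)] by simp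
qed

definition map_quot :: "'a bisset \<Rightarrow> (nat \<Rightarrow> 'a \<times> 'a \<Rightarrow> 'a) \<Rightarrow> (nat \<Rightarrow> 'k \<Rightarrow> 'a) \<Rightarrow> (nat \<Rightarrow> 'k \<Rightarrow> 'a) \<Rightarrow> nat \<Rightarrow> 'k \<Rightarrow> 'a" where
  "map_quot X \<mu> f g = (\<lambda>m x. hop X 2 [1, 2] m (\<mu> m (f m x, g m x)))"

definition map_one :: "'a bisset \<Rightarrow> (nat \<Rightarrow> 'k \<Rightarrow> 'a) \<Rightarrow> nat \<Rightarrow> 'k \<Rightarrow> 'a" where
  "map_one X a = (\<lambda>m x. hop X 0 [0, 0] m (a m x))"

lemma exists_bousfield_section:
  assumes X: "bousfield_segal_space X"
  shows "\<exists>\<mu>. bousfield_section X \<mu>"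
proof -
  let ?K = "fibre_pairs X 0"
  let ?F = "\<lambda>i m p. if i = (1::nat) then snd p else fst p"
  have K: "is_sset ?K" by (rule is_sset_fibre_pairs[OF bss_bisset[OF X]]) simp
  obtain \<omega> where w: "smor ?K (column X 2) \<omega>"
    "\<And>i m x. 0 < i \<Longrightarrow> i \<le> 2 \<Longrightarrow> x \<in> simp ?K m \<Longrightarrow> hop X 2 [0, i] m (\<omega> m x) = ?F i m x"
  proof (rule star_lift[OF X order_refl K, of ?F])
    fix i :: nat show "smor ?K (column X 1) (?F i)"
      using fibre_pairs_proj[of X 0] by (cases "i = 1") auto
  qed auto
  have "bousfield_section X (sres ?K \<omega>)"
    unfolding bousfield_section_def pairs_fibre hface_hop
  proof (intro conjI allI ballI)
    show "sres ?K \<omega> \<in> smaps ?K (column X 2)" by (rule smor_sres[OF K w(1)])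
    fix m p assume p: "p \<in> simp ?K m"
    show "(hop X 2 [0, 2] m (sres ?K \<omega> m p), hop X 2 [0, 1] m (sres ?K \<omega> m p)) = p"
      unfolding sres_eq[OF p] using w(2)[of 1, OF _ _ p] w(2)[of 2, OF _ _ p] by simp
  qed
  then show ?thesis by blast
qed

locale bousfield_division =
  fixes X :: "'a bisset" and \<mu> :: "nat \<Rightarrow> 'a \<times> 'a \<Rightarrow> 'a"
  assumes bss: "bousfield_segal_space X" and mu_section: "bousfield_section X \<mu>"
begin

lemma bis: "is_bisset X" using bss_bisset[OF bss] .

lemma mu_smor: "smor (fibre_pairs X 0) (column X 2) \<mu>"
  using mu_section smaps_smor unfolding bousfield_section_def pairs_fibre by blast

lemma mu_edges:
  assumes "(f, g) \<in> simp (fibre_pairs X 0) m"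
  shows "\<mu> m (f, g) \<in> bisimp X 2 m" "hop X 2 [0, 2] m (\<mu> m (f, g)) = f" "hop X 2 [0, 1] m (\<mu> m (f, g)) = g"
proof -
  show "\<mu> m (f, g) \<in> bisimp X 2 m" using smor_in[OF mu_smor assms] by simp
  have "\<forall>m. \<forall>p\<in>simp (fibre_pairs X 0) m. (hop X 2 [0, 2] m (\<mu> m p), hop X 2 [0, 1] m (\<mu> m p)) = p"
    using mu_section unfolding bousfield_section_def pairs_fibre hface_hop by blast
  then show "hop X 2 [0, 2] m (\<mu> m (f, g)) = f" "hop X 2 [0, 1] m (\<mu> m (f, g)) = g" using assms by blast+
qed

lemma hop_edge_vertex:
  assumes "v \<le> 1" "i \<le> j" "j \<le> n" "x \<in> bisimp X n m"
  shows "hop X 1 [v] m (hop X n [i, j] m x) = hop X n [if v = 0 then i else j] m x"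
proof -
  have "ord_comp [i, j] [v] = [if v = 0 then i else j]" using assms(1) by (auto simp: ord_comp_def le_Suc_eq)
  then show ?thesis using hop_hop[OF bis pair_in[OF assms(2,3)] edge_ops(1)[OF assms(1)] assms(4)] by simp
qed

lemma mu_ends:
  assumes p: "(f, g) \<in> simp (fibre_pairs X 0) m"
  shows "ends X m (hop X 2 [1, 2] m (\<mu> m (f, g))) = (hop X 1 [1] m g, hop X 1 [1] m f)"
proof -
  note e = hop_edge_vertex[OF _ _ _ mu_edges(1)[OF p]]
  show ?thesis unfolding ends_def
    using e[of 0 1 2] e[of 1 1 2] e[of 1 0 1] e[of 1 0 2] mu_edges(2,3)[OF p] by simp
qed

lemma quot_pair:
  assumes "map_hom K X a b f" "map_hom K X a c g" "x \<in> simp K m"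
  shows "(f m x, g m x) \<in> simp (fibre_pairs X 0) m"
  using map_homD(4,6)[OF assms(1,3)] map_homD(4,6)[OF assms(2,3)] by simp

lemma map_quot_hom:
  assumes f: "map_hom K X a b f" and g: "map_hom K X a c g"
  shows "map_hom K X c b (map_quot X \<mu> f g)"
proof -
  have "smor K (fibre_pairs X 0) (\<lambda>m x. (f m x, g m x))"
    using map_homD(4)[OF f] map_homD(4)[OF g] by (intro fibre_pairs_pair map_homD(3)[OF f] map_homD(3)[OF g]) simp
  from smor_comp[OF smor_comp[OF this mu_smor] hop_smor[OF bis pair_in]]
  have "smor K (column X 1) (map_quot X \<mu> f g)" by (simp add: map_quot_def)
  then show ?thesis
    unfolding map_hom_def map_quot_def
    using map_homD(2)[OF f] map_homD(2)[OF g] mu_ends[OF quot_pair[OF f g]] map_homD(5)[OF f] map_homD(5)[OF g]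
    by (simp add: ends_def)
qed

lemma map_one_hom:
  assumes a: "smor K (column X 0) a"
  shows "map_hom K X a a (map_one X a)"
proof -
  have c: "[0, 0] \<in> ord_hom 1 0" by (rule pair_in) simp_all
  have "hop X 1 [v] m (hop X 0 [0, 0] m y) = y" if "v \<le> 1" "y \<in> bisimp X 0 m" for v m y
    using hop_edge_vertex[OF that(1) _ _ that(2), of 0 0] hop_id[OF bis that(2)] by (simp add: ord_id_0)
  then show ?thesis
    unfolding map_hom_def map_one_def using a smor_comp[OF a hop_smor[OF bis c]] smor_in[OF a] by simp
qed

lemma map_quot_cong:
  assumes K: "is_sset K" and f: "map_hom K X a b f" "map_hom K X a b f'" and g: "map_hom K X a c g" "map_hom K X a c g'"
    and ff: "homotopic_over K (column X 1) (ends X) f f'" and gg: "homotopic_over K (column X 1) (ends X) g g'"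
  shows "homotopic_over K (column X 1) (ends X) (map_quot X \<mu> f g) (map_quot X \<mu> f' g')"
proof -
  have 1: "homotopic_over K (fibre_pairs X 0) (pair_ends X) (\<lambda>m x. (f m x, g m x)) (\<lambda>m x. (f' m x, g' m x))"
    using map_homD(4)[OF f(1)] map_homD(4)[OF g(1)] by (intro homotopic_pair[OF ff gg]) simp_all
  have k: "smor (fibre_pairs X 0) (column X 1) (\<lambda>m p. hop X 2 [1, 2] m (\<mu> m p))"
    using smor_comp[OF mu_smor hop_smor[OF bis pair_in]] by simp
  show ?thesis unfolding map_quot_def
  proof (rule homotopic_over_post[OF 1 k])
    fix m p p' assume p: "p \<in> simp (fibre_pairs X 0) m" "p' \<in> simp (fibre_pairs X 0) m" "pair_ends X m p = pair_ends X m p'"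
    obtain u v u' v' where [simp]: "p = (u, v)" "p' = (u', v')" by (cases p, cases p')
    show "ends X m (hop X 2 [1, 2] m (\<mu> m p)) = ends X m (hop X 2 [1, 2] m (\<mu> m p'))"
      using p(3) mu_ends p(1,2) by (simp add: pair_ends_def ends_def)
  qed
qed

text \<open>The triangle \<open>i \<le> j \<le> k\<close> of \<open>\<omega>\<close> and the triangle chosen by \<open>\<mu>\<close> have the same two edges at the vertex \<open>i\<close>.\<close>

lemma quot_triangle:
  assumes K: "is_sset K" and w: "smor K (column X n) \<omega>" and ijk: "i \<le> j" "j \<le> k" "k \<le> n"
  shows "homotopic_over K (column X 1) (ends X) (\<lambda>m x. hop X n [j, k] m (\<omega> m x))
    (map_quot X \<mu> (\<lambda>m x. hop X n [i, k] m (\<omega> m x)) (\<lambda>m x. hop X n [i, j] m (\<omega> m x)))"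
proof -
  have t: "[i, j, k] \<in> ord_hom 2 n" using ijk by (simp add: ord_hom_def)
  let ?s = "\<lambda>m x. hop X n [i, j, k] m (\<omega> m x)"
  let ?f = "\<lambda>m x. hop X n [i, k] m (\<omega> m x)" and ?g = "\<lambda>m x. hop X n [i, j] m (\<omega> m x)"
  have w_in: "\<omega> m x \<in> bisimp X n m" if "x \<in> simp K m" for m x using smor_in[OF w that] by simp
  have s: "smor K (column X 2) ?s" by (rule smor_comp[OF w hop_smor[OF bis t]])
  have ed: "hop X 2 [a, b] m (?s m x) = hop X n [[i, j, k] ! a, [i, j, k] ! b] m (\<omega> m x)"
    if "x \<in> simp K m" "a \<le> b" "b \<le> 2" for a b m x
    using hop_hop[OF bis t pair_in[OF that(2,3)] w_in[OF that(1)]] by (simp add: ord_comp_def)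
  have f: "map_hom K X (\<lambda>m x. hop X n [i] m (\<omega> m x)) (\<lambda>m x. hop X n [k] m (\<omega> m x)) ?f"
    unfolding map_hom_def using ijk w_in
    by (intro conjI smor_comp[OF w hop_smor[OF bis]] single_in pair_in) (auto simp: hop_edge_vertex simp del: One_nat_def)
  have g: "map_hom K X (\<lambda>m x. hop X n [i] m (\<omega> m x)) (\<lambda>m x. hop X n [j] m (\<omega> m x)) ?g"
    unfolding map_hom_def using ijk w_in
    by (intro conjI smor_comp[OF w hop_smor[OF bis]] single_in pair_in) (auto simp: hop_edge_vertex simp del: One_nat_def)
  have fg: "smor K (fibre_pairs X 0) (\<lambda>m x. (?f m x, ?g m x))"
    using map_homD(4)[OF f] map_homD(4)[OF g] by (intro fibre_pairs_pair map_homD(3)[OF f] map_homD(3)[OF g]) simp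
  have "homotopic_over K (column X 1) (ends X) (\<lambda>m x. hop X 2 [1, 2] m (?s m x))
    (\<lambda>m x. hop X 2 [1, 2] m (\<mu> m (?f m x, ?g m x)))"
  proof (rule star_unique[OF bss K s smor_comp[OF fg mu_smor]])
    fix m x assume x: "x \<in> simp K m"
    show "hop X 2 [0, 1] m (?s m x) = hop X 2 [0, 1] m (\<mu> m (?f m x, ?g m x))"
      using ed[OF x, of 0 1] mu_edges(3)[OF quot_pair[OF f g x]] by simp
    show "hop X 2 [0, 2] m (?s m x) = hop X 2 [0, 2] m (\<mu> m (?f m x, ?g m x))"
      using ed[OF x, of 0 2] mu_edges(2)[OF quot_pair[OF f g x]] by simp
  qed
  then show ?thesis
    unfolding map_quot_def by (rule homotopic_over_cong[OF K]) (use ed[of _ _ 1 2] in simp_all)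
qed

text \<open>The degenerate triangle with vertices \<open>0, 1, 1\<close>.\<close>

lemma map_quot_self:
  assumes K: "is_sset K" and f: "map_hom K X a b f"
  shows "homotopic_over K (column X 1) (ends X) (map_quot X \<mu> f f) (map_one X b)"
proof (rule homotopic_over_sym, rule homotopic_over_cong[OF K quot_triangle[OF K map_homD(3)[OF f], of 0 1 1]])
  fix m x assume x: "x \<in> simp K m"
  note fi = map_homD(6)[OF f x]
  have "hop X 1 [1, 1] m (f m x) = hop X 0 [0, 0] m (hop X 1 [1] m (f m x))"
    using hop_hop[OF bis edge_ops(1) pair_in fi, of 1 0 0] by (simp add: ord_comp_def)
  then show "hop X 1 [1, 1] m (f m x) = map_one X b m x" using map_homD(5)[OF f x] by (simp add: map_one_def)
  have "hop X 1 [0, 1] m (f m x) = f m x" using hop_id[OF bis fi] by (simp add: ord_id_1[simplified])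
  then show "map_quot X \<mu> (\<lambda>m x. hop X 1 [0, 1] m (f m x)) (\<lambda>m x. hop X 1 [0, 1] m (f m x)) m x = map_quot X \<mu> f f m x"
    by (simp add: map_quot_def)
qed simp_all

text \<open>The degenerate triangle with vertices \<open>0, 0, 1\<close>.\<close>

lemma map_quot_one:
  assumes K: "is_sset K" and f: "map_hom K X a b f"
  shows "homotopic_over K (column X 1) (ends X) (map_quot X \<mu> f (map_one X a)) f"
proof (rule homotopic_over_sym, rule homotopic_over_cong[OF K quot_triangle[OF K map_homD(3)[OF f], of 0 0 1]])
  fix m x assume x: "x \<in> simp K m"
  note fi = map_homD(6)[OF f x]
  have 1: "hop X 1 [0, 0] m (f m x) = map_one X a m x"
    using hop_hop[OF bis edge_ops(1) pair_in fi, of 0 0 0] map_homD(4)[OF f x] by (simp add: ord_comp_def map_one_def)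
  show 2: "hop X 1 [0, 1] m (f m x) = f m x" using hop_id[OF bis fi] by (simp add: ord_id_1[simplified])
  show "map_quot X \<mu> (\<lambda>m x. hop X 1 [0, 1] m (f m x)) (\<lambda>m x. hop X 1 [0, 0] m (f m x)) m x =
      map_quot X \<mu> f (map_one X a) m x"
    by (simp only: map_quot_def 1 2)
qed simp_all

text \<open>A 3-simplex with edges \<open>f\<close>, \<open>g\<close>, \<open>h\<close> at the vertex 0 has the edges \<open>12 \<sim> g/f\<close>, \<open>13 \<sim> h/f\<close> and
  \<open>23 \<sim> h/g\<close> by its faces at the vertex 0, and \<open>23 \<sim> 13/12\<close> by the face opposite to it.\<close>

lemma map_quot_quot:
  assumes K: "is_sset K" and f: "map_hom K X a b f" and g: "map_hom K X a c g" and h: "map_hom K X a d h"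
  shows "homotopic_over K (column X 1) (ends X)
    (map_quot X \<mu> (map_quot X \<mu> h f) (map_quot X \<mu> g f)) (map_quot X \<mu> h g)"
proof -
  let ?F = "\<lambda>i. if i = 1 then f else if i = 2 then g else h"
  obtain \<omega> where w: "smor K (column X 3) \<omega>"
    "\<And>i m x. 0 < i \<Longrightarrow> i \<le> 3 \<Longrightarrow> x \<in> simp K m \<Longrightarrow> hop X 3 [0, i] m (\<omega> m x) = ?F i m x"
  proof (rule star_lift[OF bss _ K, of 3 ?F])
    fix i :: nat show "smor K (column X 1) (?F i)" using map_homD(3)[OF f] map_homD(3)[OF g] map_homD(3)[OF h] by simp
    fix m x assume "x \<in> simp K m"
    then show "hop X 1 [0] m (?F i m x) = hop X 1 [0] m (?F 1 m x)"
      using map_homD(4)[OF f] map_homD(4)[OF g] map_homD(4)[OF h] by simp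
  qed auto
  have w1: "hop X 3 [0, 1] m (\<omega> m x) = f m x" "hop X 3 [0, 2] m (\<omega> m x) = g m x" "hop X 3 [0, 3] m (\<omega> m x) = h m x"
    if "x \<in> simp K m" for m x
    using w(2)[of 1, OF _ _ that] w(2)[of 2, OF _ _ that] w(2)[of 3, OF _ _ that] by auto
  let ?e = "\<lambda>i j m x. hop X 3 [i, j] m (\<omega> m x)"
  let ?E = "homotopic_over K (column X 1) (ends X)"
  have w_in: "\<omega> m x \<in> bisimp X 3 m" if "x \<in> simp K m" for m x using smor_in[OF w(1) that] by simp
  have vert: "hop X 1 [v] m (?e i j m x) = hop X 3 [if v = 0 then i else j] m (\<omega> m x)"
    if "x \<in> simp K m" "v \<le> 1" "i \<le> j" "j \<le> 3" for v i j m x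
    by (rule hop_edge_vertex[OF that(2-4) w_in[OF that(1)]])
  have v1: "hop X 3 [1] m (\<omega> m x) = b m x" "hop X 3 [2] m (\<omega> m x) = c m x" "hop X 3 [3] m (\<omega> m x) = d m x"
    if "x \<in> simp K m" for m x
    using vert[OF that, of 1 0 1] vert[OF that, of 1 0 2] vert[OF that, of 1 0 3] w1[OF that]
      map_homD(5)[OF f that] map_homD(5)[OF g that] map_homD(5)[OF h that] by auto
  have e12: "map_hom K X b c (?e 1 2)" and e13: "map_hom K X b d (?e 1 3)"
    unfolding map_hom_def
    using map_homD(2)[OF f] map_homD(2)[OF g] map_homD(2)[OF h] smor_comp[OF w(1) hop_smor[OF bis pair_in]]
      vert[of _ _ 0 1 2] vert[of _ _ 1 1 2] vert[of _ _ 0 1 3] vert[of _ _ 1 1 3] v1 by auto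
  have t12: "?E (?e 1 2) (map_quot X \<mu> g f)"
    by (rule homotopic_over_cong[OF K quot_triangle[OF K w(1), of 0 1 2]]) (simp_all add: map_quot_def w1[simplified])
  have t13: "?E (?e 1 3) (map_quot X \<mu> h f)"
    by (rule homotopic_over_cong[OF K quot_triangle[OF K w(1), of 0 1 3]]) (simp_all add: map_quot_def w1[simplified])
  have t23: "?E (?e 2 3) (map_quot X \<mu> h g)"
    by (rule homotopic_over_cong[OF K quot_triangle[OF K w(1), of 0 2 3]]) (simp_all add: map_quot_def w1[simplified])
  have "?E (?e 2 3) (map_quot X \<mu> (?e 1 3) (?e 1 2))"
    by (rule quot_triangle[OF K w(1)]) simp_all
  moreover have "?E (map_quot X \<mu> (map_quot X \<mu> h f) (map_quot X \<mu> g f)) (map_quot X \<mu> (?e 1 3) (?e 1 2))"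
    by (rule map_quot_cong[OF K map_quot_hom[OF h f] e13 map_quot_hom[OF g f] e12
          homotopic_over_sym[OF t13] homotopic_over_sym[OF t12]])
  ultimately show ?thesis
    using homotopic_over_trans[OF _ homotopic_over_trans[OF homotopic_over_sym t23]] by blast
qed

lemma ward_maps:
  assumes K: "is_sset K"
  shows "ward_groupoid (map_hom K X) (homotopic_over K (column X 1) (ends X)) (map_quot X \<mu>) (map_one X)
    (\<lambda>a. smor K (column X 0) a)"
proof unfold_locales
  fix a b f assume "map_hom K X a b f"
  then show "homotopic_over K (column X 1) (ends X) f f" using map_homD(3) by (simp add: homotopic_over_def)
next
  fix a b f assume "map_hom K X a b f"
  then show "smor K (column X 0) a \<and> smor K (column X 0) b" using map_homD(1,2) by blast
qed (rule homotopic_over_sym homotopic_over_trans map_one_hom map_quot_hom map_quot_cong[OF K]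
  map_quot_self[OF K] map_quot_one[OF K] map_quot_quot[OF K]; assumption)+

text \<open>The spine of \<open>\<Delta>\<^sup>2\<close> is a graph, so pairs of composable edges are maps out of it, and restriction to a subcomplex
  is a Kan fibration.\<close>

lemma segal_map_kanfib:
  "kanfib (column X 2) (fibre_pairs X 1) (\<lambda>m \<sigma>. (hop X 2 [0, 1] m \<sigma>, hop X 2 [1, 2] m \<sigma>))"
proof -
  let ?K = "fibre_pairs X 1"
  have K: "is_sset ?K" by (rule is_sset_fibre_pairs[OF bis]) simp
  define V where "V i m p = (if i = 0 then hop X 1 [0] m (fst p) else hop X 1 [1] m (if i = 1 then fst p else snd p))"
    for i :: nat and m and p :: "'a \<times> 'a"
  define F where "F i j m p = (if j = 1 then fst p else snd p)" for i j m :: nat and p :: "'a \<times> 'a"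
  have h: "smor (column X 1) (column X 0) (hop X 1 [v])" if "v \<le> 1" for v
    using hop_smor[OF bis edge_ops(1)[OF that]] .
  have edge: "i = 0 \<and> j = 1 \<or> i = 1 \<and> j = 2" if "i < j" "spine_faces {i, j}" for i j using that by auto
  interpret G: graph_family X 2 spine_faces ?K V F
  proof (unfold_locales)
    show "is_bisset X" "graph 2 spine_faces" "is_sset ?K" using bis graph_spine K by auto
    fix i :: nat assume i: "i \<le> 2"
    show "smor ?K (column X 0) (V i)"
      using smor_comp[OF fibre_pairs_proj(1) h] smor_comp[OF fibre_pairs_proj(2) h] unfolding V_def
      by (cases "i = 0"; cases "i = 1") auto
  next
    fix i j :: nat assume ij: "i < j" "j \<le> 2" "spine_faces {i, j}"
    show "smor ?K (column X 1) (F i j)" using fibre_pairs_proj[of X 1] unfolding F_def by (cases "j = 1") auto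
    fix m p assume p: "p \<in> simp ?K m"
    then obtain f g where [simp]: "p = (f, g)" by (cases p)
    show "hop X 1 [0] m (F i j m p) = V i m p" using edge[OF ij(1,3)] p by (auto simp: F_def V_def)
    show "hop X 1 [1] m (F i j m p) = V j m p" using edge[OF ij(1,3)] by (auto simp: F_def V_def)
  qed
  let ?A = "subsimplex 2 spine_faces"
  have fib: "kanfib (column X 2) (ldiv ?A X) (ldiv_restrict X 2 ?A)"
    by (rule column_restriction_kanfib[OF bss_fibrant[OF bss] graph_down[OF graph_spine]])
  have pi: "[0, 1] \<in> ord_hom 1 2" "[1, 2] \<in> ord_hom 1 2" by (rule pair_in; simp)+
  have sm: "smor (column X 2) ?K (\<lambda>m \<sigma>. (hop X 2 [0, 1] m \<sigma>, hop X 2 [1, 2] m \<sigma>))"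
  proof (rule fibre_pairs_pair[OF hop_smor[OF bis pi(1)] hop_smor[OF bis pi(2)]])
    fix m x assume "x \<in> simp (column X 2) m"
    then have x: "x \<in> bisimp X 2 m" by simp
    show "hop X 1 [1] m (hop X 2 [0, 1] m x) = hop X 1 [0] m (hop X 2 [1, 2] m x)"
      using hop_edge_vertex[OF _ _ _ x, of 1 0 1] hop_edge_vertex[OF _ _ _ x, of 0 1 2] by simp
  qed
  show ?thesis
  proof (rule kanfibI[OF sm])
    fix m k u b assume mk: "1 \<le> m" "k \<le> m" and b: "b \<in> simp ?K m" and u: "smor (horn m k) (column X 2) u"
      and ub: "\<And>j \<kappa>. \<kappa> \<in> simp (horn m k) j \<Longrightarrow> (hop X 2 [0, 1] j (u j \<kappa>), hop X 2 [1, 2] j (u j \<kappa>)) = act ?K m \<kappa> b"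
    have ub': "ldiv_restrict X 2 ?A j (u j \<kappa>) = act (ldiv ?A X) m \<kappa> (G.fam m b)" if kk: "\<kappa> \<in> simp (horn m k) j" for j \<kappa>
    proof -
      have k: "\<kappa> \<in> ord_hom j m" using kk by simp
      let ?b = "act ?K m \<kappa> b"
      have bk: "?b \<in> simp ?K j" using sset_act[OF K k b] .
      have uk: "u j \<kappa> \<in> bisimp X 2 j" using smor_in[OF u kk] by simp
      have fs: "fst ?b = hop X 2 [0, 1] j (u j \<kappa>)" "snd ?b = hop X 2 [1, 2] j (u j \<kappa>)"
        unfolding ub[OF kk, symmetric] by simp_all
      note v = hop_edge_vertex[OF _ _ _ uk]
      have "ldiv_restrict X 2 ?A j (u j \<kappa>) = G.fam j ?b"
      proof (rule G.fam_restrict[OF bk uk])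
        fix i :: nat assume "i \<le> 2"
        then have "i = 0 \<or> i = 1 \<or> i = 2" by auto
        then show "hop X 2 [i] j (u j \<kappa>) = V i j ?b"
          using v[of 0 0 1] v[of 1 0 1] v[of 1 1 2] unfolding V_def fs by auto
      next
        fix i i' :: nat assume "i < i'" "i' \<le> 2" "spine_faces {i, i'}"
        then show "hop X 2 [i, i'] j (u j \<kappa>) = F i i' j ?b" using edge[of i i'] unfolding F_def fs by auto
      qed
      also have "\<dots> = act (ldiv ?A X) m \<kappa> (G.fam m b)" by (rule smor_nat[OF G.fam_smor k b])
      finally show ?thesis .
    qed
    have "\<exists>e\<in>simp (column X 2) m. ldiv_restrict X 2 ?A m e = G.fam m b \<and>
        (\<forall>j. \<forall>\<kappa>\<in>simp (horn m k) j. act (column X 2) m \<kappa> e = u j \<kappa>)"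
      by (rule kanfib_lift[where p="ldiv_restrict X 2 ?A" and u=u, OF fib mk G.fam_in[OF b] u ub'])
        (assumption, intro bexI conjI allI ballI)
    then obtain e where e: "e \<in> simp (column X 2) m" "ldiv_restrict X 2 ?A m e = G.fam m b"
      "\<forall>j. \<forall>\<kappa>\<in>simp (horn m k) j. act (column X 2) m \<kappa> e = u j \<kappa>" by (elim bexE conjE)
    have e2: "e \<in> bisimp X 2 m" using e(1) by simp
    have "hop X 2 [0, 1] m e = F 0 1 m b" "hop X 2 [1, 2] m e = F 1 2 m b"
      by (rule G.restrict_fam_edge[OF e2 e(2) b]; simp)+
    then have "(hop X 2 [0, 1] m e, hop X 2 [1, 2] m e) = b" by (simp add: F_def)
    then show "\<exists>e\<in>simp (column X 2) m. (hop X 2 [0, 1] m e, hop X 2 [1, 2] m e) = b \<and>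
        (\<forall>j. \<forall>\<kappa>\<in>simp (horn m k) j. act (column X 2) m \<kappa> e = u j \<kappa>)"
      using e(1,3) by (intro bexI[of _ e] conjI)
  qed
qed

text \<open>The triangle \<open>\<mu>(g \<circ> f, f)\<close> has the edges \<open>01 = f\<close>, \<open>02 = g \<circ> f\<close> and \<open>12 = (g \<circ> f)/f \<sim> g\<close>, so it is a section
  of the Segal map up to a homotopy that fixes end points and hence stays among composable pairs.\<close>

theorem exists_segal_section: "\<exists>\<eta>. segal_section X \<eta>"
proof -
  let ?K = "fibre_pairs X 1"
  have K: "is_sset ?K" by (rule is_sset_fibre_pairs[OF bis]) simp
  interpret W: ward_groupoid "map_hom ?K X" "homotopic_over ?K (column X 1) (ends X)" "map_quot X \<mu>" "map_one X"
    "\<lambda>a. smor ?K (column X 0) a" by (rule ward_maps[OF K])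
  let ?f = "\<lambda>m. fst :: 'a \<times> 'a \<Rightarrow> 'a" and ?g = "\<lambda>m. snd :: 'a \<times> 'a \<Rightarrow> 'a"
  define a where "a m p = hop X 1 [0] m (fst p)" for m and p :: "'a \<times> 'a"
  define b where "b m p = hop X 1 [1] m (fst p)" for m and p :: "'a \<times> 'a"
  define c where "c m p = hop X 1 [1] m (snd p)" for m and p :: "'a \<times> 'a"
  note proj = fibre_pairs_proj[of X 1]
  have f: "map_hom ?K X a b ?f"
    unfolding map_hom_def a_def b_def
    by (intro conjI smor_comp[OF proj(1) hop_smor[OF bis edge_ops(1)]] proj(1)) simp_all
  have g: "map_hom ?K X b c ?g"
    unfolding map_hom_def b_def c_def
    by (intro conjI smor_comp[OF proj(1) hop_smor[OF bis edge_ops(1)]] smor_comp[OF proj(2) hop_smor[OF bis edge_ops(1)]] proj(2)) auto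
  let ?k = "W.comp a ?g ?f"
  have k: "map_hom ?K X a c ?k" by (rule W.comp_Hom[OF f g])
  define r where "r m p = \<mu> m (?k m p, fst p)" for m p
  have r: "smor ?K (column X 2) r"
  proof -
    have "smor ?K (fibre_pairs X 0) (\<lambda>m p. (?k m p, fst p))"
      using map_homD(4)[OF k] map_homD(4)[OF f] by (intro fibre_pairs_pair map_homD(3)[OF k] proj(1)) simp
    from smor_comp[OF this mu_smor] show ?thesis unfolding r_def .
  qed
  let ?xi = "\<lambda>m \<sigma>. (hop X 2 [0, 1] m \<sigma>, hop X 2 [1, 2] m \<sigma>)"
  have xr: "?xi m (r m p) = (fst p, map_quot X \<mu> ?k ?f m p)" if "p \<in> simp ?K m" for m p
    using mu_edges(3)[OF quot_pair[OF k f that]] by (simp add: r_def map_quot_def)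
  have "homotopic_over ?K ?K (pair_ends X) (\<lambda>m p. (fst p, snd p)) (\<lambda>m p. (fst p, map_quot X \<mu> ?k ?f m p))"
  proof (rule homotopic_pair[OF W.E_refl[OF f] W.E_sym[OF W.comp_quot_cancel[OF f g]] order_refl])
    fix m p assume "p \<in> simp ?K m"
    then show "hop X 1 [1] m (fst p) = hop X 1 [0] m (snd p)" by (cases p) simp
  qed
  then have "homotopic_over ?K ?K (pair_ends X) (\<lambda>m p. (fst p, snd p)) (\<lambda>m p. ?xi m (r m p))"
    by (rule homotopic_over_cong[OF K]) (simp_all only: xr)
  from section_of_homotopy_section[OF K is_sset_column[OF bis] segal_map_kanfib r homotopic_over_sym[OF this]]
  obtain s where s: "smor ?K (column X 2) s" "\<forall>m. \<forall>p\<in>simp ?K m. ?xi m (s m p) = (fst p, snd p)"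
    by (elim exE conjE)
  have "segal_section X (sres ?K s)"
    unfolding segal_section_def pairs_fibre hface_hop
  proof (intro conjI allI ballI)
    show "sres ?K s \<in> smaps ?K (column X 2)" by (rule smor_sres[OF K s(1)])
    fix m p assume p: "p \<in> simp ?K m"
    then show "(hop X 2 [0, 1] m (sres ?K s m p), hop X 2 [1, 2] m (sres ?K s m p)) = p"
      unfolding sres_eq[OF p] using s(2) by simp
  qed
  then show ?thesis by blast
qed

end

declare One_nat_def [simp del]

section \<open>The homotopy category\<close>

text \<open>The map \<open>\<Delta>\<^sup>0 \<rightarrow> X\<^sub>n\<close> with value \<open>f\<close>. It transfers the laws for families to vertices.\<close>

definition pt :: "'a bisset \<Rightarrow> nat \<Rightarrow> 'a \<Rightarrow> nat \<Rightarrow> nat list \<Rightarrow> 'a" where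
  "pt X n f = (\<lambda>m \<alpha>. bact X n 0 (ord_id n) \<alpha> f)"

lemma pt_smor: "is_bisset X \<Longrightarrow> f \<in> bisimp X n 0 \<Longrightarrow> smor (simplex 0) (column X n) (pt X n f)"
  using yoneda[OF is_sset_column, of X f n 0] by (simp add: pt_def)

lemma pt_at_zero: "is_bisset X \<Longrightarrow> f \<in> bisimp X n 0 \<Longrightarrow> pt X n f 0 [0] = f"
  unfolding pt_def ord_id_0[symmetric] by (rule bi_id)

lemma hop_pt:
  assumes "is_bisset X" "\<beta> \<in> ord_hom k n" "f \<in> bisimp X n 0" "\<alpha> \<in> ord_hom m 0"
  shows "hop X n \<beta> m (pt X n f m \<alpha>) = pt X k (hop X n \<beta> 0 f) m \<alpha>"
  unfolding pt_def hop_bact[OF assms(1) ord_id_in assms(2,4,3)] hop_vert[OF assms(1,2) ord_id_in assms(4,3)]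
    ord_comp_id_left[OF assms(2)] ord_comp_id_right[OF assms(2)] ..

lemma const_simplex_pt: "const_simplex X m x = pt X 0 x m (ord_const m 0)"
  by (simp add: const_simplex_def pt_def)

lemma map_space_simp: "simp (map_space X x y) m = {f \<in> bisimp X 1 m. x \<in> bisimp X 0 0 \<and> y \<in> bisimp X 0 0 \<and>
    ends X m f = (const_simplex X m x, const_simplex X m y)}"
  unfolding map_space_def hface_hop ends_def by auto

lemma map_space_act: "act (map_space X x y) = act (column X 1)"
  by (simp add: map_space_def)

lemma map_space_vertexD:
  assumes X: "is_bisset X" and f: "f \<in> simp (map_space X x y) 0"
  shows "f \<in> bisimp X 1 0" "x \<in> bisimp X 0 0" "y \<in> bisimp X 0 0" "hop X 1 [0] 0 f = x" "hop X 1 [1] 0 f = y"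
proof -
  show f': "f \<in> bisimp X 1 0" "x \<in> bisimp X 0 0" "y \<in> bisimp X 0 0" using f unfolding map_space_simp by auto
  have "const_simplex X 0 z = z" if "z \<in> bisimp X 0 0" for z
    using pt_at_zero[OF X that] by (simp add: const_simplex_pt replicate_Suc)
  then show "hop X 1 [0] 0 f = x" "hop X 1 [1] 0 f = y" using f f' unfolding map_space_simp ends_def by auto
qed

lemma map_space_vertexI:
  assumes X: "is_bisset X" and "f \<in> bisimp X 1 0" "x \<in> bisimp X 0 0" "y \<in> bisimp X 0 0" "hop X 1 [0] 0 f = x" "hop X 1 [1] 0 f = y"
  shows "f \<in> simp (map_space X x y) 0"
proof -
  have "const_simplex X 0 z = z" if "z \<in> bisimp X 0 0" for z
    using pt_at_zero[OF X that] by (simp add: const_simplex_pt replicate_Suc)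
  then show ?thesis using assms unfolding map_space_simp ends_def by auto
qed

lemma map_space_pt:
  assumes X: "is_bisset X" and f: "f \<in> simp (map_space X x y) 0"
  shows "map_hom (simplex 0) X (pt X 0 x) (pt X 0 y) (pt X 1 f)"
  unfolding map_hom_def
  using map_space_vertexD[OF X f] pt_smor[OF X]
    hop_pt[OF X edge_ops(1)[of 0] map_space_vertexD(1)[OF X f]] hop_pt[OF X edge_ops(1)[of 1] map_space_vertexD(1)[OF X f]]
  by auto

definition vertex_homotopic :: "'a bisset \<Rightarrow> 'a \<Rightarrow> 'a \<Rightarrow> bool" where
  "vertex_homotopic X f g \<longleftrightarrow> homotopic_over (simplex 0) (column X 1) (ends X) (pt X 1 f) (pt X 1 g)"

lemma is_sset_map_space_act:
  assumes X: "is_bisset X" and e: "e \<in> simp (map_space X x y) m" and b: "\<beta> \<in> ord_hom k m"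
  shows "act (column X 1) m \<beta> e \<in> simp (map_space X x y) k"
proof -
  have e': "e \<in> bisimp X 1 m" "x \<in> bisimp X 0 0" "y \<in> bisimp X 0 0"
    "ends X m e = (const_simplex X m x, const_simplex X m y)" using e unfolding map_space_simp by auto
  have c: "const_simplex X k z = act (column X 0) m \<beta> (const_simplex X m z)" if "z \<in> bisimp X 0 0" for z
    using smor_nat[OF pt_smor[OF X that] b, of "ord_const m 0"] ord_comp_const_left[OF b]
    by (simp add: const_simplex_pt ord_hom_0)
  have "hop X 1 [v] k (act (column X 1) m \<beta> e) = act (column X 0) m \<beta> (hop X 1 [v] m e)" if "v \<le> 1" for v
    using smor_nat[OF hop_smor[OF X edge_ops(1)[OF that]] b, of e] e'(1) by simp
  then have "ends X k (act (column X 1) m \<beta> e) = (const_simplex X k x, const_simplex X k y)"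
    using e'(4) c[OF e'(2)] c[OF e'(3)] unfolding ends_def by simp
  then show ?thesis unfolding map_space_simp using e' bi_act[OF X ord_id_in b e'(1)] by simp
qed

text \<open>An edge of the mapping space is a homotopy on \<open>\<Delta>\<^sup>0\<close> that is constant on end points, because the end points
  of a simplex of the mapping space are degenerate.\<close>

lemma map_space_pi0:
  assumes X: "is_bisset X" and f: "f \<in> simp (map_space X x y) 0" and f': "f' \<in> simp (map_space X x y) 0"
  shows "(f, f') \<in> pi0_rel (map_space X x y) \<longleftrightarrow> vertex_homotopic X f f'"
proof
  let ?M = "map_space X x y"
  assume "(f, f') \<in> pi0_rel ?M"
  then have "(f, f') \<in> (edge_rel ?M)\<^sup>*" by (simp add: pi0_rel_edge)
  then show "vertex_homotopic X f f'"
  proof (induction rule: rtrancl_induct)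
    case base
    show ?case using pt_smor[OF X map_space_vertexD(1)[OF X f]] by (simp add: vertex_homotopic_def homotopic_over_def)
  next
    case (step a b)
    obtain \<epsilon> e where e: "\<epsilon> = 0 \<or> \<epsilon> = 1" "e \<in> simp ?M 1" "a = act ?M 1 [\<epsilon>] e" "b = act ?M 1 [1 - \<epsilon>] e"
      using edge_relE[OF step.hyps(2)] by blast
    have e': "e \<in> bisimp X 1 1" using e(2) unfolding map_space_simp by simp
    have v: "[\<epsilon>] \<in> ord_hom 0 1" "[1 - \<epsilon>] \<in> ord_hom 0 1" using e(1) by (auto intro!: single_in)
    have C: "is_sset (column X 1)" using is_sset_column[OF X] .
    have ab: "a \<in> simp ?M 0" "b \<in> simp ?M 0"
      using is_sset_map_space_act[OF X e(2)] v unfolding e(3,4) map_space_act by auto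
    have pt_edge: "act (column X 1) 1 (ord_const m \<delta>) e = pt X 1 (act ?M 1 [\<delta>] e) m (ord_const m 0)"
      if "[\<delta>] \<in> ord_hom 0 1" for m \<delta>
    proof -
      have "ord_const m 0 \<in> ord_hom m 0" by (simp add: ord_hom_0)
      from sset_comp[OF C that this, of e] e' show ?thesis
        by (simp add: pt_def map_space_act ord_comp_const_right)
    qed
    have "hlink (simplex 0) (column X 1) (ends X) (pt X 1 a) (pt X 1 b)"
    proof (rule hlinkI[OF pt_smor[OF X map_space_vertexD(1)[OF X ab(1)]] pt_smor[OF X map_space_vertexD(1)[OF X ab(2)]] e(1)])
      show "smor (sprod (simplex 0) (simplex 1)) (column X 1) (\<lambda>m z. act (column X 1) 1 (snd z) e)"
        by (rule smorI) (use sset_act[OF C _, of _ _ 1 e] sset_comp[OF C, of _ _ 1 _ _ e] e' in auto)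
      fix m \<alpha> assume "\<alpha> \<in> simp (simplex 0) m"
      then have al: "\<alpha> = ord_const m 0" by (simp add: ord_hom_0)
      show "act (column X 1) 1 (snd (\<alpha>, ord_const m \<epsilon>)) e = pt X 1 a m \<alpha>"
        "act (column X 1) 1 (snd (\<alpha>, ord_const m (1 - \<epsilon>))) e = pt X 1 b m \<alpha>"
        unfolding snd_conv al e(3,4) by (rule pt_edge, rule v)+
      fix \<tau> :: "nat list" assume t: "\<tau> \<in> ord_hom m 1"
      have "pt X 1 a m \<alpha> = act (column X 1) 1 (ord_const m \<epsilon>) e"
        unfolding al e(3) by (rule pt_edge[OF v(1), symmetric])
      moreover have "act (column X 1) 1 \<tau> e \<in> simp ?M m" "act (column X 1) 1 (ord_const m \<epsilon>) e \<in> simp ?M m"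
        using is_sset_map_space_act[OF X e(2)] t const01(1)[OF e(1)] by auto
      ultimately show "ends X m (act (column X 1) 1 (snd (\<alpha>, \<tau>)) e) = ends X m (pt X 1 a m \<alpha>)"
        unfolding map_space_simp by simp
    qed
    then show ?case
      using homotopic_over_trans[OF _ homotopic_over_link] step.IH unfolding vertex_homotopic_def by blast
  qed
next
  let ?M = "map_space X x y"
  assume "vertex_homotopic X f f'"
  then have h: "homotopic_over (simplex 0) (column X 1) (ends X) (pt X 1 f) (pt X 1 f')" by (simp add: vertex_homotopic_def)
  note fD = map_space_vertexD[OF X f] and f'D = map_space_vertexD[OF X f']
  have "(f, g 0 [0]) \<in> (edge_rel ?M)\<^sup>*" if "homotopic_over (simplex 0) (column X 1) (ends X) (pt X 1 f) g" for g
    using that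
  proof (induction rule: homotopic_over_induct)
    case refl show ?case using pt_at_zero[OF X fD(1)] by simp
  next
    case (link g g')
    obtain \<epsilon> H where "fib_homotopy (simplex 0) (column X 1) (ends X) g g' \<epsilon> H" by (rule hlinkE[OF link.hyps(2)])
    note H = fib_homotopyD[OF this]
    let ?z = "(ord_const 1 0, [0, 1])"
    have c: "ord_const 1 0 \<in> simp (simplex 0) 1" by (simp add: ord_hom_0)
    have i: "[0, 1] \<in> ord_hom 1 1" by (rule pair_in) simp_all
    have z: "?z \<in> simp (sprod (simplex 0) (simplex 1)) 1" using c i by simp
    define e where "e = H 1 ?z"
    have "ends X 1 e = ends X 1 (g 1 (ord_const 1 0))" unfolding e_def by (rule H(5)[OF c i])
    also have "\<dots> = ends X 1 (pt X 1 f 1 (ord_const 1 0))" using homotopic_over_same[OF link.hyps(1) c] by simp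
    also have "\<dots> = (const_simplex X 1 x, const_simplex X 1 y)"
      using map_homD(4,5)[OF map_space_pt[OF X f] c] by (simp add: ends_def const_simplex_pt)
    finally have e: "e \<in> simp ?M 1" using smor_in[OF H(2) z] fD unfolding map_space_simp e_def by simp
    have ev: "act ?M 1 [\<delta>] e = H 0 ([0], [\<delta>])" if "\<delta> = 0 \<or> \<delta> = 1" for \<delta>
    proof -
      have d: "[\<delta>] \<in> ord_hom 0 1" using that by (auto intro!: single_in)
      show ?thesis
        using smor_nat[OF H(2) d z] that ord_comp_const_left[OF d, of 0]
        by (auto simp: map_space_act e_def ord_comp_def replicate_Suc simp del: column_simps)
    qed
    have c0: "[0] \<in> simp (simplex 0) 0" by (simp add: single_in)
    have "g 0 [0] = act ?M 1 [\<epsilon>] e" "g' 0 [0] = act ?M 1 [1 - \<epsilon>] e"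
      using H(3,4)[OF c0] ev[of \<epsilon>] ev[of "1 - \<epsilon>"] H(1) by (auto simp: replicate_Suc)
    then have "(g 0 [0], g' 0 [0]) \<in> edge_rel ?M" using edge_relI[OF e] H(1) by auto
    with link.IH show ?case by (rule rtrancl_into_rtrancl)
  qed
  from this[OF h] have "(f, f') \<in> (edge_rel ?M)\<^sup>*" using pt_at_zero[OF X f'D(1)] by simp
  then show "(f, f') \<in> pi0_rel ?M" using f f' by (simp add: pi0_rel_edge)
qed

context bousfield_division
begin

lemma pair_vertex:
  assumes "f \<in> simp (map_space X x y) 0" "g \<in> simp (map_space X x z) 0"
  shows "(f, g) \<in> simp (fibre_pairs X 0) 0"
  using map_space_vertexD[OF bis assms(1)] map_space_vertexD[OF bis assms(2)] by simp

lemma div_hop: "bousfield_div X \<mu> f g = hop X 2 [1, 2] 0 (\<mu> 0 (f, g))"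
  unfolding bousfield_div_def hface_hop ..

lemma div_hom:
  assumes f: "f \<in> simp (map_space X x y) 0" and g: "g \<in> simp (map_space X x z) 0"
  shows "bousfield_div X \<mu> f g \<in> simp (map_space X z y) 0"
proof -
  note p = pair_vertex[OF f g]
  have "ends X 0 (bousfield_div X \<mu> f g) = (z, y)"
    unfolding div_hop mu_ends[OF p] using map_space_vertexD[OF bis f] map_space_vertexD[OF bis g] by simp
  moreover have "bousfield_div X \<mu> f g \<in> bisimp X 1 0"
    unfolding div_hop by (rule hop_in[OF bis pair_in mu_edges(1)[OF p]]) simp_all
  ultimately show ?thesis
    using map_space_vertexD(3)[OF bis f] map_space_vertexD(3)[OF bis g]
    by (intro map_space_vertexI[OF bis]) (auto simp: ends_def)
qed

lemma pt_div:
  assumes f: "f \<in> simp (map_space X x y) 0" and g: "g \<in> simp (map_space X x z) 0" and a: "\<alpha> \<in> ord_hom m 0"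
  shows "pt X 1 (bousfield_div X \<mu> f g) m \<alpha> = map_quot X \<mu> (pt X 1 f) (pt X 1 g) m \<alpha>"
proof -
  note p = pair_vertex[OF f g]
  have o: "[1, 2] \<in> ord_hom 1 2" by (rule pair_in) simp_all
  have "\<mu> m (pt X 1 f m \<alpha>, pt X 1 g m \<alpha>) = pt X 2 (\<mu> 0 (f, g)) m \<alpha>"
    using smor_nat[OF mu_smor a p] by (simp add: pt_def)
  then show ?thesis
    unfolding map_quot_def div_hop by (simp only: hop_pt[OF bis o mu_edges(1)[OF p] a])
qed

lemma id_edge_hop: "id_edge X x = hop X 0 [0, 0] 0 x"
  unfolding id_edge_def hface_hop ..

lemma id_edge_hom:
  assumes x: "x \<in> bisimp X 0 0"
  shows "id_edge X x \<in> simp (map_space X x x) 0"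
proof -
  have o: "[0, 0] \<in> ord_hom 1 0" by (rule pair_in) simp_all
  have "hop X 1 [v] 0 (id_edge X x) = x" if "v \<le> 1" for v
    unfolding id_edge_hop using hop_edge_vertex[OF that _ _ x, of 0 0] hop_id[OF bis x] by (simp add: ord_id_0)
  then show ?thesis using hop_in[OF bis o x] x by (intro map_space_vertexI[OF bis]) (auto simp: id_edge_hop)
qed

lemma pt_id_edge:
  assumes x: "x \<in> bisimp X 0 0" and a: "\<alpha> \<in> ord_hom m 0"
  shows "pt X 1 (id_edge X x) m \<alpha> = map_one X (pt X 0 x) m \<alpha>"
proof -
  have o: "[0, 0] \<in> ord_hom 1 0" by (rule pair_in) simp_all
  show ?thesis unfolding id_edge_hop map_one_def by (rule hop_pt[OF bis o x a, symmetric])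
qed

lemma ward_vertices:
  "ward_groupoid (\<lambda>x y f. f \<in> simp (map_space X x y) 0) (vertex_homotopic X) (bousfield_div X \<mu>) (id_edge X)
    (\<lambda>x. x \<in> bisimp X 0 0)"
proof -
  let ?K = "simplex 0"
  let ?E = "homotopic_over ?K (column X 1) (ends X)"
  have K: "is_sset ?K" by (rule is_sset_simplex)
  interpret W: ward_groupoid "map_hom ?K X" ?E "map_quot X \<mu>" "map_one X" "\<lambda>a. smor ?K (column X 0) a"
    by (rule ward_maps[OF K])
  note H = map_space_pt[OF bis]
  show ?thesis
  proof unfold_locales
    fix x y f assume f: "f \<in> simp (map_space X x y) 0"
    show "vertex_homotopic X f f" unfolding vertex_homotopic_def by (rule W.E_refl[OF H[OF f]])
    show "x \<in> bisimp X 0 0 \<and> y \<in> bisimp X 0 0" using map_space_vertexD[OF bis f] by simp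
    then have x: "x \<in> bisimp X 0 0" and y: "y \<in> bisimp X 0 0" by auto
    show "vertex_homotopic X (bousfield_div X \<mu> f f) (id_edge X y)"
      unfolding vertex_homotopic_def
      by (rule homotopic_over_cong[OF K W.quot_self[OF H[OF f]]]) (simp_all add: pt_div[OF f f] pt_id_edge[OF y])
    show "vertex_homotopic X (bousfield_div X \<mu> f (id_edge X x)) f"
      unfolding vertex_homotopic_def
      by (rule homotopic_over_cong[OF K W.quot_one[OF H[OF f]]])
        (simp_all add: pt_div[OF f id_edge_hom[OF x]] map_quot_def pt_id_edge[OF x])
  next
    fix f g assume "vertex_homotopic X f g"
    then show "vertex_homotopic X g f" unfolding vertex_homotopic_def by (rule W.E_sym)
  next
    fix f g h assume "vertex_homotopic X f g" "vertex_homotopic X g h"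
    then show "vertex_homotopic X f h" unfolding vertex_homotopic_def by (rule W.E_trans)
  next
    fix x assume "x \<in> bisimp X 0 0" then show "id_edge X x \<in> simp (map_space X x x) 0" by (rule id_edge_hom)
  next
    fix x y z f g assume "f \<in> simp (map_space X x y) 0" "g \<in> simp (map_space X x z) 0"
    then show "bousfield_div X \<mu> f g \<in> simp (map_space X z y) 0" by (rule div_hom)
  next
    fix x y z f f' g g'
    assume f: "f \<in> simp (map_space X x y) 0" and f': "f' \<in> simp (map_space X x y) 0"
      and g: "g \<in> simp (map_space X x z) 0" and g': "g' \<in> simp (map_space X x z) 0"
      and e: "vertex_homotopic X f f'" "vertex_homotopic X g g'"
    show "vertex_homotopic X (bousfield_div X \<mu> f g) (bousfield_div X \<mu> f' g')"
      unfolding vertex_homotopic_def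
      by (rule homotopic_over_cong[OF K W.quot_cong[OF H[OF f] H[OF f'] H[OF g] H[OF g'] e[unfolded vertex_homotopic_def]]])
        (simp_all add: pt_div[OF f g] pt_div[OF f' g'])
  next
    fix x y z w f g h
    assume f: "f \<in> simp (map_space X x y) 0" and g: "g \<in> simp (map_space X x z) 0" and h: "h \<in> simp (map_space X x w) 0"
    show "vertex_homotopic X (bousfield_div X \<mu> (bousfield_div X \<mu> h f) (bousfield_div X \<mu> g f)) (bousfield_div X \<mu> h g)"
      unfolding vertex_homotopic_def
      by (rule homotopic_over_cong[OF K W.quot_quot[OF H[OF f] H[OF g] H[OF h]]])
        (simp_all add: pt_div[OF div_hom[OF h f] div_hom[OF g f]] map_quot_def pt_div[OF h f] pt_div[OF g f] pt_div[OF h g])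
  qed
qed

lemma vertex_triangle:
  assumes t: "\<tau> \<in> bisimp X 2 0"
  shows "vertex_homotopic X (hop X 2 [1, 2] 0 \<tau>) (bousfield_div X \<mu> (hop X 2 [0, 2] 0 \<tau>) (hop X 2 [0, 1] 0 \<tau>))"
proof -
  have K: "is_sset (simplex 0)" by (rule is_sset_simplex)
  have o: "[0, 1] \<in> ord_hom 1 2" "[0, 2] \<in> ord_hom 1 2" "[1, 2] \<in> ord_hom 1 2" by (rule pair_in; simp)+
  note v = hop_edge_vertex[OF _ _ _ t]
  have vin: "hop X 2 [i] 0 \<tau> \<in> bisimp X 0 0" if "i \<le> 2" for i using hop_in[OF bis single_in[OF that] t] .
  have e: "hop X 2 [0, j] 0 \<tau> \<in> simp (map_space X (hop X 2 [0] 0 \<tau>) (hop X 2 [j] 0 \<tau>)) 0" if "j \<le> 2" for j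
    using v[of 0 0 j] v[of 1 0 j] vin that hop_in[OF bis pair_in t, of 0 j] by (intro map_space_vertexI[OF bis]) auto
  show ?thesis
    unfolding vertex_homotopic_def
    by (rule homotopic_over_cong[OF K quot_triangle[OF K pt_smor[OF bis t], of 0 1 2]])
      (simp_all add: pt_div[OF e[of 2] e[of 1]] map_quot_def hop_pt[OF bis o(1) t]
        hop_pt[OF bis o(2) t] hop_pt[OF bis o(3) t])
qed

sublocale V: ward_groupoid "\<lambda>x y f. f \<in> simp (map_space X x y) 0" "vertex_homotopic X" "bousfield_div X \<mu>" "id_edge X"
    "\<lambda>x. x \<in> bisimp X 0 0"
  by (rule ward_vertices)

lemma class_eq_iff:
  assumes "f \<in> simp (map_space X x y) 0" "f' \<in> simp (map_space X x y) 0"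
  shows "pi0_class (map_space X x y) f = pi0_class (map_space X x y) f' \<longleftrightarrow> vertex_homotopic X f f'"
  using pi0_class_eq_iff[OF assms] map_space_pi0[OF bis assms] by simp

lemma class_memD:
  assumes "f' \<in> pi0_class (map_space X x y) f" "f \<in> simp (map_space X x y) 0"
  shows "f' \<in> simp (map_space X x y) 0" "vertex_homotopic X f f'"
proof -
  have r: "(f, f') \<in> pi0_rel (map_space X x y)" using assms(1) by (simp add: pi0_class_def)
  then show f': "f' \<in> simp (map_space X x y) 0" by (simp add: pi0_rel_edge)
  show "vertex_homotopic X f f'" using r map_space_pi0[OF bis assms(2) f'] by simp
qed

lemma Ho_B_Comp:
  "Comp (Ho_B X \<mu>) x y z G F = (\<Union>f \<in> F \<inter> simp (map_space X x y) 0. \<Union>g \<in> G \<inter> simp (map_space X y z) 0.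
    pi0_class (map_space X x z) (V.comp x g f))"
  by (simp add: Ho_B_def V.comp_def)

lemma Ho_B_Comp_class:
  assumes f: "f \<in> simp (map_space X x y) 0" and g: "g \<in> simp (map_space X y z) 0"
  shows "Comp (Ho_B X \<mu>) x y z (pi0_class (map_space X y z) g) (pi0_class (map_space X x y) f) =
    pi0_class (map_space X x z) (V.comp x g f)"
proof -
  let ?F = "pi0_class (map_space X x y) f \<inter> simp (map_space X x y) 0"
  let ?G = "pi0_class (map_space X y z) g \<inter> simp (map_space X y z) 0"
  have fF: "f \<in> ?F" and gG: "g \<in> ?G" using f g pi0_class_self by auto
  have eq: "pi0_class (map_space X x z) (V.comp x g' f') = pi0_class (map_space X x z) (V.comp x g f)"
    if "f' \<in> ?F" "g' \<in> ?G" for f' g'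
  proof -
    have f': "f' \<in> simp (map_space X x y) 0" "vertex_homotopic X f f'" using that(1) class_memD(2)[OF _ f] by auto
    have g': "g' \<in> simp (map_space X y z) 0" "vertex_homotopic X g g'" using that(2) class_memD(2)[OF _ g] by auto
    show ?thesis
      unfolding class_eq_iff[OF V.comp_Hom[OF f'(1) g'(1)] V.comp_Hom[OF f g]]
      by (rule V.comp_cong[OF f'(1) f g'(1) g V.E_sym[OF f'(2)] V.E_sym[OF g'(2)]])
  qed
  have "(\<Union>g'\<in>?G. pi0_class (map_space X x z) (V.comp x g' f')) = pi0_class (map_space X x z) (V.comp x g f)"
    if "f' \<in> ?F" for f'
    by (rule UN_constant_eq[OF gG]) (rule ballI, rule eq[OF that])
  then show ?thesis unfolding Ho_B_Comp by (intro UN_constant_eq[OF fF] ballI)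
qed

lemma Ho_B_simps: "Obj (Ho_B X \<mu>) = bisimp X 0 0" "Hom (Ho_B X \<mu>) x y = pi0 (map_space X x y)"
  "Ident (Ho_B X \<mu>) x = pi0_class (map_space X x x) (id_edge X x)"
  by (simp_all add: Ho_B_def)

theorem Ho_B_groupoid: "is_groupoid (Ho_B X \<mu>)"
proof -
  let ?C = "Ho_B X \<mu>"
  let ?cl = "\<lambda>x y. pi0_class (map_space X x y)"
  have comp: "Comp ?C x y z (?cl y z g) (?cl x y f) = ?cl x z (V.comp x g f)"
    if "f \<in> simp (map_space X x y) 0" "g \<in> simp (map_space X y z) 0" for x y z f g
    by (rule Ho_B_Comp_class[OF that])
  have clI: "?cl x y f = ?cl x y f'"
    if "vertex_homotopic X f f'" "f \<in> simp (map_space X x y) 0" "f' \<in> simp (map_space X x y) 0" for x y f f'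
    using class_eq_iff[OF that(2,3)] that(1) by simp
  have "is_category ?C"
    unfolding is_category_def Ho_B_simps
  proof (intro conjI ballI)
    fix x assume "x \<in> bisimp X 0 0"
    then show "?cl x x (id_edge X x) \<in> pi0 (map_space X x x)" by (intro pi0_class_in V.one_Hom)
  next
    fix x y z F G assume "F \<in> pi0 (map_space X x y)" "G \<in> pi0 (map_space X y z)"
    then obtain f g where f: "f \<in> simp (map_space X x y) 0" "F = ?cl x y f"
      and g: "g \<in> simp (map_space X y z) 0" "G = ?cl y z g" by (elim pi0_cases)
    show "Comp ?C x y z G F \<in> pi0 (map_space X x z)"
      unfolding f(2) g(2) comp[OF f(1) g(1)] by (rule pi0_class_in[OF V.comp_Hom[OF f(1) g(1)]])
  next
    fix x y F assume xy: "x \<in> bisimp X 0 0" "y \<in> bisimp X 0 0" and "F \<in> pi0 (map_space X x y)"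
    then obtain f where f: "f \<in> simp (map_space X x y) 0" "F = ?cl x y f" by (elim pi0_cases)
    note x = V.one_Hom[OF xy(1)] and y = V.one_Hom[OF xy(2)]
    show "Comp ?C x x y F (?cl x x (id_edge X x)) = F"
      unfolding f(2) comp[OF x f(1)] by (rule clI[OF V.comp_one_right[OF f(1)] V.comp_Hom[OF x f(1)] f(1)])
    show "Comp ?C x y y (?cl y y (id_edge X y)) F = F"
      unfolding f(2) comp[OF f(1) y] by (rule clI[OF V.comp_one_left[OF f(1)] V.comp_Hom[OF f(1) y] f(1)])
  next
    fix w x y z F G H
    assume "F \<in> pi0 (map_space X w x)" "G \<in> pi0 (map_space X x y)" "H \<in> pi0 (map_space X y z)"
    then obtain f g h where f: "f \<in> simp (map_space X w x) 0" "F = ?cl w x f"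
      and g: "g \<in> simp (map_space X x y) 0" "G = ?cl x y g"
      and h: "h \<in> simp (map_space X y z) 0" "H = ?cl y z h" by (elim pi0_cases)
    note gf = V.comp_Hom[OF f(1) g(1)] and hg = V.comp_Hom[OF g(1) h(1)]
    show "Comp ?C w x z (Comp ?C x y z H G) F = Comp ?C w y z H (Comp ?C w x y G F)"
      unfolding f(2) g(2) h(2) comp[OF f(1) g(1)] comp[OF g(1) h(1)] comp[OF f(1) hg] comp[OF gf h(1)]
      by (rule clI[OF V.comp_assoc[OF f(1) g(1) h(1)] V.comp_Hom[OF f(1) hg] V.comp_Hom[OF gf h(1)]])
  qed
  moreover have "\<exists>G\<in>Hom ?C y x. Comp ?C x y x G F = Ident ?C x \<and> Comp ?C y x y F G = Ident ?C y"
    if xy: "x \<in> Obj ?C" "y \<in> Obj ?C" and "F \<in> Hom ?C x y" for x y F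
  proof -
    have xy: "x \<in> bisimp X 0 0" "y \<in> bisimp X 0 0" and "F \<in> pi0 (map_space X x y)"
      using that by (simp_all add: Ho_B_simps)
    then obtain f where f: "f \<in> simp (map_space X x y) 0" "F = ?cl x y f" by (elim pi0_cases)
    note x = V.one_Hom[OF xy(1)] and y = V.one_Hom[OF xy(2)] and i = V.inv_Hom[OF f(1)]
    show ?thesis
      unfolding Ho_B_simps f(2)
    proof (intro bexI conjI)
      show "?cl y x (bousfield_div X \<mu> (id_edge X x) f) \<in> pi0 (map_space X y x)" by (rule pi0_class_in[OF i])
      show "Comp ?C x y x (?cl y x (bousfield_div X \<mu> (id_edge X x) f)) (?cl x y f) = ?cl x x (id_edge X x)"
        unfolding comp[OF f(1) i] by (rule clI[OF V.comp_inv_left[OF f(1)] V.comp_Hom[OF f(1) i] x])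
      show "Comp ?C y x y (?cl x y f) (?cl y x (bousfield_div X \<mu> (id_edge X x) f)) = ?cl y y (id_edge X y)"
        unfolding comp[OF i f(1)] by (rule clI[OF V.comp_inv_right[OF f(1)] V.comp_Hom[OF i f(1)] y])
    qed
  qed
  ultimately show ?thesis unfolding is_groupoid_def by blast
qed

text \<open>If \<open>k\<close> is the long edge of the Segal filler of \<open>f\<close> and \<open>g\<close>, then \<open>g \<sim> k/f\<close> by the triangle principle, so
  \<open>g \<circ> f \<sim> (k/f) \<circ> f \<sim> k\<close>. The compositions are unions over the same representatives, so it suffices to
  compare them for each pair of representatives.\<close>

theorem Ho_eq_Ho_B:
  assumes \<eta>: "segal_section X \<eta>"
  shows "Ho X \<eta> = Ho_B X \<mu>"
proof -
  have es: "smor (fibre_pairs X 1) (column X 2) \<eta>"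
    using \<eta> smaps_smor unfolding segal_section_def pairs_fibre by blast
  have ee: "\<forall>m. \<forall>p\<in>simp (fibre_pairs X 1) m. (hop X 2 [0, 1] m (\<eta> m p), hop X 2 [1, 2] m (\<eta> m p)) = p"
    using \<eta> unfolding segal_section_def pairs_fibre hface_hop by blast
  have eq: "pi0_class (map_space X x z) (hface X 2 0 1 (\<eta> 0 (f, g))) = pi0_class (map_space X x z) (V.comp x g f)"
    if f: "f \<in> simp (map_space X x y) 0" and g: "g \<in> simp (map_space X y z) 0" for x y z f g
  proof -
    note fD = map_space_vertexD[OF bis f] and gD = map_space_vertexD[OF bis g]
    have p: "(f, g) \<in> simp (fibre_pairs X 1) 0" using fD gD by simp
    let ?t = "\<eta> 0 (f, g)" let ?k = "hop X 2 [0, 2] 0 ?t"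
    have t: "?t \<in> bisimp X 2 0" using smor_in[OF es p] by simp
    have ed: "hop X 2 [0, 1] 0 ?t = f" "hop X 2 [1, 2] 0 ?t = g" using ee p by blast+
    note v = hop_edge_vertex[OF _ _ _ t]
    have k: "?k \<in> simp (map_space X x z) 0"
    proof (rule map_space_vertexI[OF bis hop_in[OF bis pair_in t] fD(2) gD(3)])
      show "hop X 1 [0] 0 ?k = x" using v[of 0 0 2] v[of 0 0 1] ed fD by simp
      show "hop X 1 [1] 0 ?k = z" using v[of 1 0 2] v[of 1 1 2] ed gD by simp
    qed simp_all
    have "vertex_homotopic X g (bousfield_div X \<mu> ?k f)" using vertex_triangle[OF t] unfolding ed .
    then have "vertex_homotopic X (V.comp x g f) (V.comp x (bousfield_div X \<mu> ?k f) f)"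
      by (rule V.comp_cong[OF f f g div_hom[OF k f] V.E_refl[OF f]])
    also have "vertex_homotopic X (V.comp x (bousfield_div X \<mu> ?k f) f) ?k" by (rule V.quot_comp_cancel[OF f k])
    finally show ?thesis
      unfolding hface_hop class_eq_iff[OF k V.comp_Hom[OF f g]] by (rule V.E_sym)
  qed
  have "Comp (Ho X \<eta>) x y z G F = Comp (Ho_B X \<mu>) x y z G F" for x y z G F
  proof -
    have "Comp (Ho X \<eta>) x y z G F = (\<Union>f \<in> F \<inter> simp (map_space X x y) 0. \<Union>g \<in> G \<inter> simp (map_space X y z) 0.
        pi0_class (map_space X x z) (hface X 2 0 1 (\<eta> 0 (f, g))))" by (simp add: Ho_def)
    also have "\<dots> = Comp (Ho_B X \<mu>) x y z G F"
      unfolding Ho_B_Comp by (intro SUP_cong refl eq) auto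
    finally show ?thesis .
  qed
  then show ?thesis by (simp add: Ho_def Ho_B_def)
qed

end

theorem corollary4p7:
  fixes X :: "'a bisset"
  assumes "bousfield_segal_space X"
  shows "(\<exists>\<mu>. bousfield_section X \<mu>) \<and> (\<exists>\<eta>. segal_section X \<eta>) \<and>
    (\<forall>\<mu> \<eta>. bousfield_section X \<mu> \<and> segal_section X \<eta> \<longrightarrow>
       Ho X \<eta> = Ho_B X \<mu> \<and> is_groupoid (Ho X \<eta>))"
proof (intro conjI allI impI; (elim conjE)?)
  show "\<exists>\<mu>. bousfield_section X \<mu>" by (rule exists_bousfield_section[OF assms])
  then obtain \<mu> where "bousfield_section X \<mu>" by blast
  then interpret bousfield_division X \<mu> using assms by unfold_locales
  show "\<exists>\<eta>. segal_section X \<eta>" by (rule exists_segal_section)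
next
  fix \<mu> \<eta> assume m: "bousfield_section X \<mu>" and e: "segal_section X \<eta>"
  interpret bousfield_division X \<mu> using assms m by unfold_locales
  show "Ho X \<eta> = Ho_B X \<mu>" by (rule Ho_eq_Ho_B[OF e])
  then show "is_groupoid (Ho X \<eta>)" using Ho_B_groupoid by simp
qed

end
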